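(* Let $\Omega\subset\mathbb{R}^N$ be a domain, let $\mathscr{A}$ be an $N\times N$ matrix function on $\Omega$ with complex valued entries in $L^\infty(\Omega)$, let $\varphi:(0,+\infty)\to(0,+\infty)$ satisfy conditions (i)--(v) of the context, and let $Eu=\nabla(\mathscr{A}\nabla u)$. Suppose that the matrix $\operatorname{Im}\mathscr{A}$ is symmetric, i.e. $\operatorname{Im}\mathscr{A}^{t}=\operatorname{Im}\mathscr{A}$. Then the operator $E$ is $L^{\Phi}$-dissipative if and only if $$|s\,\varphi'(s)|\,|\langle \operatorname{Im}\mathscr{A}(x)\,\xi,\xi\rangle|\leq 2\sqrt{\varphi(s)\,[s\,\varphi(s)]'}\;\langle \operatorname{Re}\mathscr{A}(x)\,\xi,\xi\rangle$$ for almost every $x\in\Omega$ and for any $s>0$, $\xi\in\mathbb{R}^N$.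
   Context: Conditions on the positive function $\varphi$ on $(0,+\infty)$: (i) $\varphi\in C^1((0,+\infty))$; (ii) $(s\varphi(s))'>0$ for any $s>0$; (iii) the range of the strictly increasing function $s\mapsto s\varphi(s)$ is $(0,+\infty)$; (iv) there exist positive constants $C_1,C_2$, a real number $r>-1$ and $s_0>0$ such that $C_1 s^r\leq (s\varphi(s))'\leq C_2 s^r$ for $s\in(0,s_0)$; if $r=0$ it is moreover required that the finite limit $\lim_{s\to0^+}\varphi(s)=\varphi_+(0)>0$ exists and that $\lim_{s\to0^+}s\varphi'(s)=0$; (v) there exists $s_1>s_0$ such that either $\varphi'(s)\geq0$ for all $s\geq s_1$, or $\varphi'(s)\leq0$ for all $s\geq s_1$. Notation: $\operatorname{Re}\mathscr{A}$ and $\operatorname{Im}\mathscr{A}$ are the entrywise real and imaginary parts, $\mathscr{A}^t$ is the transpose. $\langle\cdot,\cdot\rangle$ is the standard inner product in $\mathbb{C}^N$ (conjugate linear in the second argument). $\mathring{H}^1(\Omega)$ is the closure of the complex valued functions in $C_0^\infty(\Omega)$ in the $H^1$ norm. The combination $\varphi(|u|)u$ is taken to be $0$ where $u$ vanishes. Definition: with $\Phi(s)=\int_0^s\sigma\varphi(\sigma)\,d\sigma$, the operator $E$ is called $L^\Phi$-dissipative if $$\operatorname{Re}\int_\Omega\langle\mathscr{A}\nabla u,\nabla(\varphi(|u|)\,u)\rangle\,dx\geq0$$ for any complex valued $u\in\mathring{H}^1(\Omega)$ such that $\varphi(|u|)\,u\in\mathring{H}^1(\Omega)$. *)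

theory Defs
  imports "HOL-Analysis.Analysis"
begin

definition cdot :: "complex^'n \<Rightarrow> complex^'n \<Rightarrow> complex" where
  "cdot a b = (\<Sum>i\<in>UNIV. a $ i * cnj (b $ i))"

definition partial_deriv :: "'n::finite \<Rightarrow> (real^'n \<Rightarrow> complex) \<Rightarrow> real^'n \<Rightarrow> complex" where
  "partial_deriv i f x = frechet_derivative f (at x) (axis i 1)"

definition grad :: "(real^'n::finite \<Rightarrow> complex) \<Rightarrow> real^'n \<Rightarrow> complex^'n" where
  "grad f x = (\<chi> i. partial_deriv i f x)"

primrec Ck :: "nat \<Rightarrow> (real^'n::finite \<Rightarrow> complex) \<Rightarrow> bool" where
  "Ck 0 f \<longleftrightarrow> continuous_on UNIV f"
| "Ck (Suc k) f \<longleftrightarrow> (\<forall>x. f differentiable (at x)) \<and> (\<forall>i. Ck k (partial_deriv i f))"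

text \<open>The complex valued functions in \<open>C\<^sub>0\<^sup>\<infinity>(\<Omega>)\<close>, extended by zero to the whole space.\<close>
definition test_function :: "(real^'n::finite) set \<Rightarrow> (real^'n \<Rightarrow> complex) \<Rightarrow> bool" where
  "test_function \<Omega> \<psi> \<longleftrightarrow> (\<forall>k. Ck k \<psi>) \<and>
     compact (closure {x. \<psi> x \<noteq> 0}) \<and> closure {x. \<psi> x \<noteq> 0} \<subseteq> \<Omega>"

definition square_integrable :: "(real^'n::finite) set \<Rightarrow> (real^'n \<Rightarrow> 'b::euclidean_space) \<Rightarrow> bool" where
  "square_integrable \<Omega> f \<longleftrightarrow>
     f \<in> borel_measurable (lebesgue_on \<Omega>) \<and> integrable (lebesgue_on \<Omega>) (\<lambda>x. (norm (f x))\<^sup>2)"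

text \<open>Weak gradients are determined only up to null sets, so they are handled as a relation:
  \<open>has_H1_gradient \<Omega> u g\<close> says that \<open>u\<close> belongs to \<open>H\<^sup>1(\<Omega>)\<close> and that \<open>g\<close> is a version of its
  distributional gradient.\<close>
definition has_H1_gradient ::
    "(real^'n::finite) set \<Rightarrow> (real^'n \<Rightarrow> complex) \<Rightarrow> (real^'n \<Rightarrow> complex^'n) \<Rightarrow> bool" where
  "has_H1_gradient \<Omega> u g \<longleftrightarrow> square_integrable \<Omega> u \<and> square_integrable \<Omega> g \<and>
     (\<forall>\<psi> i. test_function \<Omega> \<psi> \<longrightarrow>
        (LINT x|lebesgue_on \<Omega>. u x * partial_deriv i \<psi> x) = - (LINT x|lebesgue_on \<Omega>. g x $ i * \<psi> x))"

text \<open>The \<open>H\<^sup>1(\<Omega>)\<close> norm of a function \<open>u\<close> with weak gradient \<open>g\<close>.\<close>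
definition H1_norm ::
    "(real^'n::finite) set \<Rightarrow> (real^'n \<Rightarrow> complex) \<Rightarrow> (real^'n \<Rightarrow> complex^'n) \<Rightarrow> real" where
  "H1_norm \<Omega> u g =
     sqrt ((LINT x|lebesgue_on \<Omega>. (norm (u x))\<^sup>2) + (LINT x|lebesgue_on \<Omega>. (norm (g x))\<^sup>2))"

text \<open>\<open>u\<close> lies in the \<open>H\<^sup>1\<close> closure of the test functions and has weak gradient \<open>g\<close>.\<close>
definition has_H10_gradient ::
    "(real^'n::finite) set \<Rightarrow> (real^'n \<Rightarrow> complex) \<Rightarrow> (real^'n \<Rightarrow> complex^'n) \<Rightarrow> bool" where
  "has_H10_gradient \<Omega> u g \<longleftrightarrow> has_H1_gradient \<Omega> u g \<and>
     (\<forall>\<epsilon>>0. \<exists>\<psi>. test_function \<Omega> \<psi> \<and> H1_norm \<Omega> (\<lambda>x. u x - \<psi> x) (\<lambda>x. g x - grad \<psi> x) < \<epsilon>)"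

definition Linfinity_matrix ::
    "(real^'n::finite) set \<Rightarrow> (real^'n \<Rightarrow> complex^'n^'n) \<Rightarrow> bool" where
  "Linfinity_matrix \<Omega> A \<longleftrightarrow> (\<forall>i j. (\<lambda>x. A x $ i $ j) \<in> borel_measurable (lebesgue_on \<Omega>) \<and>
     (\<exists>C. AE x in lebesgue_on \<Omega>. cmod (A x $ i $ j) \<le> C))"

text \<open>Only the values of \<open>\<phi>\<close> and its derivative on the open half line \<open>{0<..}\<close> matter.\<close>
definition admissible :: "(real \<Rightarrow> real) \<Rightarrow> bool" where
  "admissible \<phi> \<longleftrightarrow>
     (\<forall>s>0. \<phi> s > 0) \<and>
     (\<forall>s>0. \<phi> differentiable (at s)) \<and> continuous_on {0<..} (deriv \<phi>) \<and>
     (\<forall>s>0. deriv (\<lambda>t. t * \<phi> t) s > 0) \<and>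
     (\<lambda>s. s * \<phi> s) ` {0<..} = {0<..} \<and>
     (\<exists>C1 C2 r s0. C1 > 0 \<and> C2 > 0 \<and> r > -1 \<and> s0 > 0 \<and>
        (\<forall>s\<in>{0<..<s0}. C1 * s powr r \<le> deriv (\<lambda>t. t * \<phi> t) s \<and>
                       deriv (\<lambda>t. t * \<phi> t) s \<le> C2 * s powr r) \<and>
        (r = 0 \<longrightarrow> (\<exists>L>0. (\<phi> \<longlongrightarrow> L) (at_right 0)) \<and>
                    ((\<lambda>s. s * deriv \<phi> s) \<longlongrightarrow> 0) (at_right 0)) \<and>
        (\<exists>s1>s0. (\<forall>s\<ge>s1. deriv \<phi> s \<ge> 0) \<or> (\<forall>s\<ge>s1. deriv \<phi> s \<le> 0)))"

text \<open>Dissipativity of \<open>E u = div (A grad u)\<close> with respect to \<open>\<Phi>(s) = \<integral>\<^sub>0\<^sup>s \<sigma> \<phi>(\<sigma>) d\<sigma>\<close>;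
  the defining condition involves \<open>E\<close> and \<open>\<Phi>\<close> only through \<open>A\<close> and \<open>\<phi>\<close>.
  Whatever \<open>\<phi> 0\<close> is, the product \<open>\<phi>(|u|) u\<close> below is zero where \<open>u\<close> vanishes.\<close>
definition LPhi_dissipative ::
    "(real^'n::finite) set \<Rightarrow> (real^'n \<Rightarrow> complex^'n^'n) \<Rightarrow> (real \<Rightarrow> real) \<Rightarrow> bool" where
  "LPhi_dissipative \<Omega> A \<phi> \<longleftrightarrow>
     (\<forall>u g h. has_H10_gradient \<Omega> u g \<longrightarrow>
        has_H10_gradient \<Omega> (\<lambda>x. complex_of_real (\<phi> (cmod (u x))) * u x) h \<longrightarrow>
        0 \<le> Re (LINT x|lebesgue_on \<Omega>. cdot (A x *v g x) (h x)))"

end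

theory Submission
  imports Defs
begin

text \<open>Write \<open>u = |u| e\<^sup>i\<^sup>\<theta>\<close> and \<open>e\<^sup>-\<^sup>i\<^sup>\<theta> \<nabla>u = X + i Y\<close> with real vector fields. Where \<open>u \<noteq> 0\<close> the chain rule
  gives \<open>e\<^sup>-\<^sup>i\<^sup>\<theta> \<nabla>(\<phi>(|u|) u) = (s \<phi>)' X + i \<phi> Y\<close> at \<open>s = |u|\<close>, so for symmetric \<open>Im A\<close> the real part of
  the integrand is \<open>(s \<phi>)' \<langle>Re A X, X\<rangle> + \<phi> \<langle>Re A Y, Y\<rangle> - s \<phi>' \<langle>Im A Y, X\<rangle>\<close>. The pointwise inequality
  makes this nonnegative by polarization; where \<open>u = 0\<close> the gradient vanishes almost everywhere.

  Conversely, one tests with \<open>u = \<eta>\<^sup>m (s + (c/n) sin (n\<^sup>2 \<xi> \<bullet> x + \<beta>))\<close>, where \<open>\<eta>\<close> is a smooth bump and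
  \<open>c = \<alpha> + i \<mu>\<close>. After division by \<open>n\<^sup>2\<close> only the oscillating part of the gradient survives, and
  adding the cases \<open>\<beta> = 0\<close> and \<open>\<beta> = \<pi>/2\<close> removes the oscillation because \<open>cos\<^sup>2 + sin\<^sup>2 = 1\<close>.
  Letting \<open>\<eta>\<close> tend to the indicator of an open set leaves the quadratic form above with \<open>X = \<alpha> \<xi>\<close>,
  \<open>Y = \<mu> \<xi>\<close>, which is then nonnegative almost everywhere; \<open>\<alpha> = \<surd>\<phi>\<close> and \<open>\<mu> = \<plusminus>\<surd>(s \<phi>)'\<close> give the inequality.\<close>

section \<open>Smooth functions in the sense of \<open>Ck\<close>\<close>

text \<open>The obstacle is the origin: the map z -> \<phi>(|z|) z is C^1 only away from zero and
  need not be Lipschitz there, because (s \<phi>)' may behave like s^r with r < 0. No chain rule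
  applies to it directly, so sufficiency works with cut-offs near modulus zero and infinity.
  Necessity has to prove that \<phi>(|u|) u is admissible, and this is the purpose of the power
  \<open>m\<close>: if |u| is of order \<eta>^m, then the gradient of \<phi>(|u|) u is of order
  \<eta>^(m (r + 1) - 1), which is bounded once m (r + 1) >= 1. Amplitude c/n freezes the modulus at
  s \<eta>^m in the limit, while frequency n^2 makes the gradient of order n; hence the terms with
  the gradient of \<eta> are lost after the division. The two phases replace a weak convergence
  argument for cos^2: the sum of the two integrands converges pointwise. Parallel X and Y only give
  an inequality for single vectors \<xi>; symmetry of Im A extends it to all pairs. The exceptional
  null set depends on s and \<xi> until density and continuity remove this dependence.\<close>

lemma partial_deriv_eqI:
  "(f has_derivative f') (at x) \<Longrightarrow> partial_deriv i f x = f' (axis i 1)"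
  unfolding partial_deriv_def by (metis frechet_derivative_at)

lemma Ck_SucD: "Ck (Suc k) f \<Longrightarrow> Ck k f"
proof (induction k arbitrary: f)
  case 0
  then show ?case
    by (auto intro!: continuous_at_imp_continuous_on differentiable_imp_continuous_within)
qed auto

lemma Ck_const: "Ck k (\<lambda>x. c)"
proof (induction k arbitrary: c)
  case (Suc k)
  have "partial_deriv i (\<lambda>x. c) = (\<lambda>x. 0)" for i :: 'a
    by (rule ext, rule partial_deriv_eqI) auto
  then show ?case using Suc by simp
qed simp

lemma partial_deriv_add:
  assumes "f differentiable (at x)" "g differentiable (at x)"
  shows "partial_deriv i (\<lambda>x. f x + g x) x = partial_deriv i f x + partial_deriv i g x"
  by (subst partial_deriv_eqI[OF has_derivative_add])
     (use assms in \<open>auto simp: partial_deriv_def frechet_derivative_works\<close>)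

lemma partial_deriv_mult:
  assumes "f differentiable (at x)" "g differentiable (at x)"
  shows "partial_deriv i (\<lambda>x. f x * g x) x = f x * partial_deriv i g x + partial_deriv i f x * g x"
  by (subst partial_deriv_eqI[OF has_derivative_mult])
     (use assms in \<open>auto simp: partial_deriv_def frechet_derivative_works\<close>)

lemma partial_deriv_cnj:
  assumes "f differentiable (at x)"
  shows "partial_deriv i (\<lambda>x. cnj (f x)) x = cnj (partial_deriv i f x)"
  by (subst partial_deriv_eqI[OF has_derivative_cnj])
     (use assms in \<open>auto simp: partial_deriv_def frechet_derivative_works\<close>)

lemma Ck_add: "Ck k f \<Longrightarrow> Ck k g \<Longrightarrow> Ck k (\<lambda>x. f x + g x)"
proof (induction k arbitrary: f g)
  case 0
  then show ?case by (auto intro: continuous_on_add)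
next
  case (Suc k)
  have "partial_deriv i (\<lambda>x. f x + g x) = (\<lambda>x. partial_deriv i f x + partial_deriv i g x)" for i
    using Suc.prems by (auto simp: partial_deriv_add)
  then show ?case using Suc by (auto intro: differentiable_add)
qed

lemma Ck_mult: "Ck k f \<Longrightarrow> Ck k g \<Longrightarrow> Ck k (\<lambda>x. f x * g x)"
proof (induction k arbitrary: f g)
  case 0
  then show ?case by (auto intro: continuous_on_mult)
next
  case (Suc k)
  have "partial_deriv i (\<lambda>x. f x * g x) = (\<lambda>x. f x * partial_deriv i g x + partial_deriv i f x * g x)" for i
    using Suc.prems by (auto simp: partial_deriv_mult)
  moreover have "Ck k f" "Ck k g" using Suc.prems Ck_SucD by blast+
  ultimately show ?case using Suc by (auto intro!: differentiable_mult Ck_add)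
qed

lemma Ck_cnj: "Ck k f \<Longrightarrow> Ck k (\<lambda>x. cnj (f x))"
proof (induction k arbitrary: f)
  case 0
  then show ?case by (auto intro: continuous_on_cnj)
next
  case (Suc k)
  have "partial_deriv i (\<lambda>x. cnj (f x)) = (\<lambda>x. cnj (partial_deriv i f x))" for i
    using Suc.prems by (auto simp: partial_deriv_cnj)
  moreover have "(\<lambda>x. cnj (f x)) differentiable (at x)" for x
    using Suc.prems has_derivative_cnj unfolding differentiable_def Ck.simps by blast
  ultimately show ?case using Suc by auto
qed

lemma Ck_sum: "(\<And>j. j \<in> J \<Longrightarrow> Ck k (f j)) \<Longrightarrow> Ck k (\<lambda>x. \<Sum>j\<in>J. f j x)"
  by (induction J rule: infinite_finite_induct) (auto intro: Ck_const Ck_add)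

lemma Ck_prod: "(\<And>j. j \<in> J \<Longrightarrow> Ck k (f j)) \<Longrightarrow> Ck k (\<lambda>x. \<Prod>j\<in>J. f j x)"
  by (induction J rule: infinite_finite_induct) (auto intro: Ck_const Ck_mult)

lemma Ck_power: "Ck k f \<Longrightarrow> Ck k (\<lambda>x. f x ^ n)"
  by (induction n) (auto intro: Ck_const Ck_mult)

section \<open>Ridge functions as building blocks of smooth functions\<close>

lemma has_derivative_ridge:
  assumes "(h has_real_derivative h') (at (a \<bullet> x + b))"
  shows "((\<lambda>x::real^'n. complex_of_real (h (a \<bullet> x + b))) has_derivative (\<lambda>v. of_real (h' * (a \<bullet> v)))) (at x)"
proof -
  have "((\<lambda>x. h (a \<bullet> x + b)) has_derivative (\<lambda>v. h' * (a \<bullet> v))) (at x)"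
    by (rule has_derivative_compose[where f = "\<lambda>x. a \<bullet> x + b" and g = h and g' = "(*) h'"])
       (use assms in \<open>auto simp: has_field_derivative_def intro!: derivative_eq_intros\<close>)
  then show ?thesis by (rule has_derivative_of_real)
qed

text \<open>A partial derivative of the ridge function of \<open>d j\<close> is a constant times the
  ridge function of \<open>d (Suc j)\<close>. Since \<open>Ck\<close> recurses through partial
  derivatives, the induction needs the whole sequence \<open>d\<close>, with \<open>j\<close>
  generalized.\<close>

lemma Ck_ridge:
  fixes d :: "nat \<Rightarrow> real \<Rightarrow> real"
  assumes d: "\<And>j t. (d j has_real_derivative d (Suc j) t) (at t)"
  shows "Ck k (\<lambda>x::real^'n. complex_of_real (d j (a \<bullet> x + b)))"
proof (induction k arbitrary: j)
  case 0
  have "continuous_on UNIV (d j)" by (meson DERIV_continuous_on d has_field_derivative_at_within)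
  then have "continuous_on UNIV (\<lambda>x::real^'n. d j (a \<bullet> x + b))"
    by (rule continuous_on_compose2) (auto intro!: continuous_intros)
  then show ?case by (auto intro: continuous_intros)
next
  case (Suc k)
  note D = has_derivative_ridge[OF d]
  have "partial_deriv i (\<lambda>x::real^'n. complex_of_real (d j (a \<bullet> x + b))) =
      (\<lambda>x. complex_of_real (d (Suc j) (a \<bullet> x + b)) * of_real (a $ i))" for i
    by (rule ext, subst partial_deriv_eqI[OF D]) (simp add: inner_axis)
  moreover have "(\<lambda>x::real^'n. complex_of_real (d j (a \<bullet> x + b))) differentiable (at x)" for x
    using D unfolding differentiable_def by blast
  ultimately show ?case using Suc by (auto intro!: Ck_mult Ck_const)
qed

text \<open>The class \<open>q(1/t) e\<^sup>-\<^sup>1\<^sup>/\<^sup>t\<close> with polynomial \<open>q\<close> is closed under differentiation.\<close>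
definition flat :: "real poly \<Rightarrow> real \<Rightarrow> real" where
  "flat q t = (if t > 0 then poly q (1 / t) * exp (- (1 / t)) else 0)"

text \<open>This is the right difference quotient of \<open>flat q\<close> at zero. With s = 1/t the
  extra factor turns \<open>q\<close> into \<open>pCons 0 q\<close>, and the exponential beats every
  polynomial at infinity.\<close>

lemma flat_over_tendsto_0: "((\<lambda>t. poly q (1 / t) * exp (- (1 / t)) * (1 / t)) \<longlongrightarrow> 0) (at_right (0::real))"
proof -
  have poly_exp: "((\<lambda>s. poly q s * exp (- s)) \<longlongrightarrow> 0) at_top" for q :: "real poly"
  proof -
    have "((\<lambda>s. \<Sum>i\<le>degree q. coeff q i * (s ^ i / exp s)) \<longlongrightarrow> (\<Sum>i\<le>degree q. coeff q i * 0)) at_top"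
      by (intro tendsto_intros tendsto_power_div_exp_0)
    then show ?thesis
      by (simp add: poly_altdef sum_distrib_left sum_distrib_right exp_minus divide_inverse mult_ac)
  qed
  have "((\<lambda>s. poly (pCons 0 q) s * exp (- s)) \<longlongrightarrow> 0) at_top" by (rule poly_exp)
  moreover have "filterlim (\<lambda>t::real. 1 / t) at_top (at_right 0)"
    using filterlim_inverse_at_top_right by (simp add: divide_inverse)
  ultimately have "((\<lambda>t. poly (pCons 0 q) (1 / t) * exp (- (1 / t))) \<longlongrightarrow> 0) (at_right (0::real))"
    by (rule filterlim_compose)
  then show ?thesis by (simp add: mult_ac)
qed

text \<open>With x = 1/t one has dx/dt = - x^2, so q(x) exp(-x) has the derivative x^2 (q - q')(x)
  exp(-x); the factor \<open>[:0, 0, 1:]\<close> is x^2.\<close>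

lemma DERIV_flat: "(flat q has_real_derivative flat ([:0, 0, 1:] * (q - pderiv q)) t) (at t)"
proof -
  consider "t < 0" | "t = 0" | "t > 0" by linarith
  then show ?thesis
  proof cases
    case 1
    have "((\<lambda>_. 0) has_real_derivative 0) (at t)" by simp
    then have "(flat q has_real_derivative 0) (at t)"
      by (rule has_field_derivative_transform_within_open[of _ _ _ "{..<0}"])
         (use 1 in \<open>auto simp: flat_def\<close>)
    then show ?thesis using 1 by (simp add: flat_def)
  next
    case 3
    have "((\<lambda>t. poly q (1 / t) * exp (- (1 / t))) has_real_derivative
       flat ([:0, 0, 1:] * (q - pderiv q)) t) (at t)"
      using 3
      by (auto simp: flat_def intro!: derivative_eq_intros DERIV_chain'[OF _ poly_DERIV])
         (simp add: field_simps power2_eq_square)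
    then show ?thesis
      by (rule has_field_derivative_transform_within_open[of _ _ _ "{0<..}"])
         (use 3 in \<open>auto simp: flat_def\<close>)
  next
    case 2
    have "((\<lambda>h. (flat q (0 + h) - flat q 0) / h) \<longlongrightarrow> 0) (at 0)"
    proof (rule filterlim_split_at)
      show "((\<lambda>h. (flat q (0 + h) - flat q 0) / h) \<longlongrightarrow> 0) (at_left 0)"
        by (rule tendsto_eventually) (auto simp: flat_def eventually_at_filter)
      show "((\<lambda>h. (flat q (0 + h) - flat q 0) / h) \<longlongrightarrow> 0) (at_right 0)"
        by (rule Lim_transform_eventually[OF flat_over_tendsto_0[of q]])
           (auto simp: flat_def eventually_at_filter divide_inverse)
    qed
    then show ?thesis using 2 by (simp add: DERIV_def flat_def)
  qed
qed

lemma Ck_flat_ridge: "Ck k (\<lambda>x::real^'n. complex_of_real (flat q (a \<bullet> x + b)))"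
  using Ck_ridge[of "\<lambda>j. flat (((\<lambda>q. [:0, 0, 1:] * (q - pderiv q)) ^^ j) q)" k 0 a b] DERIV_flat
  by simp

lemma Ck_sin_ridge: "Ck k (\<lambda>x::real^'n. complex_of_real (sin (a \<bullet> x + b)))"
proof -
  \<comment> \<open>Differentiating a sine shifts its phase by pi/2, so all derivatives fit one
    formula in \<open>j\<close>.\<close>
  have "((\<lambda>t. sin (t + real j * (pi / 2))) has_real_derivative sin (t + real (Suc j) * (pi / 2))) (at t)" for j t
    by (auto intro!: derivative_eq_intros simp: algebra_simps sin_add cos_add add_divide_distrib)
  then show ?thesis
    using Ck_ridge[where d = "\<lambda>j t. sin (t + real j * (pi / 2))" and k = k and j = 0 and a = a and b = b]
    by simp
qed

section \<open>Smooth bumps and almost everywhere inequalities\<close>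

lemma test_functionI:
  assumes "\<And>k. Ck k \<psi>" "compact K" "K \<subseteq> \<Omega>" "\<And>x. x \<notin> K \<Longrightarrow> \<psi> x = 0"
  shows "test_function \<Omega> \<psi>"
proof -
  have "closure {x. \<psi> x \<noteq> 0} \<subseteq> K"
    using assms by (intro closure_minimal) (auto intro: compact_imp_closed)
  moreover from this have "compact (closure {x. \<psi> x \<noteq> 0})"
    using compact_Int_closed[OF assms(2) closed_closure, of "{x. \<psi> x \<noteq> 0}"] by (simp add: Int_absorb1)
  ultimately show ?thesis
    unfolding test_function_def using assms(1,3) by auto
qed

definition bump :: "(real^'n::finite \<Rightarrow> real) \<Rightarrow> (real^'n) set \<Rightarrow> bool" where
  "bump \<eta> U \<longleftrightarrow> test_function U (\<lambda>x. complex_of_real (\<eta> x)) \<and> (\<forall>x. 0 \<le> \<eta> x \<and> \<eta> x \<le> 1)"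

lemma bump_continuous:
  assumes "bump \<eta> U"
  shows "continuous_on UNIV \<eta>"
proof -
  have "Ck 0 (\<lambda>x. complex_of_real (\<eta> x))"
    using assms unfolding bump_def test_function_def by blast
  then have "continuous_on UNIV (\<lambda>x. Re (complex_of_real (\<eta> x)))"
    unfolding Ck.simps by (rule continuous_on_Re)
  then show ?thesis by simp
qed

lemma flat_bounds: "0 \<le> flat 1 t" "flat 1 t \<le> 1"
  by (auto simp: flat_def)

lemma flat_scaled_tendsto: "t > 0 \<Longrightarrow> (\<lambda>k. flat 1 (real (Suc k) * t)) \<longlonglongrightarrow> 1"
proof -
  assume t: "t > 0"
  have "(\<lambda>k. exp (- ((1 / t) * inverse (real (Suc k))))) \<longlonglongrightarrow> exp (- ((1 / t) * 0))"
    by (intro tendsto_intros LIMSEQ_inverse_real_of_nat)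
  moreover have "0 < real (Suc k) * t" for k using t by simp
  ultimately show ?thesis using t by (simp add: flat_def divide_inverse mult.commute del: of_nat_Suc)
qed

text \<open>For positive \<open>c\<close> this is positive exactly on the open box.
  \<open>flat 1\<close> has no plateau; it only tends to 1 at infinity, so the indicator of the box
  is reached by letting \<open>c\<close> grow.\<close>

definition box_bump :: "real^'n \<Rightarrow> real^'n \<Rightarrow> real \<Rightarrow> real^'n::finite \<Rightarrow> real" where
  "box_bump a b c x = (\<Prod>i\<in>UNIV. flat 1 (c * (x $ i - a $ i)) * flat 1 (c * (b $ i - x $ i)))"

lemma Ck_box_bump: "Ck k (\<lambda>x. complex_of_real (box_bump a b c x))"
proof -
  have "Ck k (\<lambda>x. complex_of_real (flat 1 (c * (x $ i - a $ i))))" for i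
    using Ck_flat_ridge[of k 1 "axis i c" "- c * a $ i"]
    by (simp add: inner_axis' algebra_simps)
  moreover have "Ck k (\<lambda>x. complex_of_real (flat 1 (c * (b $ i - x $ i))))" for i
    using Ck_flat_ridge[of k 1 "axis i (-c)" "c * b $ i"]
    by (simp add: inner_axis' algebra_simps)
  ultimately show ?thesis
    unfolding box_bump_def of_real_prod of_real_mult by (intro Ck_prod Ck_mult)
qed

lemma box_bump_bounds: "0 \<le> box_bump a b c x" "box_bump a b c x \<le> 1"
  unfolding box_bump_def by (auto intro!: prod_nonneg prod_le_1 mult_le_one simp: flat_bounds)

lemma box_bump_eq_0:
  assumes "c > 0" "x \<notin> box a b"
  shows "box_bump a b c x = 0"
proof -
  obtain i where "\<not> (a $ i < x $ i \<and> x $ i < b $ i)" using assms(2) by (auto simp: mem_box_cart)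
  then have "flat 1 (c * (x $ i - a $ i)) = 0 \<or> flat 1 (c * (b $ i - x $ i)) = 0"
    using assms(1) by (auto simp: flat_def zero_less_mult_iff)
  then show ?thesis unfolding box_bump_def by (intro prod_zero) auto
qed

lemma box_bump_tendsto:
  assumes "x \<in> box a b"
  shows "(\<lambda>k. box_bump a b (real (Suc k)) x) \<longlonglongrightarrow> 1"
proof -
  have "(\<lambda>k. box_bump a b (real (Suc k)) x) \<longlonglongrightarrow> (\<Prod>i\<in>(UNIV::'a set). 1 * 1)"
    unfolding box_bump_def using assms
    by (intro tendsto_prod tendsto_mult flat_scaled_tendsto) (auto simp: mem_box_cart)
  then show ?thesis by simp
qed

text \<open>By Lindelof, an open set is a countable union of open boxes whose closed hulls stay
  inside it. The k-th bump joins the bumps of the first k boxes, so its support is a finite union of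
  compact boxes, while the sharpness of every box bump grows with k.\<close>

lemma bumps_to_indicator:
  fixes U :: "(real^'n::finite) set"
  assumes "open U"
  obtains \<eta> where "\<And>k. bump (\<eta> k) U" "\<And>x. (\<lambda>k. \<eta> k x) \<longlonglongrightarrow> indicator U x"
proof -
  define \<B> where "\<B> = {B. \<exists>a b. B = box a b \<and> cbox a b \<subseteq> U}"
  have "\<exists>B\<in>\<B>. x \<in> B" if xU: "x \<in> U" for x
  proof -
    obtain a b where "x \<in> box a b" "cbox a b \<subseteq> U"
      using open_contains_cbox[OF assms xU] by metis
    then show ?thesis unfolding \<B>_def by blast
  qed
  moreover have "B \<subseteq> U" if "B \<in> \<B>" for B
    using that box_subset_cbox unfolding \<B>_def by fast
  ultimately have UB: "U = \<Union>\<B>" by auto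
  obtain \<B>' where B': "\<B>' \<subseteq> \<B>" "countable \<B>'" "\<Union>\<B>' = \<Union>\<B>"
    using Lindelof[of \<B>] unfolding \<B>_def by auto
  \<comment> \<open>The empty box \<open>box 1 0\<close> keeps the family nonempty even if
    \<open>U\<close> is empty, so that \<open>from_nat_into\<close> enumerates it.\<close>
  define \<C> where "\<C> = insert (box (1::real^'n) 0) \<B>'"
  have "box (1::real^'n) 0 = {}" "cbox (1::real^'n) 0 = {}"
    by (auto simp: mem_box_cart set_eq_iff)
  then have "box (1::real^'n) 0 \<in> \<B>" "\<Union>\<C> = \<Union>\<B>'"
    unfolding \<C>_def \<B>_def by auto
  then have C: "\<C> \<subseteq> \<B>" "countable \<C>" "\<Union>\<C> = U" "\<C> \<noteq> {}"
    using B' UB by (auto simp: \<C>_def)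
  have "\<forall>j. \<exists>a b. from_nat_into \<C> j = box a b \<and> cbox a b \<subseteq> U"
    using C from_nat_into[OF C(4)] unfolding \<B>_def by blast
  then obtain a b where ab: "\<And>j. from_nat_into \<C> j = box (a j) (b j)" "\<And>j. cbox (a j) (b j) \<subseteq> U"
    by metis
  define \<beta> where "\<beta> j k = box_bump (a j) (b j) (real (Suc k))" for j k
  \<comment> \<open>A smooth substitute for the union: the value lies between each of the first k
    box bumps and 1, and it is 0 where all of them vanish.\<close>
  define \<eta> where "\<eta> k x = 1 - (\<Prod>j<k. (1 - \<beta> j k x))" for k x
  have bnd: "0 \<le> 1 - \<beta> j k x" "1 - \<beta> j k x \<le> 1" for j k x
    using box_bump_bounds unfolding \<beta>_def by auto
  show ?thesis
  proof
    fix k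
    have ck: "Ck m (\<lambda>x. complex_of_real (\<eta> k x))" for m
    proof -
      have "Ck m (\<lambda>x. 1 + (-1) * (\<Prod>j<k. 1 + (-1) * complex_of_real (\<beta> j k x)))"
        unfolding \<beta>_def by (intro Ck_add Ck_mult Ck_const Ck_prod Ck_box_bump)
      then show ?thesis by (simp add: \<eta>_def)
    qed
    have "test_function U (\<lambda>x. complex_of_real (\<eta> k x))"
    proof (rule test_functionI[OF ck, of "\<Union>j<k. cbox (a j) (b j)"])
      fix x assume "x \<notin> (\<Union>j<k. cbox (a j) (b j))"
      then have "\<beta> j k x = 0" if "j < k" for j
        unfolding \<beta>_def using that box_subset_cbox by (intro box_bump_eq_0) auto
      then show "complex_of_real (\<eta> k x) = 0" unfolding \<eta>_def by simp
    qed (use ab in auto)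
    then show "bump (\<eta> k) U"
      unfolding bump_def \<eta>_def using bnd by (auto intro!: prod_nonneg prod_le_1)
  next
    fix x
    show "(\<lambda>k. \<eta> k x) \<longlonglongrightarrow> indicator U x"
    proof (cases "x \<in> U")
      case True
      then obtain j where j: "x \<in> box (a j) (b j)"
        using C ab(1) by (metis UnionE from_nat_into_surj)
      have "\<beta> j k x \<le> \<eta> k x" if "j < k" for k
      proof -
        have "(\<Prod>i<k. (1 - \<beta> i k x)) = (1 - \<beta> j k x) * (\<Prod>i\<in>{..<k} - {j}. (1 - \<beta> i k x))"
          using that by (intro prod.remove) auto
        also have "\<dots> \<le> (1 - \<beta> j k x) * 1"
          using bnd by (intro mult_left_mono prod_le_1) auto
        finally show ?thesis unfolding \<eta>_def by simp
      qed
      then have "\<forall>\<^sub>F k in sequentially. \<beta> j k x \<le> \<eta> k x"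
        by (rule eventually_mono[OF eventually_gt_at_top[of j]])
      moreover have "\<forall>\<^sub>F k in sequentially. \<eta> k x \<le> 1"
        unfolding \<eta>_def using bnd by (intro always_eventually) (simp add: prod_nonneg)
      moreover have "(\<lambda>k. \<beta> j k x) \<longlonglongrightarrow> 1"
        unfolding \<beta>_def by (rule box_bump_tendsto[OF j])
      ultimately show ?thesis using True by (auto intro: tendsto_sandwich[where h = "\<lambda>_. 1"])
    next
      case False
      then have "x \<notin> box (a j) (b j)" for j
        using ab(2)[of j] box_subset_cbox[of "a j" "b j"] by auto
      then have "\<beta> j k x = 0" for j k
        unfolding \<beta>_def by (intro box_bump_eq_0) auto
      then show ?thesis using False unfolding \<eta>_def by simp
    qed
  qed
qed

text \<open>Outer regularity squeezes the set \<open>N\<close> where f is negative between itself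
  and a decreasing sequence of open sets, up to a null set. Dominated convergence then makes the
  integral of f over \<open>N\<close> nonnegative, which forces \<open>N\<close> to be null.\<close>

lemma AE_nonneg_if_open_integrals_nonneg:
  fixes f :: "'a::euclidean_space \<Rightarrow> real"
  assumes f: "integrable lebesgue f"
    and U: "\<And>U. open U \<Longrightarrow> 0 \<le> (LINT x|lebesgue. indicator U x * f x)"
  shows "AE x in lebesgue. 0 \<le> f x"
proof -
  define N where "N = {x. f x < 0}"
  have fm: "f \<in> borel_measurable lebesgue" using f by auto
  have N: "N \<in> sets lebesgue"
    using measurable_sets[OF fm, of "{..<0}"] by (auto simp: N_def vimage_def)
  have "\<exists>T. open T \<and> N \<subseteq> T \<and> T - N \<in> lmeasurable \<and> emeasure lebesgue (T - N) < ennreal (inverse (real (Suc k)))" for k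
    using sets_lebesgue_outer_open[OF N, of "inverse (real (Suc k))"] by force
  then obtain T where T: "\<And>k. open (T k)" "\<And>k. N \<subseteq> T k" "\<And>k. T k - N \<in> lmeasurable"
    "\<And>k. emeasure lebesgue (T k - N) < ennreal (inverse (real (Suc k)))"
    by metis
  \<comment> \<open>Finite intersections of the covers are still open, and being decreasing they
    converge pointwise to \<open>G\<close>.\<close>
  define V where "V k = (\<Inter>j\<le>k. T j)" for k
  define G where "G = (\<Inter>j. T j)"
  have Vm: "open (V k)" "V k \<in> sets lebesgue" for k unfolding V_def using T by (auto intro!: open_INT)
  have Gm: "G \<in> sets lebesgue" unfolding G_def using T(1) by auto
  have null: "emeasure lebesgue (G - N) = 0"
  proof (rule ccontr)
    assume "emeasure lebesgue (G - N) \<noteq> 0"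
    moreover have le: "emeasure lebesgue (G - N) \<le> ennreal (inverse (real (Suc k)))" for k
      using emeasure_mono[of "G - N" "T k - N" lebesgue] T Gm N unfolding G_def
      by (meson Diff_mono INT_lower UNIV_I fmeasurableD less_imp_le order_refl order_trans)
    ultimately obtain r where r: "emeasure lebesgue (G - N) = ennreal r" "r > 0"
      using le[of 0] by (cases "emeasure lebesgue (G - N)") (auto simp: top_unique)
    obtain k where "inverse (real (Suc k)) < r" using reals_Archimedean[OF r(2)] by auto
    then show False using le[of k] r by (simp add: ennreal_le_iff)
  qed
  have "(\<lambda>k. LINT x|lebesgue. indicator (V k) x * f x) \<longlonglongrightarrow> (LINT x|lebesgue. indicator G x * f x)"
  proof (rule integral_dominated_convergence[where w = "\<lambda>x. norm (f x)"])
    show "AE x in lebesgue. (\<lambda>k. indicator (V k) x * f x) \<longlonglongrightarrow> indicator G x * f x"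
    proof (rule AE_I2)
      fix x
      have "\<forall>\<^sub>F k in sequentially. indicator (V k) x = (indicator G x :: real)"
      proof (cases "x \<in> G")
        case False
        then obtain j where "x \<notin> T j" by (auto simp: G_def)
        then have "x \<notin> V k" if "k \<ge> j" for k using that by (auto simp: V_def)
        then show ?thesis using False eventually_mono[OF eventually_ge_at_top[of j]]
          by (simp add: indicator_def)
      qed (auto simp: G_def V_def)
      then show "(\<lambda>k. indicator (V k) x * f x) \<longlonglongrightarrow> indicator G x * f x"
        by (intro tendsto_eventually) (auto elim: eventually_mono)
    qed
    show "(\<lambda>x. indicator (V k) x * f x) \<in> borel_measurable lebesgue" for k
      using fm Vm by (intro borel_measurable_times borel_measurable_indicator)
    show "(\<lambda>x. indicator G x * f x) \<in> borel_measurable lebesgue"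
      using fm Gm by (intro borel_measurable_times borel_measurable_indicator)
  qed (use f in \<open>auto simp: indicator_def\<close>)
  then have "0 \<le> (LINT x|lebesgue. indicator G x * f x)"
    by (rule LIMSEQ_le_const) (use U Vm in auto)
  also have "\<dots> = (LINT x|lebesgue. indicator N x * f x)"
  proof (rule integral_cong_AE)
    have "AE x in lebesgue. x \<notin> G - N"
      using null Gm N by (intro AE_not_in) (auto simp: null_sets_def)
    then show "AE x in lebesgue. indicator G x * f x = indicator N x * f x"
      using T(2) by (auto simp: G_def indicator_def)
  qed (use fm Gm N in auto)
  finally have "(LINT x|lebesgue. - (indicator N x * f x)) \<le> 0"
    by simp
  moreover have int: "integrable lebesgue (\<lambda>x. - (indicator N x * f x))"
    using f N by (intro integrable_minus) (auto intro: integrable_mult_indicator[of _ _ f, simplified])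
  moreover have nn: "AE x in lebesgue. 0 \<le> - (indicator N x * f x)"
    by (auto simp: N_def indicator_def)
  ultimately have "(LINT x|lebesgue. - (indicator N x * f x)) = 0"
    using integral_nonneg_AE[OF nn] by linarith
  then have "AE x in lebesgue. - (indicator N x * f x) = 0"
    using integral_nonneg_eq_0_iff_AE[OF int nn] by blast
  then show ?thesis by (auto simp: N_def indicator_def elim!: eventually_mono split: if_splits)
qed

text \<open>Bumps tending to the indicator of \<open>U \<inter> U0\<close> turn the hypothesis into
  one about integrals over open sets; as bumps lie between 0 and 1, the norm of the integrand is a
  majorant.\<close>

lemma AE_nonneg_if_bump_integrals_nonneg:
  fixes f :: "real^'n::finite \<Rightarrow> real"
  assumes f: "integrable (lebesgue_on U0) f" and "open U0"
    and *: "\<And>\<eta>. bump \<eta> U0 \<Longrightarrow> 0 \<le> (LINT x|lebesgue_on U0. f x * \<eta> x)"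
  shows "AE x in lebesgue_on U0. 0 \<le> f x"
proof -
  have U0: "U0 \<in> sets lebesgue" using \<open>open U0\<close> by auto
  define F where "F x = indicator U0 x * f x" for x
  have F: "integrable lebesgue F"
    using f U0 unfolding F_def by (simp add: integrable_restrict_space)
  have "AE x in lebesgue. 0 \<le> F x"
  proof (rule AE_nonneg_if_open_integrals_nonneg[OF F])
    fix U :: "(real^'n) set" assume "open U"
    then have "open (U \<inter> U0)" using \<open>open U0\<close> by auto
    then obtain \<eta> where \<eta>: "\<And>k. bump (\<eta> k) (U \<inter> U0)" "\<And>x. (\<lambda>k. \<eta> k x) \<longlonglongrightarrow> indicator (U \<inter> U0) x"
      using bumps_to_indicator by metis
    have "bump (\<eta> k) U0" for k using \<eta>(1)[of k] by (auto simp: bump_def test_function_def)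
    then have "0 \<le> (LINT x|lebesgue_on U0. f x * \<eta> k x)" for k using * by blast
    then have nn: "0 \<le> (LINT x|lebesgue. F x * \<eta> k x)" for k
      using U0 by (simp add: integral_restrict_space F_def mult.assoc)
    have "(\<lambda>k. LINT x|lebesgue. F x * \<eta> k x) \<longlonglongrightarrow> (LINT x|lebesgue. F x * indicator (U \<inter> U0) x)"
    proof (rule integral_dominated_convergence[where w = "\<lambda>x. norm (F x)"])
      have "continuous_on UNIV (\<eta> k)" for k using \<eta>(1) by (rule bump_continuous)
      then have "\<eta> k \<in> borel_measurable lebesgue" for k
        by (auto intro!: measurable_completion borel_measurable_continuous_onI)
      then show "(\<lambda>x. F x * \<eta> k x) \<in> borel_measurable lebesgue" for k using F by auto
      show "(\<lambda>x. F x * indicator (U \<inter> U0) x) \<in> borel_measurable lebesgue"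
        using F \<open>open (U \<inter> U0)\<close>
        by (intro borel_measurable_times borel_measurable_indicator) auto
      show "AE x in lebesgue. norm (F x * \<eta> k x) \<le> norm (F x)" for k
        using \<eta>(1)[of k] by (auto simp: bump_def abs_mult intro!: mult_left_le)
    qed (use F \<eta> in \<open>auto intro!: tendsto_intros\<close>)
    then have "0 \<le> (LINT x|lebesgue. F x * indicator (U \<inter> U0) x)"
      by (rule LIMSEQ_le_const) (use nn in auto)
    also have "\<dots> = (LINT x|lebesgue. indicator U x * F x)"
      by (rule Bochner_Integration.integral_cong) (auto simp: F_def indicator_def)
    finally show "0 \<le> (LINT x|lebesgue. indicator U x * F x)" .
  qed
  then show ?thesis
    using U0 by (auto simp: AE_restrict_space_iff F_def indicator_def elim!: eventually_mono)
qed

section \<open>Integration by parts\<close>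

lemma integrable_continuous_compact_support:
  fixes f :: "'a::euclidean_space \<Rightarrow> 'b::euclidean_space"
  assumes "continuous_on UNIV f" "compact K" "\<And>x. x \<notin> K \<Longrightarrow> f x = 0"
  shows "integrable lborel f" "integrable lebesgue f"
proof -
  have "integrable lborel (\<lambda>x. indicator K x *\<^sub>R f x)"
    using assms by (intro borel_integrable_compact) (auto intro: continuous_on_subset)
  moreover have "(\<lambda>x. indicator K x *\<^sub>R f x) = f"
    using assms(3) by (auto simp: indicator_def fun_eq_iff)
  ultimately show "integrable lborel f" by simp
  then show "integrable lebesgue f"
    using integrable_completion[of f lborel] by auto
qed

lemma partial_deriv_outside_support:
  assumes "closed K" "\<And>x. x \<notin> K \<Longrightarrow> f x = 0" "x \<notin> K"
  shows "partial_deriv i f x = 0"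
proof -
  have "((\<lambda>_. 0) has_derivative (\<lambda>_. 0)) (at x)" by simp
  then have "(f has_derivative (\<lambda>_. 0)) (at x)"
    by (rule has_derivative_transform_within_open[where s = "- K"]) (use assms in auto)
  then show ?thesis by (simp add: partial_deriv_eqI)
qed

lemma bounded_if_compact_support:
  fixes f :: "'a::topological_space \<Rightarrow> 'b::real_normed_vector"
  assumes "continuous_on UNIV f" "compact K" "\<And>x. x \<notin> K \<Longrightarrow> f x = 0"
  obtains C where "C \<ge> 0" "\<And>x. norm (f x) \<le> C"
proof -
  have "compact (f ` K)"
    using assms by (intro compact_continuous_image) (auto intro: continuous_on_subset)
  then obtain C where "\<And>y. y \<in> f ` K \<Longrightarrow> norm y \<le> C"
    using compact_imp_bounded[of "f ` K"] bounded_iff[of "f ` K"] by auto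
  then have "norm (f x) \<le> max C 0" for x
    using assms(3)[of x] by (cases "x \<in> K") (auto simp: le_max_iff_disj)
  then show ?thesis using that[of "max C 0"] by simp
qed

lemma has_vector_derivative_line:
  assumes "w differentiable (at (x + t *\<^sub>R axis i 1))"
  shows "((\<lambda>t. w (x + t *\<^sub>R axis i 1)) has_vector_derivative partial_deriv i w (x + t *\<^sub>R axis i 1)) (at t)"
proof -
  let ?y = "x + t *\<^sub>R axis i 1"
  have D: "(w has_derivative frechet_derivative w (at ?y)) (at ?y)"
    using assms by (simp add: frechet_derivative_works)
  have "((\<lambda>t. x + t *\<^sub>R axis i 1) has_derivative (\<lambda>h. h *\<^sub>R axis i 1)) (at t)"
    by (auto intro!: derivative_eq_intros)
  from has_derivative_compose[OF this D] show ?thesis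
    unfolding has_vector_derivative_def partial_deriv_def
    by (simp add: linear_scale[OF has_derivative_linear[OF D]])
qed

lemma has_vector_derivative_quotient:
  assumes "(f has_vector_derivative c) (at x)"
  shows "((\<lambda>h. (f (x + h) - f x) /\<^sub>R h) \<longlongrightarrow> c) (at 0)"
proof -
  have "((\<lambda>h. norm (f (x + h) - f x - h *\<^sub>R c) / norm h) \<longlongrightarrow> 0) (at 0)"
    using assms by (simp add: has_vector_derivative_def has_derivative_at)
  then have "((\<lambda>h. norm ((f (x + h) - f x) /\<^sub>R h - c)) \<longlongrightarrow> 0) (at 0)"
  proof (rule Lim_transform_eventually)
    have "norm (f (x + h) - f x - h *\<^sub>R c) / norm h = norm ((f (x + h) - f x) /\<^sub>R h - c)" if "h \<noteq> 0" for h
    proof -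
      have "(f (x + h) - f x) /\<^sub>R h - c = (f (x + h) - f x - h *\<^sub>R c) /\<^sub>R h"
        using that by (simp add: scaleR_diff_right)
      then show ?thesis by (simp add: divide_inverse mult.commute)
    qed
    then show "\<forall>\<^sub>F h in at 0. norm (f (x + h) - f x - h *\<^sub>R c) / norm h = norm ((f (x + h) - f x) /\<^sub>R h - c)"
      by (auto simp: eventually_at_filter)
  qed
  then show ?thesis by (simp add: tendsto_norm_zero_iff LIM_zero_iff)
qed

text \<open>The difference quotients of \<open>w\<close> integrate to zero by translation invariance.\<close>
lemma integral_partial_deriv_eq_0:
  fixes w :: "real^'n::finite \<Rightarrow> complex"
  assumes diff: "\<And>x. w differentiable (at x)" and cont: "continuous_on UNIV (partial_deriv i w)"
    and K: "compact K" "\<And>x. x \<notin> K \<Longrightarrow> w x = 0"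
  shows "(LINT x|lebesgue. partial_deriv i w x) = 0"
proof -
  define e :: "real^'n" where "e = axis i 1"
  define t where "t k = inverse (real (Suc k))" for k
  define D where "D k x = (1 / t k) *\<^sub>R (w (x + t k *\<^sub>R e) - w x)" for k x
  have t: "0 < t k" "t k \<le> 1" for k unfolding t_def by (auto simp: field_simps)
  have t0: "t \<longlonglongrightarrow> 0" unfolding t_def by (rule LIMSEQ_inverse_real_of_nat)
  have wc: "continuous_on UNIV w"
    using diff by (auto intro!: continuous_at_imp_continuous_on differentiable_imp_continuous_within)
  have wi: "integrable lborel w" using integrable_continuous_compact_support[OF wc K] by simp
  have P0: "x \<notin> K \<Longrightarrow> partial_deriv i w x = 0" for x
    using partial_deriv_outside_support K compact_imp_closed by metis
  obtain C where C: "C \<ge> 0" "\<And>x. norm (partial_deriv i w x) \<le> C"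
    using bounded_if_compact_support[OF cont K(1) P0] by metis
  obtain R where R: "K \<subseteq> cball 0 R"
    using compact_imp_bounded[OF K(1)] unfolding bounded_iff by (metis mem_cball_0 subsetI)
  have line: "((\<lambda>t. w (x + t *\<^sub>R e)) has_vector_derivative partial_deriv i w (x + s *\<^sub>R e)) (at s)" for x s
    unfolding e_def using has_vector_derivative_line diff by blast
  have Dint0: "(LINT x|lborel. D k x) = 0" for k
  proof -
    have sh: "integrable lborel (\<lambda>x. w (t k *\<^sub>R e + x))" "(LINT x|lborel. w (t k *\<^sub>R e + x)) = (LINT x|lborel. w x)"
      using integrable_distr_eq[of "(+) (t k *\<^sub>R e)" lborel borel w]
        integral_distr[of "(+) (t k *\<^sub>R e)" lborel borel w] wi
      by (auto simp: lborel_distr_plus)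
    have "(LINT x|lborel. D k x) = (1 / t k) *\<^sub>R ((LINT x|lborel. w (t k *\<^sub>R e + x)) - (LINT x|lborel. w x))"
      unfolding D_def using wi sh(1) by (simp add: add.commute)
    then show ?thesis using sh(2) by simp
  qed
  \<comment> \<open>The shifts are at most 1, so all quotients are supported in the ball of radius R
    + 1, and the mean value inequality bounds them there by C.\<close>
  have "(\<lambda>k. LINT x|lborel. D k x) \<longlonglongrightarrow> (LINT x|lborel. partial_deriv i w x)"
  proof (rule integral_dominated_convergence[where w = "\<lambda>x. indicator (cball 0 (R + 1)) x *\<^sub>R C"])
    show "partial_deriv i w \<in> borel_measurable lborel" using cont
      by (simp add: borel_measurable_continuous_onI)
    have "continuous_on UNIV (D k)" for k
      unfolding D_def using wc by (auto intro!: continuous_intros intro: continuous_on_compose2[of UNIV w])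
    then show "D k \<in> borel_measurable lborel" for k by (simp add: borel_measurable_continuous_onI)
    show "integrable lborel (\<lambda>x::real^'n. indicator (cball 0 (R + 1)) x *\<^sub>R C)"
      by (rule borel_integrable_compact) auto
    show "AE x in lborel. (\<lambda>k. D k x) \<longlonglongrightarrow> partial_deriv i w x"
    proof (rule AE_I2)
      fix x
      have "((\<lambda>h. (w (x + (0 + h) *\<^sub>R e) - w (x + 0 *\<^sub>R e)) /\<^sub>R h) \<longlongrightarrow> partial_deriv i w (x + 0 *\<^sub>R e)) (at 0)"
        by (rule has_vector_derivative_quotient[OF line])
      moreover have "filterlim t (at 0) sequentially"
        using t0 t(1) by (auto simp: filterlim_at intro!: always_eventually) (metis less_irrefl)
      ultimately have "(\<lambda>k. (w (x + (0 + t k) *\<^sub>R e) - w (x + 0 *\<^sub>R e)) /\<^sub>R t k) \<longlonglongrightarrow> partial_deriv i w (x + 0 *\<^sub>R e)"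
        by (rule filterlim_compose)
      then show "(\<lambda>k. D k x) \<longlonglongrightarrow> partial_deriv i w x" by (simp add: D_def divide_inverse)
    qed
    show "AE x in lborel. norm (D k x) \<le> indicator (cball 0 (R + 1)) x *\<^sub>R C" for k
    proof (rule AE_I2)
      fix x
      have "norm (w (x + t k *\<^sub>R e) - w (x + 0 *\<^sub>R e)) \<le> C * norm (t k - 0)"
        by (rule differentiable_bound[of UNIV "\<lambda>t. w (x + t *\<^sub>R e)" "\<lambda>s h. h *\<^sub>R partial_deriv i w (x + s *\<^sub>R e)"])
           (use line C in \<open>auto simp: has_vector_derivative_def mult.commute[of C] intro!: onorm_le mult_left_mono\<close>)
      then have "norm (D k x) \<le> C" using t[of k] unfolding D_def norm_scaleR by (simp add: field_simps)
      moreover have "D k x = 0" if "x \<notin> cball 0 (R + 1)"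
      proof -
        have "norm (t k *\<^sub>R e) \<le> 1" using t[of k] by (simp add: e_def)
        then have "norm x \<le> norm (x + t k *\<^sub>R e) + 1"
          using norm_triangle_ineq4[of "x + t k *\<^sub>R e" "t k *\<^sub>R e"] by simp
        then have "x \<notin> K" "x + t k *\<^sub>R e \<notin> K" using R that by auto
        then show ?thesis using K(2) by (simp add: D_def)
      qed
      ultimately show "norm (D k x) \<le> indicator (cball 0 (R + 1)) x *\<^sub>R C"
        by (auto simp: indicator_def)
    qed
  qed
  then have "(LINT x|lborel. partial_deriv i w x) = 0"
    unfolding Dint0 by (simp add: LIMSEQ_const_iff)
  then show ?thesis
    using cont by (simp add: integral_completion borel_measurable_continuous_onI)
qed

lemma test_functionD:
  assumes "test_function U \<psi>"
  shows "\<psi> differentiable (at x)" "continuous_on UNIV \<psi>" "continuous_on UNIV (partial_deriv i \<psi>)"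
    "Ck k \<psi>"
proof -
  have "Ck 0 \<psi>" "Ck 1 \<psi>" "Ck k \<psi>" using assms unfolding test_function_def by blast+
  then show "\<psi> differentiable (at x)" "continuous_on UNIV \<psi>" "continuous_on UNIV (partial_deriv i \<psi>)" "Ck k \<psi>"
    by auto
qed

lemma test_function_supportE:
  assumes "test_function U \<psi>"
  obtains K where "compact K" "K \<subseteq> U" "\<And>x. x \<notin> K \<Longrightarrow> \<psi> x = 0" "\<And>x i. x \<notin> K \<Longrightarrow> partial_deriv i \<psi> x = 0"
proof -
  let ?K = "closure {x. \<psi> x \<noteq> 0}"
  have K: "compact ?K" "?K \<subseteq> U" using assms by (auto simp: test_function_def)
  have z: "x \<notin> ?K \<Longrightarrow> \<psi> x = 0" for x using closure_subset[of "{x. \<psi> x \<noteq> 0}"] by blast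
  show ?thesis
    by (rule that[OF K z]) (auto intro: partial_deriv_outside_support[OF _ z])
qed

text \<open>The partial derivative of \<open>f * \<psi>\<close> has integral zero by compact
  support, and since that support lies in \<Omega> the integrals over \<Omega> and over the whole
  space coincide.\<close>

lemma integral_by_parts:
  fixes f \<psi> :: "real^'n::finite \<Rightarrow> complex"
  assumes \<Omega>: "open \<Omega>" and \<psi>: "test_function \<Omega> \<psi>"
    and f: "\<And>x. f differentiable (at x)" "continuous_on UNIV (partial_deriv i f)"
  shows "(LINT x|lebesgue_on \<Omega>. f x * partial_deriv i \<psi> x) = - (LINT x|lebesgue_on \<Omega>. partial_deriv i f x * \<psi> x)"
proof -
  obtain K where K: "compact K" "K \<subseteq> \<Omega>" "\<And>x. x \<notin> K \<Longrightarrow> \<psi> x = 0" "\<And>x i. x \<notin> K \<Longrightarrow> partial_deriv i \<psi> x = 0"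
    using test_function_supportE[OF \<psi>] by metis
  note \<psi>D = test_functionD[OF \<psi>]
  have fc: "continuous_on UNIV f"
    using f(1) by (auto intro!: continuous_at_imp_continuous_on differentiable_imp_continuous_within)
  have ext: "(LINT x|lebesgue_on \<Omega>. h x) = (LINT x|lebesgue. h x)"
    if "\<And>x. x \<notin> K \<Longrightarrow> h x = 0" for h :: "real^'n \<Rightarrow> complex"
  proof -
    have "indicator \<Omega> x *\<^sub>R h x = h x" for x using that[of x] K(2) by (auto simp: indicator_def)
    then show ?thesis using \<Omega> by (simp add: integral_restrict_space)
  qed
  have pd: "partial_deriv i (\<lambda>x. f x * \<psi> x) = (\<lambda>x. f x * partial_deriv i \<psi> x + partial_deriv i f x * \<psi> x)"
    using f \<psi>D by (auto simp: partial_deriv_mult)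
  have "(LINT x|lebesgue. partial_deriv i (\<lambda>x. f x * \<psi> x) x) = 0"
    by (rule integral_partial_deriv_eq_0[OF _ _ K(1)])
       (use f fc \<psi>D K in \<open>auto simp: pd intro!: differentiable_mult continuous_intros\<close>)
  moreover have "integrable lebesgue (\<lambda>x. f x * partial_deriv i \<psi> x)"
    "integrable lebesgue (\<lambda>x. partial_deriv i f x * \<psi> x)"
    using K f fc \<psi>D
    by (auto intro!: integrable_continuous_compact_support(2)[OF _ K(1)] continuous_intros)
  ultimately have "(LINT x|lebesgue. f x * partial_deriv i \<psi> x) + (LINT x|lebesgue. partial_deriv i f x * \<psi> x) = 0"
    unfolding pd by simp
  moreover have "(LINT x|lebesgue_on \<Omega>. f x * partial_deriv i \<psi> x) = (LINT x|lebesgue. f x * partial_deriv i \<psi> x)"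
    "(LINT x|lebesgue_on \<Omega>. partial_deriv i f x * \<psi> x) = (LINT x|lebesgue. partial_deriv i f x * \<psi> x)"
    using K by (auto intro!: ext)
  ultimately show ?thesis by (simp add: eq_neg_iff_add_eq_0)
qed

section \<open>The weak chain rule\<close>

lemma square_integrable_mult:
  fixes f g :: "real^'n::finite \<Rightarrow> complex"
  assumes "square_integrable \<Omega> f" "square_integrable \<Omega> g"
  shows "integrable (lebesgue_on \<Omega>) (\<lambda>x. f x * g x)"
proof (rule Bochner_Integration.integrable_bound)
  show "integrable (lebesgue_on \<Omega>) (\<lambda>x. (norm (f x))\<^sup>2 + (norm (g x))\<^sup>2)"
    using assms by (auto simp: square_integrable_def)
  show "AE x in lebesgue_on \<Omega>. norm (f x * g x) \<le> norm ((norm (f x))\<^sup>2 + (norm (g x))\<^sup>2)"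
  proof (rule AE_I2)
    fix x
    have "2 * (norm (f x) * norm (g x)) \<le> (norm (f x))\<^sup>2 + (norm (g x))\<^sup>2"
      using sum_squares_bound[of "norm (f x)" "norm (g x)"] by simp
    moreover have "0 \<le> norm (f x) * norm (g x)" by simp
    ultimately have "norm (f x) * norm (g x) \<le> (norm (f x))\<^sup>2 + (norm (g x))\<^sup>2" by linarith
    then show "norm (f x * g x) \<le> norm ((norm (f x))\<^sup>2 + (norm (g x))\<^sup>2)"
      by (simp add: norm_mult)
  qed
qed (use assms in \<open>auto simp: square_integrable_def\<close>)

lemma square_integrable_diff:
  fixes f g :: "real^'n::finite \<Rightarrow> 'b::euclidean_space"
  assumes "square_integrable \<Omega> f" "square_integrable \<Omega> g"
  shows "square_integrable \<Omega> (\<lambda>x. f x - g x)"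
  unfolding square_integrable_def
proof
  show "integrable (lebesgue_on \<Omega>) (\<lambda>x. (norm (f x - g x))\<^sup>2)"
  proof (rule Bochner_Integration.integrable_bound)
    show "integrable (lebesgue_on \<Omega>) (\<lambda>x. 2 * (norm (f x))\<^sup>2 + 2 * (norm (g x))\<^sup>2)"
      using assms by (auto simp: square_integrable_def)
    show "AE x in lebesgue_on \<Omega>. norm ((norm (f x - g x))\<^sup>2) \<le> norm (2 * (norm (f x))\<^sup>2 + 2 * (norm (g x))\<^sup>2)"
    proof (rule AE_I2)
      fix x
      have "(norm (f x - g x))\<^sup>2 \<le> (norm (f x) + norm (g x))\<^sup>2"
        by (intro power_mono norm_triangle_ineq4) auto
      also have "\<dots> \<le> 2 * (norm (f x))\<^sup>2 + 2 * (norm (g x))\<^sup>2"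
        using sum_squares_bound[of "norm (f x)" "norm (g x)"] by (simp add: power2_sum)
      finally show "norm ((norm (f x - g x))\<^sup>2) \<le> norm (2 * (norm (f x))\<^sup>2 + 2 * (norm (g x))\<^sup>2)"
        by simp
    qed
  qed (use assms in \<open>auto simp: square_integrable_def\<close>)
qed (use assms in \<open>auto simp: square_integrable_def\<close>)

lemma square_integrable_bound:
  fixes f :: "real^'n::finite \<Rightarrow> 'b::euclidean_space" and g :: "real^'n \<Rightarrow> 'c::euclidean_space"
  assumes "square_integrable \<Omega> f" "g \<in> borel_measurable (lebesgue_on \<Omega>)" "\<And>x. norm (g x) \<le> C * norm (f x)"
  shows "square_integrable \<Omega> g"
  unfolding square_integrable_def
proof
  show "integrable (lebesgue_on \<Omega>) (\<lambda>x. (norm (g x))\<^sup>2)"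
  proof (rule Bochner_Integration.integrable_bound)
    show "integrable (lebesgue_on \<Omega>) (\<lambda>x. C\<^sup>2 * (norm (f x))\<^sup>2)"
      using assms by (auto simp: square_integrable_def)
    show "AE x in lebesgue_on \<Omega>. norm ((norm (g x))\<^sup>2) \<le> norm (C\<^sup>2 * (norm (f x))\<^sup>2)"
    proof (rule AE_I2)
      fix x
      have "(norm (g x))\<^sup>2 \<le> (C * norm (f x))\<^sup>2" using assms(3) by (intro power_mono) auto
      then show "norm ((norm (g x))\<^sup>2) \<le> norm (C\<^sup>2 * (norm (f x))\<^sup>2)" by (simp add: power_mult_distrib)
    qed
  qed (use assms in auto)
qed (use assms in auto)

lemma borel_measurable_vec_nth:
  fixes g :: "'a \<Rightarrow> complex^'n::finite"
  assumes "g \<in> borel_measurable M"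
  shows "(\<lambda>x. g x $ i) \<in> borel_measurable M"
proof -
  have "(\<lambda>v::complex^'n. v $ i) \<in> borel_measurable borel"
    by (intro borel_measurable_continuous_onI continuous_intros)
  with assms show ?thesis by (rule measurable_compose)
qed

lemma square_integrable_vec_nth:
  "square_integrable \<Omega> g \<Longrightarrow> square_integrable \<Omega> (\<lambda>x. (g x :: complex^'n::finite) $ i)"
  by (rule square_integrable_bound[where C = 1])
     (auto simp: square_integrable_def borel_measurable_vec_nth Finite_Cartesian_Product.norm_nth_le)

lemma borel_measurable_continuous_lebesgue_on:
  fixes f :: "real^'n::finite \<Rightarrow> 'b::euclidean_space"
  assumes "continuous_on UNIV f"
  shows "f \<in> borel_measurable (lebesgue_on \<Omega>)"
proof -
  have "f \<in> borel_measurable lebesgue"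
    using assms by (intro measurable_completion) (simp add: borel_measurable_continuous_onI)
  then show ?thesis by (rule measurable_restrict_space1)
qed

lemma square_integrable_continuous_compact_support:
  fixes f :: "real^'n::finite \<Rightarrow> 'b::euclidean_space"
  assumes "open \<Omega>" "continuous_on UNIV f" "compact K" "\<And>x. x \<notin> K \<Longrightarrow> f x = 0"
  shows "square_integrable \<Omega> f"
  unfolding square_integrable_def
proof
  have "integrable lebesgue (\<lambda>x. (norm (f x))\<^sup>2)"
    using assms by (intro integrable_continuous_compact_support[OF _ assms(3)]) (auto intro!: continuous_intros)
  then show "integrable (lebesgue_on \<Omega>) (\<lambda>x. (norm (f x))\<^sup>2)"
    using assms(1) integrable_mult_indicator[of \<Omega> lebesgue "\<lambda>x. (norm (f x))\<^sup>2"]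
    by (simp add: integrable_restrict_space)
qed (use assms in \<open>auto intro: borel_measurable_continuous_lebesgue_on\<close>)

lemma square_integrable_test_function:
  assumes "open \<Omega>" "test_function \<Omega> \<psi>"
  shows "square_integrable \<Omega> \<psi>" "square_integrable \<Omega> (partial_deriv i \<psi>)" "square_integrable \<Omega> (grad \<psi>)"
proof -
  obtain K where K: "compact K" "\<And>x. x \<notin> K \<Longrightarrow> \<psi> x = 0" "\<And>x i. x \<notin> K \<Longrightarrow> partial_deriv i \<psi> x = 0"
    using test_function_supportE[OF assms(2)] by metis
  note D = test_functionD[OF assms(2)]
  have "continuous_on UNIV (grad \<psi>)"
    unfolding grad_def using D(3) by (intro continuous_on_vec_lambda) auto
  then show "square_integrable \<Omega> \<psi>" "square_integrable \<Omega> (partial_deriv i \<psi>)" "square_integrable \<Omega> (grad \<psi>)"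
    using K D by (auto intro!: square_integrable_continuous_compact_support[OF assms(1) _ K(1)]
        simp: grad_def vec_eq_iff)
qed

text \<open>A weighted Young inequality with a free weight t takes the place of Cauchy-Schwarz: a
  large t makes the share of \<open>b\<close> small, and then a large n handles the share of
  \<open>a n\<close>.\<close>

lemma integral_mult_tendsto_0:
  fixes a :: "nat \<Rightarrow> 'a \<Rightarrow> real" and b :: "'a \<Rightarrow> real"
  assumes int: "\<And>n. integrable M (\<lambda>x. (a n x)\<^sup>2)" "integrable M (\<lambda>x. (b x)\<^sup>2)"
    and m: "\<And>n. a n \<in> borel_measurable M" "b \<in> borel_measurable M"
    and lim: "(\<lambda>n. LINT x|M. (a n x)\<^sup>2) \<longlonglongrightarrow> 0"
  shows "(\<lambda>n. LINT x|M. \<bar>a n x * b x\<bar>) \<longlonglongrightarrow> 0"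
proof -
  define A where "A n = (LINT x|M. (a n x)\<^sup>2)" for n
  define B where "B = (LINT x|M. (b x)\<^sup>2)"
  have B: "B \<ge> 0" unfolding B_def by simp
  have bound: "(LINT x|M. \<bar>a n x * b x\<bar>) \<le> t * A n + B / t" if t: "t > 0" for t n
  proof -
    have pt: "\<bar>a n x * b x\<bar> \<le> t * (a n x)\<^sup>2 + (b x)\<^sup>2 / t" for x
    proof -
      have "2 * \<bar>a n x * b x\<bar> \<le> t * (a n x)\<^sup>2 + (b x)\<^sup>2 / t"
        using sum_squares_bound[of "sqrt t * \<bar>a n x\<bar>" "\<bar>b x\<bar> / sqrt t"] t
        by (simp add: power_mult_distrib power_divide abs_mult)
      then show ?thesis using abs_ge_zero[of "a n x * b x"] by linarith
    qed
    have int2: "integrable M (\<lambda>x. t * (a n x)\<^sup>2 + (b x)\<^sup>2 / t)" using int by auto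
    have "integrable M (\<lambda>x. \<bar>a n x * b x\<bar>)"
      by (rule Bochner_Integration.integrable_bound[OF int2])
         (use m pt in \<open>auto intro!: AE_I2 intro: order_trans[OF _ abs_ge_self]\<close>)
    then have "(LINT x|M. \<bar>a n x * b x\<bar>) \<le> (LINT x|M. t * (a n x)\<^sup>2 + (b x)\<^sup>2 / t)"
      by (intro integral_mono int2 pt)
    also have "\<dots> = t * A n + B / t" unfolding A_def B_def using int by simp
    finally show ?thesis .
  qed
  show ?thesis
  proof (rule LIMSEQ_I)
    fix r :: real assume r: "0 < r"
    \<comment> \<open>B + 1 instead of B keeps t positive when B = 0 and makes B / t strictly less
      than r / 2.\<close>
    define t where "t = 2 * (B + 1) / r"
    have t: "t > 0" using r B unfolding t_def by simp
    have Bt: "B / t < r / 2" unfolding t_def using r B by (simp add: field_simps)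
    have "\<forall>\<^sub>F n in sequentially. A n < r / 2 / t"
      using order_tendstoD(2)[OF lim, of "r / 2 / t"] r t unfolding A_def by simp
    then have "\<forall>\<^sub>F n in sequentially. norm ((LINT x|M. \<bar>a n x * b x\<bar>) - 0) < r"
    proof eventually_elim
      case (elim n)
      then have "t * A n < r / 2" using t by (simp add: field_simps)
      moreover have "0 \<le> (LINT x|M. \<bar>a n x * b x\<bar>)" by simp
      ultimately show ?case using bound[OF t, of n] Bt
        unfolding diff_0_right real_norm_def by linarith
    qed
    then show "\<exists>no. \<forall>n\<ge>no. norm ((LINT x|M. \<bar>a n x * b x\<bar>) - 0) < r"
      by (simp add: eventually_sequentially)
  qed
qed

text \<open>Beyond the L^2 convergence built into the definition, passing to a subsequence gives
  convergence of the values almost everywhere. The chain rule needs this because the coefficient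
  \<open>T' (u x)\<close> is merely continuous in the value of u.\<close>

lemma has_H10_gradient_approx:
  assumes \<Omega>: "open \<Omega>" and u: "has_H10_gradient \<Omega> u g"
  obtains \<psi> where "\<And>n. test_function \<Omega> (\<psi> n)"
    "(\<lambda>n. LINT x|lebesgue_on \<Omega>. (norm (\<psi> n x - u x))\<^sup>2) \<longlonglongrightarrow> 0"
    "\<And>i. (\<lambda>n. LINT x|lebesgue_on \<Omega>. (norm (partial_deriv i (\<psi> n) x - g x $ i))\<^sup>2) \<longlonglongrightarrow> 0"
    "AE x in lebesgue_on \<Omega>. (\<lambda>n. \<psi> n x) \<longlonglongrightarrow> u x"
proof -
  have sq: "square_integrable \<Omega> u" "square_integrable \<Omega> g"
    using u by (auto simp: has_H10_gradient_def has_H1_gradient_def)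
  have "\<exists>\<psi>. test_function \<Omega> \<psi> \<and> H1_norm \<Omega> (\<lambda>x. u x - \<psi> x) (\<lambda>x. g x - grad \<psi> x) < inverse (real (Suc n))" for n
    using u unfolding has_H10_gradient_def by simp
  then obtain \<psi> where \<psi>: "\<And>n. test_function \<Omega> (\<psi> n)"
    "\<And>n. H1_norm \<Omega> (\<lambda>x. u x - \<psi> n x) (\<lambda>x. g x - grad (\<psi> n) x) < inverse (real (Suc n))"
    by metis
  define a where "a n = (LINT x|lebesgue_on \<Omega>. (norm (u x - \<psi> n x))\<^sup>2)" for n
  define b where "b n = (LINT x|lebesgue_on \<Omega>. (norm (g x - grad (\<psi> n) x))\<^sup>2)" for n
  have nn: "0 \<le> a n" "0 \<le> b n" for n unfolding a_def b_def by auto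
  have "norm (sqrt (a n + b n)) \<le> inverse (real (Suc n))" for n
    using \<psi>(2)[of n] nn[of n] unfolding H1_norm_def a_def b_def by simp
  then have "(\<lambda>n. sqrt (a n + b n)) \<longlonglongrightarrow> 0"
    by (intro Lim_null_comparison[OF _ LIMSEQ_inverse_real_of_nat] always_eventually) auto
  then have "(\<lambda>n. (sqrt (a n + b n))\<^sup>2) \<longlonglongrightarrow> 0\<^sup>2" by (intro tendsto_power)
  then have ab: "(\<lambda>n. a n + b n) \<longlonglongrightarrow> 0" using nn by simp
  have a0: "a \<longlonglongrightarrow> 0" and b0: "b \<longlonglongrightarrow> 0"
    by (rule Lim_null_comparison[OF _ ab]; use nn in auto)+
  have int: "integrable (lebesgue_on \<Omega>) (\<lambda>x. (norm (u x - \<psi> n x))\<^sup>2)" for n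
    using square_integrable_diff[OF sq(1) square_integrable_test_function(1)[OF \<Omega> \<psi>(1)]]
    by (simp add: square_integrable_def)
  have "\<exists>r::nat \<Rightarrow> nat. strict_mono r \<and>
      (AE x in lebesgue_on \<Omega>. (\<lambda>n. (norm (u x - \<psi> (r n) x))\<^sup>2) \<longlonglongrightarrow> 0)"
    by (rule tendsto_L1_AE_subseq[OF int]) (use a0 in \<open>simp add: a_def[abs_def]\<close>)
  then obtain r :: "nat \<Rightarrow> nat" where r: "strict_mono r"
    "AE x in lebesgue_on \<Omega>. (\<lambda>n. (norm (u x - \<psi> (r n) x))\<^sup>2) \<longlonglongrightarrow> 0"
    by blast
  show ?thesis
  proof
    show "test_function \<Omega> (\<psi> (r n))" for n by (rule \<psi>)
    show "(\<lambda>n. LINT x|lebesgue_on \<Omega>. (norm (\<psi> (r n) x - u x))\<^sup>2) \<longlonglongrightarrow> 0"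
      using LIMSEQ_subseq_LIMSEQ[OF a0 r(1)] by (simp add: a_def o_def norm_minus_commute)
    show "(\<lambda>n. LINT x|lebesgue_on \<Omega>. (norm (partial_deriv i (\<psi> (r n)) x - g x $ i))\<^sup>2) \<longlonglongrightarrow> 0" for i
    proof (rule Lim_null_comparison)
      show "(\<lambda>n. b (r n)) \<longlonglongrightarrow> 0"
        using LIMSEQ_subseq_LIMSEQ[OF b0 r(1)] by (simp add: o_def)
      have d: "square_integrable \<Omega> (\<lambda>x. g x - grad (\<psi> n) x)" for n
        by (intro square_integrable_diff sq square_integrable_test_function[OF \<Omega> \<psi>(1)])
      have "(LINT x|lebesgue_on \<Omega>. (norm (partial_deriv i (\<psi> n) x - g x $ i))\<^sup>2) \<le> b n" for n
        unfolding b_def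
      proof (rule integral_mono)
        show "integrable (lebesgue_on \<Omega>) (\<lambda>x. (norm (g x - grad (\<psi> n) x))\<^sup>2)"
          using d by (simp add: square_integrable_def)
        show "integrable (lebesgue_on \<Omega>) (\<lambda>x. (norm (partial_deriv i (\<psi> n) x - g x $ i))\<^sup>2)"
          using square_integrable_vec_nth[OF d, of n i]
          by (simp add: square_integrable_def grad_def norm_minus_commute)
        show "(norm (partial_deriv i (\<psi> n) x - g x $ i))\<^sup>2 \<le> (norm (g x - grad (\<psi> n) x))\<^sup>2" for x
          using Finite_Cartesian_Product.norm_nth_le[of "g x - grad (\<psi> n) x" i]
          by (intro power_mono) (auto simp: grad_def norm_minus_commute)
      qed
      then show "\<forall>\<^sub>F n in sequentially. norm (LINT x|lebesgue_on \<Omega>. (norm (partial_deriv i (\<psi> (r n)) x - g x $ i))\<^sup>2) \<le> b (r n)"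
        by simp
    qed
    show "AE x in lebesgue_on \<Omega>. (\<lambda>n. \<psi> (r n) x) \<longlonglongrightarrow> u x"
      using r(2)
    proof eventually_elim
      case (elim x)
      then have "(\<lambda>n. sqrt ((norm (u x - \<psi> (r n) x))\<^sup>2)) \<longlonglongrightarrow> sqrt 0" by (intro tendsto_real_sqrt)
      then have "(\<lambda>n. norm (\<psi> (r n) x - u x)) \<longlonglongrightarrow> 0" by (simp add: norm_minus_commute)
      then show ?case by (simp add: tendsto_norm_zero_iff LIM_zero_iff)
    qed
  qed
qed

text \<open>Differentiability is real, not complex, so \<open>T'\<close> takes the direction as an
  argument. The bound makes \<open>T\<close> globally Lipschitz, and together with
  \<open>T 0 = 0\<close> it keeps compositions square integrable on sets of infinite
  measure.\<close>

definition C1_map :: "real \<Rightarrow> (complex \<Rightarrow> complex) \<Rightarrow> (complex \<Rightarrow> complex \<Rightarrow> complex) \<Rightarrow> bool" where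
  "C1_map C T T' \<longleftrightarrow> T 0 = 0 \<and> (\<forall>z. (T has_derivative T' z) (at z)) \<and>
     (\<forall>v. continuous_on UNIV (\<lambda>z. T' z v)) \<and> (\<forall>z v. norm (T' z v) \<le> C * norm v)"

lemma C1_map_bound:
  assumes "C1_map C T T'"
  shows "norm (T z - T w) \<le> C * norm (z - w)"
  by (rule differentiable_bound[of UNIV T T'])
     (use assms in \<open>auto simp: C1_map_def intro: onorm_le has_derivative_at_withinI\<close>)

lemma complex_linear_expand:
  assumes "linear (L :: complex \<Rightarrow> complex)"
  shows "L v = of_real (Re v) * L 1 + of_real (Im v) * L \<i>"
proof -
  have "v = Re v *\<^sub>R 1 + Im v *\<^sub>R \<i>" by (simp add: complex_eq_iff)
  then have "L v = L (Re v *\<^sub>R 1 + Im v *\<^sub>R \<i>)" by simp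
  also have "\<dots> = Re v *\<^sub>R L 1 + Im v *\<^sub>R L \<i>"
    using assms by (simp add: linear_add linear_scale)
  finally show ?thesis by (simp add: scaleR_conv_of_real)
qed

text \<open>This reduces joint continuity and measurability of \<open>T' z v\<close> to continuity
  in \<open>z\<close> for the two fixed directions 1 and i.\<close>

lemma C1_map_expand:
  assumes "C1_map C T T'"
  shows "T' z v = of_real (Re v) * T' z 1 + of_real (Im v) * T' z \<i>"
  using assms has_derivative_linear complex_linear_expand unfolding C1_map_def by blast

lemma C1_map_measurable:
  assumes T: "C1_map C T T'" and "u \<in> borel_measurable M" "v \<in> borel_measurable M"
  shows "(\<lambda>x. T (u x)) \<in> borel_measurable M" "(\<lambda>x. T' (u x) (v x)) \<in> borel_measurable M"
proof -
  have "continuous_on UNIV T"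
    using T unfolding C1_map_def
    by (meson continuous_at_imp_continuous_on has_derivative_continuous)
  then have "T \<in> borel_measurable borel" by (rule borel_measurable_continuous_onI)
  with assms(2) show "(\<lambda>x. T (u x)) \<in> borel_measurable M" by (rule measurable_compose)
  have ofr: "complex_of_real \<in> borel_measurable borel"
    by (intro borel_measurable_continuous_onI continuous_intros)
  have T'm: "(\<lambda>x. T' (u x) w) \<in> borel_measurable M" for w
    using T unfolding C1_map_def
    by (intro measurable_compose[OF assms(2), of "\<lambda>z. T' z w"] borel_measurable_continuous_onI) blast
  then show "(\<lambda>x. T' (u x) (v x)) \<in> borel_measurable M"
    using measurable_compose[OF assms(3) borel_measurable_Re, THEN measurable_compose[OF _ ofr]]
      measurable_compose[OF assms(3) borel_measurable_Im, THEN measurable_compose[OF _ ofr]]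
    by (subst C1_map_expand[OF T])
       (intro borel_measurable_add borel_measurable_times T'm)
qed

lemma C1_map_square_integrable:
  assumes T: "C1_map C T T'" and u: "square_integrable \<Omega> u" and v: "square_integrable \<Omega> v"
  shows "square_integrable \<Omega> (\<lambda>x. T (u x))" "square_integrable \<Omega> (\<lambda>x. T' (u x) (v x))"
proof -
  show "square_integrable \<Omega> (\<lambda>x. T (u x))"
    using C1_map_bound[OF T, of _ 0] T u v
    by (intro square_integrable_bound[OF u, of _ C] C1_map_measurable[OF T])
       (auto simp: square_integrable_def C1_map_def)
  show "square_integrable \<Omega> (\<lambda>x. T' (u x) (v x))"
    using T u v
    by (intro square_integrable_bound[OF v, of _ C] C1_map_measurable[OF T])
       (auto simp: square_integrable_def C1_map_def)
qed

lemma tendsto_integral_if_diff: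
  fixes f :: "nat \<Rightarrow> 'a \<Rightarrow> complex"
  assumes "\<And>n. integrable M (f n)" "integrable M g"
    and "\<And>n. integrable M (h n)" "(\<lambda>n. LINT x|M. h n x) \<longlonglongrightarrow> 0"
    and "\<And>n x. norm (f n x - g x) \<le> h n x"
  shows "(\<lambda>n. LINT x|M. f n x) \<longlonglongrightarrow> (LINT x|M. g x)"
proof -
  have "norm ((LINT x|M. f n x) - (LINT x|M. g x)) \<le> (LINT x|M. h n x)" for n
  proof -
    have "(LINT x|M. f n x) - (LINT x|M. g x) = (LINT x|M. f n x - g x)"
      using assms by simp
    also have "norm \<dots> \<le> (LINT x|M. norm (f n x - g x))" by (rule integral_norm_bound)
    also have "\<dots> \<le> (LINT x|M. h n x)" using assms by (intro integral_mono) auto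
    finally show ?thesis .
  qed
  then have "(\<lambda>n. (LINT x|M. f n x) - (LINT x|M. g x)) \<longlonglongrightarrow> 0"
    by (intro Lim_null_comparison[OF _ assms(4)] always_eventually) auto
  then show ?thesis by (simp add: LIM_zero_iff)
qed

text \<open>For test functions the formula is classical integration by parts, and it survives
  approximation. On the left the Lipschitz bound of \<open>T\<close> suffices; on the right the base
  point and the direction are changed one after the other.\<close>

lemma weak_chain_rule:
  fixes \<Omega> :: "(real^'n::finite) set"
  assumes \<Omega>: "open \<Omega>" and u: "has_H10_gradient \<Omega> u g" and T: "C1_map C T T'" and \<zeta>: "test_function \<Omega> \<zeta>"
  shows "(LINT x|lebesgue_on \<Omega>. T (u x) * partial_deriv i \<zeta> x) = - (LINT x|lebesgue_on \<Omega>. T' (u x) (g x $ i) * \<zeta> x)"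
proof -
  let ?M = "lebesgue_on \<Omega>"
  obtain \<psi> where \<psi>: "\<And>n. test_function \<Omega> (\<psi> n)"
    "(\<lambda>n. LINT x|?M. (norm (\<psi> n x - u x))\<^sup>2) \<longlonglongrightarrow> 0"
    "\<And>i. (\<lambda>n. LINT x|?M. (norm (partial_deriv i (\<psi> n) x - g x $ i))\<^sup>2) \<longlonglongrightarrow> 0"
    "AE x in ?M. (\<lambda>n. \<psi> n x) \<longlonglongrightarrow> u x"
    by (rule has_H10_gradient_approx[OF \<Omega> u]) (rule that, assumption+)
  have C: "C \<ge> 0" using T norm_ge_zero[of "T' 0 1"] unfolding C1_map_def
    by (metis mult.right_neutral norm_one order_trans)
  have su: "square_integrable \<Omega> u" and sg: "square_integrable \<Omega> (\<lambda>x. g x $ i)"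
    using u square_integrable_vec_nth by (auto simp: has_H10_gradient_def has_H1_gradient_def)
  note s\<psi> = square_integrable_test_function[OF \<Omega> \<psi>(1)]
  note s\<zeta> = square_integrable_test_function[OF \<Omega> \<zeta>]
  have si: "integrable ?M (\<lambda>x. (norm (f x))\<^sup>2)" "f \<in> borel_measurable ?M"
    if "square_integrable \<Omega> f" for f :: "real^'n \<Rightarrow> complex"
    using that by (auto simp: square_integrable_def)
  have prod0: "(\<lambda>n. LINT x|?M. C * \<bar>norm (a n x) * norm (b x)\<bar>) \<longlonglongrightarrow> 0"
    if "\<And>n. square_integrable \<Omega> (a n)" "square_integrable \<Omega> b" "(\<lambda>n. LINT x|?M. (norm (a n x))\<^sup>2) \<longlonglongrightarrow> 0"
    for a :: "nat \<Rightarrow> real^'n \<Rightarrow> complex" and b :: "real^'n \<Rightarrow> complex"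
    using integral_mult_tendsto_0[where a = "\<lambda>n x. norm (a n x)" and b = "\<lambda>x. norm (b x)" and M = ?M]
      si(1)[OF that(1)] si(1)[OF that(2)] si(2)[OF that(1)] si(2)[OF that(2)] that(3)
    by (auto intro!: tendsto_mult_right_zero)
  have prodi: "integrable ?M (\<lambda>x. C * \<bar>norm (a x) * norm (b x)\<bar>)"
    if "square_integrable \<Omega> a" "square_integrable \<Omega> b" for a b :: "real^'n \<Rightarrow> complex"
    using integrable_norm[OF square_integrable_mult[OF that]] by (simp add: norm_mult)
  have lim1: "(\<lambda>n. LINT x|?M. T (\<psi> n x) * partial_deriv i \<zeta> x) \<longlonglongrightarrow> (LINT x|?M. T (u x) * partial_deriv i \<zeta> x)"
  proof (rule tendsto_integral_if_diff)
    show "(\<lambda>n. LINT x|?M. C * \<bar>norm (\<psi> n x - u x) * norm (partial_deriv i \<zeta> x)\<bar>) \<longlonglongrightarrow> 0"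
      by (intro prod0 square_integrable_diff s\<psi> su s\<zeta> \<psi>)
    show "norm (T (\<psi> n x) * partial_deriv i \<zeta> x - T (u x) * partial_deriv i \<zeta> x)
        \<le> C * \<bar>norm (\<psi> n x - u x) * norm (partial_deriv i \<zeta> x)\<bar>" for n x
    proof -
      have "norm (T (\<psi> n x) - T (u x)) * norm (partial_deriv i \<zeta> x)
          \<le> (C * norm (\<psi> n x - u x)) * norm (partial_deriv i \<zeta> x)"
        by (intro mult_right_mono C1_map_bound[OF T]) auto
      then show ?thesis by (simp add: norm_mult mult.assoc flip: left_diff_distrib)
    qed
  qed (intro prodi square_integrable_mult C1_map_square_integrable(1)[OF T _ su] square_integrable_diff s\<psi> s\<zeta> su)+
  \<comment> \<open>Changing the direction: \<open>T'\<close> is linear and bounded in it, so L^2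
    convergence of the gradients is enough.\<close>
  have lim2: "(\<lambda>n. LINT x|?M. T' (\<psi> n x) (partial_deriv i (\<psi> n) x) * \<zeta> x - T' (\<psi> n x) (g x $ i) * \<zeta> x) \<longlonglongrightarrow> (LINT x|?M. 0)"
  proof (rule tendsto_integral_if_diff)
    show "(\<lambda>n. LINT x|?M. C * \<bar>norm (partial_deriv i (\<psi> n) x - g x $ i) * norm (\<zeta> x)\<bar>) \<longlonglongrightarrow> 0"
      by (intro prod0 square_integrable_diff s\<psi> sg s\<zeta> \<psi>)
    fix n x
    have "T' (\<psi> n x) (partial_deriv i (\<psi> n) x) - T' (\<psi> n x) (g x $ i) = T' (\<psi> n x) (partial_deriv i (\<psi> n) x - g x $ i)"
      using T has_derivative_linear linear_diff unfolding C1_map_def by metis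
    then have "norm (T' (\<psi> n x) (partial_deriv i (\<psi> n) x) * \<zeta> x - T' (\<psi> n x) (g x $ i) * \<zeta> x - 0)
      = norm (T' (\<psi> n x) (partial_deriv i (\<psi> n) x - g x $ i)) * norm (\<zeta> x)"
      by (simp flip: left_diff_distrib norm_mult)
    also have "\<dots> \<le> (C * norm (partial_deriv i (\<psi> n) x - g x $ i)) * norm (\<zeta> x)"
      using T unfolding C1_map_def by (intro mult_right_mono) auto
    finally show "norm (T' (\<psi> n x) (partial_deriv i (\<psi> n) x) * \<zeta> x - T' (\<psi> n x) (g x $ i) * \<zeta> x - 0)
      \<le> C * \<bar>norm (partial_deriv i (\<psi> n) x - g x $ i) * norm (\<zeta> x)\<bar>" by simp
  qed (intro prodi Bochner_Integration.integrable_diff Bochner_Integration.integrable_zero square_integrable_mult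
      C1_map_square_integrable(2)[OF T] square_integrable_diff s\<psi> s\<zeta> su sg)+
  \<comment> \<open>Changing the base point: there is no modulus of continuity for
    \<open>T'\<close>, so convergence almost everywhere and domination are used, with the direction
    already frozen at the gradient of u.\<close>
  have lim3: "(\<lambda>n. LINT x|?M. T' (\<psi> n x) (g x $ i) * \<zeta> x) \<longlonglongrightarrow> (LINT x|?M. T' (u x) (g x $ i) * \<zeta> x)"
  proof (rule integral_dominated_convergence[where w = "\<lambda>x. C * \<bar>norm (g x $ i) * norm (\<zeta> x)\<bar>"])
    show "AE x in ?M. (\<lambda>n. T' (\<psi> n x) (g x $ i) * \<zeta> x) \<longlonglongrightarrow> T' (u x) (g x $ i) * \<zeta> x"
      using \<psi>(4)
    proof eventually_elim
      case (elim x)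
      have "isCont (\<lambda>z. T' z (g x $ i)) (u x)"
        using T unfolding C1_map_def by (metis continuous_on_eq_continuous_at open_UNIV UNIV_I)
      then have "(\<lambda>n. T' (\<psi> n x) (g x $ i)) \<longlonglongrightarrow> T' (u x) (g x $ i)"
        using elim by (rule isCont_tendsto_compose)
      then show ?case by (intro tendsto_intros)
    qed
    show "AE x in ?M. norm (T' (\<psi> n x) (g x $ i) * \<zeta> x) \<le> C * \<bar>norm (g x $ i) * norm (\<zeta> x)\<bar>" for n
    proof (rule AE_I2)
      fix x
      have "norm (T' (\<psi> n x) (g x $ i)) * norm (\<zeta> x) \<le> (C * norm (g x $ i)) * norm (\<zeta> x)"
        using T unfolding C1_map_def by (intro mult_right_mono) auto
      then show "norm (T' (\<psi> n x) (g x $ i) * \<zeta> x) \<le> C * \<bar>norm (g x $ i) * norm (\<zeta> x)\<bar>"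
        by (simp add: norm_mult)
    qed
  qed (intro borel_measurable_times C1_map_measurable(2)[OF T] prodi si s\<psi> s\<zeta> su sg)+
  have "(LINT x|?M. T (\<psi> n x) * partial_deriv i \<zeta> x) = - (LINT x|?M. T' (\<psi> n x) (partial_deriv i (\<psi> n) x) * \<zeta> x)" for n
  proof -
    note D = test_functionD[OF \<psi>(1)[of n]]
    have T\<psi>: "((\<lambda>x. T (\<psi> n x)) has_derivative (\<lambda>v. T' (\<psi> n x) (frechet_derivative (\<psi> n) (at x) v))) (at x)" for x
      using D(1)[of x] T unfolding C1_map_def
      by (intro has_derivative_compose[of "\<psi> n" _ _ _ T]) (auto simp: frechet_derivative_works)
    then have pd: "partial_deriv i (\<lambda>x. T (\<psi> n x)) = (\<lambda>x. T' (\<psi> n x) (partial_deriv i (\<psi> n) x))"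
      using partial_deriv_eqI[OF T\<psi>] by (simp add: partial_deriv_def fun_eq_iff)
    have "continuous_on UNIV (\<lambda>x. T' (\<psi> n x) w)" for w
    proof -
      have "continuous_on UNIV (\<lambda>z. T' z w)" using T unfolding C1_map_def by blast
      from continuous_on_compose2[OF this D(2)] show ?thesis by simp
    qed
    then have "continuous_on UNIV (\<lambda>x. T' (\<psi> n x) (partial_deriv i (\<psi> n) x))"
      using D(3) by (subst C1_map_expand[OF T]) (intro continuous_intros)
    then show ?thesis
      using integral_by_parts[OF \<Omega> \<zeta>, of "\<lambda>x. T (\<psi> n x)" i] T\<psi> unfolding pd differentiable_def by blast
  qed
  then have "(\<lambda>n. LINT x|?M. T (\<psi> n x) * partial_deriv i \<zeta> x) =
    (\<lambda>n. - ((LINT x|?M. T' (\<psi> n x) (partial_deriv i (\<psi> n) x) * \<zeta> x - T' (\<psi> n x) (g x $ i) * \<zeta> x) + (LINT x|?M. T' (\<psi> n x) (g x $ i) * \<zeta> x)))"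
    by (subst Bochner_Integration.integral_diff)
       (auto intro!: square_integrable_mult C1_map_square_integrable[OF T] s\<psi> s\<zeta> su sg)
  also have "\<dots> \<longlonglongrightarrow> - ((LINT x|?M. 0) + (LINT x|?M. T' (u x) (g x $ i) * \<zeta> x))"
    by (intro tendsto_intros lim2 lim3)
  finally show ?thesis using lim1 LIMSEQ_unique by fastforce
qed

section \<open>Cut-offs and radial maps of the plane\<close>

text \<open>On [0, 1] this is 2 t^2 - t^4, which meets the constants 0 and 1 with derivative zero.
  The nested positive parts give a single formula, so that the chain rule with
  \<open>DERIV_max_0_square\<close> covers the whole line.\<close>

definition step :: "real \<Rightarrow> real" where
  "step t = 1 - (max 0 (1 - (max 0 t)\<^sup>2))\<^sup>2"

definition step' :: "real \<Rightarrow> real" where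
  "step' t = 4 * max 0 (1 - (max 0 t)\<^sup>2) * max 0 t"

lemma DERIV_max_0_square: "((\<lambda>t. (max 0 t)\<^sup>2) has_real_derivative 2 * max 0 t) (at t)"
proof -
  consider "t < 0" | "t = 0" | "t > 0" by linarith
  then show ?thesis
  proof cases
    case 1
    have "((\<lambda>_. 0) has_real_derivative 2 * max 0 t) (at t)" using 1 by simp
    then show ?thesis
      by (rule has_field_derivative_transform_within_open[of _ _ _ "{..<0}"]) (use 1 in auto)
  next
    case 2
    have "((\<lambda>h::real. max 0 h) \<longlongrightarrow> max 0 0) (at 0)" by (intro tendsto_intros)
    then have "((\<lambda>h::real. max 0 h) \<longlongrightarrow> 0) (at 0)" by simp
    then have "((\<lambda>h::real. (max 0 (0 + h))\<^sup>2 / h) \<longlongrightarrow> 0) (at 0)"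
      by (rule Lim_transform_eventually)
         (auto simp: eventually_at_filter max_def power2_eq_square)
    then show ?thesis using 2 by (simp add: DERIV_def)
  next
    case 3
    have "((\<lambda>t. t\<^sup>2) has_real_derivative 2 * max 0 t) (at t)"
      using 3 by (auto intro!: derivative_eq_intros)
    then show ?thesis
      by (rule has_field_derivative_transform_within_open[of _ _ _ "{0<..}"]) (use 3 in auto)
  qed
qed

lemma DERIV_step: "(step has_real_derivative step' t) (at t)"
proof -
  have "((\<lambda>t. (max 0 (1 - (max 0 t)\<^sup>2))\<^sup>2) has_real_derivative 2 * max 0 (1 - (max 0 t)\<^sup>2) * (0 - 2 * max 0 t)) (at t)"
    by (intro DERIV_chain2[OF DERIV_max_0_square] DERIV_diff DERIV_const DERIV_max_0_square)
  then have "((\<lambda>t. 1 - (max 0 (1 - (max 0 t)\<^sup>2))\<^sup>2) has_real_derivative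
      0 - 2 * max 0 (1 - (max 0 t)\<^sup>2) * (0 - 2 * max 0 t)) (at t)"
    by (intro DERIV_diff DERIV_const)
  then show ?thesis unfolding step_def step'_def by (simp add: mult.assoc)
qed

lemma continuous_step': "continuous_on S step'"
  unfolding step'_def by (intro continuous_intros)

lemma step_bounds: "0 \<le> step t" "step t \<le> 1"
proof -
  have "(max 0 (1 - (max 0 t)\<^sup>2))\<^sup>2 \<le> 1" by (intro power_le_one) auto
  then show "0 \<le> step t" "step t \<le> 1" by (auto simp: step_def)
qed

lemma step_eq: "t \<le> 0 \<Longrightarrow> step t = 0" "t \<le> 0 \<Longrightarrow> step' t = 0" "1 \<le> t \<Longrightarrow> step t = 1" "1 \<le> t \<Longrightarrow> step' t = 0"
proof -
  have "max 0 (1 - (max 0 t)\<^sup>2) = 0" if "1 \<le> t" using that one_le_power[of t 2] by simp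
  then show "t \<le> 0 \<Longrightarrow> step t = 0" "t \<le> 0 \<Longrightarrow> step' t = 0" "1 \<le> t \<Longrightarrow> step t = 1" "1 \<le> t \<Longrightarrow> step' t = 0"
    by (simp_all add: step_def step'_def)
qed

lemma step'_bound: "\<bar>step' t\<bar> \<le> 4"
proof (cases "0 < t \<and> t < 1")
  case True
  then have "t\<^sup>2 \<le> 1" by (intro power_le_one) auto
  then have "max 0 (1 - t\<^sup>2) * t \<le> 1 * 1" using True by (intro mult_mono) auto
  then show ?thesis using True by (simp add: step'_def abs_mult)
qed (auto simp: step_eq not_less)

text \<open>Equal to 1 on [2/(k+1), k+1] and to 0 outside [1/(k+1), 2(k+1)]. The argument is meant
  to be a squared modulus. Both transitions happen on a multiplicative scale.\<close>

definition cutoff :: "nat \<Rightarrow> real \<Rightarrow> real" where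
  "cutoff k t = step (real (Suc k) * t - 1) * (1 - step (t / real (Suc k) - 1))"

definition cutoff' :: "nat \<Rightarrow> real \<Rightarrow> real" where
  "cutoff' k t = real (Suc k) * step' (real (Suc k) * t - 1) * (1 - step (t / real (Suc k) - 1))
     - step (real (Suc k) * t - 1) * (step' (t / real (Suc k) - 1) / real (Suc k))"

lemma DERIV_cutoff: "(cutoff k has_real_derivative cutoff' k t) (at t)"
proof -
  have "((\<lambda>t. step (real (Suc k) * t - 1)) has_real_derivative step' (real (Suc k) * t - 1) * real (Suc k)) (at t)"
    by (rule DERIV_chain2[OF DERIV_step]) (auto intro!: derivative_eq_intros)
  moreover have "((\<lambda>t. step (t / real (Suc k) - 1)) has_real_derivative step' (t / real (Suc k) - 1) * (1 / real (Suc k))) (at t)"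
    by (rule DERIV_chain2[OF DERIV_step]) (auto intro!: derivative_eq_intros)
  ultimately show ?thesis
    unfolding cutoff_def cutoff'_def
    by (auto intro!: derivative_eq_intros simp: mult.commute)
qed

lemma continuous_cutoff': "continuous_on S (cutoff' k)"
proof -
  have "continuous_on UNIV step" using DERIV_step by (intro DERIV_continuous_on) (auto intro: has_field_derivative_at_within)
  then have 1: "continuous_on S (\<lambda>x. step (g x))" if "continuous_on S g" for g
    using continuous_on_compose2[OF _ that, of UNIV step] \<open>continuous_on UNIV step\<close> by simp
  have 2: "continuous_on S (\<lambda>x. step' (g x))" if "continuous_on S g" for g
    using continuous_on_compose2[OF continuous_step'[of UNIV] that] by simp
  show ?thesis
    unfolding cutoff'_def
    by (intro 1 2 continuous_on_diff continuous_on_mult continuous_on_divide continuous_on_const continuous_on_id) auto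
qed

lemma cutoff_bounds: "0 \<le> cutoff k t" "cutoff k t \<le> 1"
  unfolding cutoff_def using step_bounds by (auto intro!: mult_nonneg_nonneg mult_le_one)

lemma cutoff_eq_0:
  assumes "real (Suc k) * t \<le> 1 \<or> 2 * real (Suc k) \<le> t"
  shows "cutoff k t = 0" "cutoff' k t = 0"
proof -
  have "real (Suc k) * t - 1 \<le> 0 \<or> 1 \<le> t / real (Suc k) - 1"
    using assms by (auto simp: field_simps)
  then show "cutoff k t = 0" "cutoff' k t = 0"
    unfolding cutoff_def cutoff'_def using step_eq by auto
qed

lemma cutoff_eq_1:
  assumes "2 \<le> real (Suc k) * t" "t \<le> real (Suc k)"
  shows "cutoff k t = 1" "cutoff' k t = 0"
proof -
  have "1 \<le> real (Suc k) * t - 1" "t / real (Suc k) - 1 \<le> 0" using assms by (auto simp: field_simps)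
  then show "cutoff k t = 1" "cutoff' k t = 0"
    unfolding cutoff_def cutoff'_def using step_eq by auto
qed

lemma eventually_cutoff_eq_1:
  assumes "t > 0"
  shows "\<forall>\<^sub>F k in sequentially. cutoff k t = 1 \<and> cutoff' k t = 0"
proof -
  obtain n :: nat where n: "max t (2 / t) \<le> real n" using real_arch_simple by blast
  have "cutoff k t = 1 \<and> cutoff' k t = 0" if "k \<ge> n" for k
  proof -
    have "t \<le> real (Suc k)" "2 / t \<le> real (Suc k)" using n that by auto
    then show ?thesis using assms cutoff_eq_1[of k t] by (auto simp: field_simps)
  qed
  then show ?thesis using eventually_sequentially by auto
qed

text \<open>Scale invariance makes the bound independent of \<open>k\<close>, as dominated
  convergence along the cut-offs requires. Each transition contributes at most 2 * 4: the derivative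
  of the step is at most 4 and vanishes once the rescaled variable exceeds 2.\<close>

lemma cutoff'_bound: "\<bar>t * cutoff' k t\<bar> \<le> 16"
proof (cases "0 \<le> t")
  case True
  have a: "\<bar>t * (real (Suc k) * step' (real (Suc k) * t - 1) * (1 - step (t / real (Suc k) - 1)))\<bar> \<le> 8"
  proof (cases "real (Suc k) * t \<le> 2")
    case True
    have "\<bar>real (Suc k) * t * step' (real (Suc k) * t - 1) * (1 - step (t / real (Suc k) - 1))\<bar> \<le> 2 * 4 * 1"
      unfolding abs_mult using True \<open>0 \<le> t\<close> step_bounds step'_bound
      by (intro mult_mono) (auto simp: abs_mult)
    then show ?thesis by (simp add: mult_ac)
  qed (simp add: step_eq)
  have b: "\<bar>t * (step (real (Suc k) * t - 1) * (step' (t / real (Suc k) - 1) / real (Suc k)))\<bar> \<le> 8"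
  proof (cases "t / real (Suc k) \<le> 2")
    case True
    have "\<bar>t / real (Suc k) * step' (t / real (Suc k) - 1) * step (real (Suc k) * t - 1)\<bar> \<le> 2 * 4 * 1"
      unfolding abs_mult using True \<open>0 \<le> t\<close> step_bounds step'_bound
      by (intro mult_mono) auto
    then show ?thesis by (simp add: mult_ac)
  qed (simp add: step_eq)
  show ?thesis using a b unfolding cutoff'_def right_diff_distrib[of t] by linarith
next
  case False
  then have "real (Suc k) * t \<le> 1" by (metis linear mult_nonneg_nonpos of_nat_0_le_iff order_trans zero_le_one)
  then show ?thesis using cutoff_eq_0 by simp
qed

text \<open>Writing the profile in the squared modulus makes the map as smooth as \<open>P\<close>,
  including at zero; for polynomial \<open>P\<close> it is a polynomial in z and its
  conjugate.\<close>

definition radial :: "(real \<Rightarrow> real) \<Rightarrow> complex \<Rightarrow> complex" where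
  "radial P z = of_real (P ((norm z)\<^sup>2)) * z"

definition radial' :: "(real \<Rightarrow> real) \<Rightarrow> (real \<Rightarrow> real) \<Rightarrow> complex \<Rightarrow> complex \<Rightarrow> complex" where
  "radial' P P' z v = of_real (P ((norm z)\<^sup>2)) * v + of_real (2 * P' ((norm z)\<^sup>2) * (z \<bullet> v)) * z"

lemma has_derivative_radial:
  assumes "(P has_real_derivative P' ((norm z)\<^sup>2)) (at ((norm z)\<^sup>2))"
  shows "(radial P has_derivative radial' P P' z) (at z)"
proof -
  have "((\<lambda>z::complex. (norm z)\<^sup>2) has_derivative (\<lambda>v. 2 * (z \<bullet> v))) (at z)"
    unfolding power2_norm_eq_inner
    by (auto intro!: derivative_eq_intros simp: inner_commute)
  from has_derivative_compose[OF this, of P "\<lambda>h. P' ((norm z)\<^sup>2) * h"]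
  have "((\<lambda>z. P ((norm z)\<^sup>2)) has_derivative (\<lambda>v. P' ((norm z)\<^sup>2) * (2 * (z \<bullet> v)))) (at z)"
    using assms by (simp add: has_field_derivative_def)
  from has_derivative_mult[OF has_derivative_of_real[OF this] has_derivative_ident]
  show ?thesis unfolding radial_def radial'_def by (simp add: mult_ac)
qed

text \<open>By Cauchy-Schwarz the second summand of \<open>radial'\<close> is at most 2 |t P'(t)|
  |v| with t = |z|^2. This is why profiles are controlled through t P'(t) rather than P'(t).\<close>

lemma norm_radial'_le:
  assumes "\<bar>P ((norm z)\<^sup>2)\<bar> \<le> B" "\<bar>(norm z)\<^sup>2 * P' ((norm z)\<^sup>2)\<bar> \<le> B'"
  shows "norm (radial' P P' z v) \<le> (B + 2 * B') * norm v"
proof -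
  have "norm (of_real (2 * P' ((norm z)\<^sup>2) * (z \<bullet> v)) * z) = 2 * \<bar>P' ((norm z)\<^sup>2)\<bar> * \<bar>z \<bullet> v\<bar> * norm z"
    by (simp add: norm_mult abs_mult del: of_real_mult)
  also have "\<dots> \<le> 2 * \<bar>P' ((norm z)\<^sup>2)\<bar> * (norm z * norm v) * norm z"
    by (intro mult_right_mono mult_left_mono Cauchy_Schwarz_ineq2) auto
  also have "\<dots> = 2 * \<bar>(norm z)\<^sup>2 * P' ((norm z)\<^sup>2)\<bar> * norm v"
    by (simp add: abs_mult power2_eq_square)
  also have "\<dots> \<le> 2 * B' * norm v" using assms(2) by (intro mult_right_mono) auto
  finally have 1: "norm (of_real (2 * P' ((norm z)\<^sup>2) * (z \<bullet> v)) * z) \<le> 2 * B' * norm v" .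
  have 2: "norm (of_real (P ((norm z)\<^sup>2)) * v) \<le> B * norm v"
    using assms(1) by (simp add: norm_mult mult_right_mono)
  show ?thesis
    unfolding radial'_def using norm_triangle_mono[OF 2 1] by (simp add: distrib_right)
qed

lemma C1_map_radial:
  assumes P: "\<And>t. (P has_real_derivative P' t) (at t)" "continuous_on UNIV P'"
    and B: "\<And>t. \<bar>P t\<bar> \<le> B" "\<And>t. \<bar>t * P' t\<bar> \<le> B'"
  shows "C1_map (B + 2 * B') (radial P) (radial' P P')"
  unfolding C1_map_def
proof (intro conjI allI)
  show "radial P 0 = 0" by (simp add: radial_def)
  show "(radial P has_derivative radial' P P' z) (at z)" for z using P by (rule_tac has_derivative_radial) auto
  have "continuous_on UNIV P" using P by (intro DERIV_continuous_on) (auto intro: has_field_derivative_at_within)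
  moreover have "continuous_on UNIV (\<lambda>z::complex. (norm z)\<^sup>2)" by (intro continuous_intros)
  ultimately have "continuous_on UNIV (\<lambda>z::complex. P ((norm z)\<^sup>2))"
    "continuous_on UNIV (\<lambda>z::complex. P' ((norm z)\<^sup>2))"
    using continuous_on_compose2[of UNIV] P(2) by blast+
  then show "continuous_on UNIV (\<lambda>z. radial' P P' z v)" for v
    unfolding radial'_def
    by (intro continuous_on_add continuous_on_mult continuous_on_of_real continuous_on_inner continuous_on_const continuous_on_id)
  show "norm (radial' P P' z v) \<le> (B + 2 * B') * norm v" for z v by (rule norm_radial'_le; rule B)
qed

text \<open>The constant is 33 = 1 + 2 * 16, the same for all \<open>k\<close>.\<close>

lemma C1_map_cutoff: "C1_map 33 (radial (cutoff k)) (radial' (cutoff k) (cutoff' k))"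
  using C1_map_radial[of "cutoff k" "cutoff' k" 1 16] DERIV_cutoff continuous_cutoff' cutoff_bounds cutoff'_bound
  by simp

text \<open>Made for profiles built from \<phi>, which is controlled only on the positive half line:
  a cut-off kills them below \<open>a\<close>, and the two open pieces overlap on (0, a).\<close>

lemma C1_extend_by_zero:
  fixes Q Q' :: "real \<Rightarrow> real"
  assumes a: "a > 0" "\<And>t. t < a \<Longrightarrow> Q t = 0" "\<And>t. t < a \<Longrightarrow> Q' t = 0"
    and Q: "\<And>t. t > 0 \<Longrightarrow> (Q has_real_derivative Q' t) (at t)" "continuous_on {0<..} Q'"
  shows "(Q has_real_derivative Q' t) (at t)" "continuous_on UNIV Q'"
proof -
  show "(Q has_real_derivative Q' t) (at t)"
  proof (cases "t > 0")
    case False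
    have "((\<lambda>_. 0) has_real_derivative Q' t) (at t)" using False a by simp
    then show ?thesis
      by (rule has_field_derivative_transform_within_open[of _ _ _ "{..<a}"]) (use False a in auto)
  qed (use Q in auto)
  have "continuous_on {..<a} Q'"
    using a(3) by (intro continuous_on_eq[OF continuous_on_const[of _ 0]]) auto
  then have "continuous_on ({0<..} \<union> {..<a}) Q'"
    using Q(2) by (intro continuous_on_open_Un) auto
  moreover have "{0<..} \<union> {..<a} = UNIV" using a by auto
  ultimately show "continuous_on UNIV Q'" by simp
qed

lemma bounded_if_zero_outside:
  fixes Q :: "real \<Rightarrow> real"
  assumes "continuous_on UNIV Q" "\<And>t. t < a \<Longrightarrow> Q t = 0" "\<And>t. t > b \<Longrightarrow> Q t = 0"
  obtains B where "B \<ge> 0" "\<And>t. \<bar>Q t\<bar> \<le> B"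
  using bounded_if_compact_support[OF assms(1) compact_Icc[of a b]] assms(2,3)
  by (metis atLeastAtMost_iff not_less real_norm_def)

text \<open>The fundamental lemma of the calculus of variations. Intersecting \<Omega> with balls
  makes the square integrable \<open>v\<close> integrable; the sign criterion for bumps is then
  applied to the real and imaginary parts and to their negatives.\<close>

lemma AE_eq_0_if_weakly_0:
  fixes v :: "real^'n::finite \<Rightarrow> complex"
  assumes \<Omega>: "open \<Omega>" and v: "square_integrable \<Omega> v"
    and *: "\<And>\<zeta>. test_function \<Omega> \<zeta> \<Longrightarrow> (LINT x|lebesgue_on \<Omega>. v x * \<zeta> x) = 0"
  shows "AE x in lebesgue_on \<Omega>. v x = 0"
proof -
  have local: "AE x in lebesgue. x \<in> \<Omega> \<inter> ball 0 (real m) \<longrightarrow> v x = 0" for m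
  proof -
    define \<Omega>m where "\<Omega>m = \<Omega> \<inter> ball 0 (real m)"
    have op: "open \<Omega>m" "\<Omega>m \<subseteq> \<Omega>" and sets: "\<Omega>m \<in> sets lebesgue" "\<Omega> \<in> sets lebesgue"
      using \<Omega> by (auto simp: \<Omega>m_def)
    have vi: "integrable (lebesgue_on \<Omega>m) v"
    proof (rule Bochner_Integration.integrable_bound)
      have "integrable (lebesgue_on \<Omega>m) (\<lambda>x. 1::real)"
      proof -
        have "\<Omega>m \<in> lmeasurable"
          using sets bounded_subset[OF bounded_ball, of \<Omega>m 0 "real m"]
          by (intro bounded_set_imp_lmeasurable) (auto simp: \<Omega>m_def)
        then show ?thesis by (intro finite_measure.integrable_const finite_measure_lebesgue_on)
      qed
      moreover have "integrable (lebesgue_on \<Omega>m) (\<lambda>x. (norm (v x))\<^sup>2)"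
      proof -
        have "integrable lebesgue (\<lambda>x. indicator \<Omega> x *\<^sub>R (norm (v x))\<^sup>2)"
          using v sets by (simp add: square_integrable_def integrable_restrict_space)
        note int = integrable_mult_indicator[OF sets(1) this]
        have "indicator \<Omega>m x *\<^sub>R (indicator \<Omega> x *\<^sub>R (norm (v x))\<^sup>2) = indicator \<Omega>m x *\<^sub>R (norm (v x))\<^sup>2" for x
          using op(2) by (auto simp: indicator_def)
        then have "integrable lebesgue (\<lambda>x. indicator \<Omega>m x *\<^sub>R (norm (v x))\<^sup>2)"
          using int by presburger
        then show ?thesis using sets by (simp add: integrable_restrict_space)
      qed
      ultimately show "integrable (lebesgue_on \<Omega>m) (\<lambda>x. 1 + (norm (v x))\<^sup>2)" by simp
      show "v \<in> borel_measurable (lebesgue_on \<Omega>m)"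
        using v op unfolding square_integrable_def by (blast intro: measurable_restrict_mono)
      show "AE x in lebesgue_on \<Omega>m. norm (v x) \<le> norm (1 + (norm (v x))\<^sup>2)"
      proof (rule AE_I2)
        fix x
        have "0 \<le> (norm (v x) - 1)\<^sup>2" by simp
        then have "2 * norm (v x) \<le> 1 + (norm (v x))\<^sup>2" by (simp add: power2_diff)
        then show "norm (v x) \<le> norm (1 + (norm (v x))\<^sup>2)" using norm_ge_zero[of "v x"] unfolding real_norm_def by linarith
      qed
    qed
    have z: "(LINT x|lebesgue_on \<Omega>m. v x * of_real (\<eta> x)) = 0" if \<eta>: "bump \<eta> \<Omega>m" for \<eta>
    proof -
      have t: "test_function \<Omega>m (\<lambda>x. complex_of_real (\<eta> x))" using \<eta> by (simp add: bump_def)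
      then have "test_function \<Omega> (\<lambda>x. complex_of_real (\<eta> x))"
        using op by (auto simp: test_function_def)
      then have "(LINT x|lebesgue_on \<Omega>. v x * of_real (\<eta> x)) = 0" by (rule *)
      moreover have "indicator \<Omega> x *\<^sub>R (v x * of_real (\<eta> x)) = indicator \<Omega>m x *\<^sub>R (v x * of_real (\<eta> x))" for x
        using op test_function_supportE[OF t] by (auto simp: indicator_def) (metis subsetD of_real_eq_0_iff)
      ultimately show ?thesis using sets by (simp add: integral_restrict_space)
    qed
    have zi: "integrable (lebesgue_on \<Omega>m) (\<lambda>x. v x * of_real (\<eta> x))" if \<eta>: "bump \<eta> \<Omega>m" for \<eta>
    proof (rule Bochner_Integration.integrable_bound[OF vi])
      show "(\<lambda>x. v x * of_real (\<eta> x)) \<in> borel_measurable (lebesgue_on \<Omega>m)"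
        by (intro borel_measurable_times borel_measurable_integrable[OF vi]
            borel_measurable_continuous_lebesgue_on continuous_on_of_real bump_continuous[OF \<eta>])
      show "AE x in lebesgue_on \<Omega>m. norm (v x * of_real (\<eta> x)) \<le> norm (v x)"
        using \<eta> by (auto simp: bump_def norm_mult intro!: mult_left_le)
    qed
    have nn: "AE x in lebesgue_on \<Omega>m. 0 \<le> L (v x)" if L: "bounded_linear L" for L :: "complex \<Rightarrow> real"
    proof (rule AE_nonneg_if_bump_integrals_nonneg[OF integrable_bounded_linear[OF L vi] op(1)])
      fix \<eta> assume \<eta>: "bump \<eta> \<Omega>m"
      have "L (v x) * \<eta> x = L (v x * of_real (\<eta> x))" for x
        using linear_scale[OF bounded_linear.linear[OF L], of "\<eta> x" "v x"] by (simp add: scaleR_conv_of_real mult.commute)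
      then have "(LINT x|lebesgue_on \<Omega>m. L (v x) * \<eta> x) = L (LINT x|lebesgue_on \<Omega>m. v x * of_real (\<eta> x))"
        using integral_bounded_linear[OF L zi[OF \<eta>]] by simp
      then show "0 \<le> (LINT x|lebesgue_on \<Omega>m. L (v x) * \<eta> x)"
        using z[OF \<eta>] linear_0[OF bounded_linear.linear[OF L]] by simp
    qed
    have "AE x in lebesgue_on \<Omega>m. v x = 0"
      using nn[OF bounded_linear_Re] nn[OF bounded_linear_Im]
        nn[OF bounded_linear_minus[OF bounded_linear_Re]] nn[OF bounded_linear_minus[OF bounded_linear_Im]]
      by eventually_elim (simp add: complex_eq_iff)
    then show ?thesis using sets by (simp add: AE_restrict_space_iff \<Omega>m_def)
  qed
  have "AE x in lebesgue. \<forall>m. x \<in> \<Omega> \<inter> ball 0 (real m) \<longrightarrow> v x = 0"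
    unfolding AE_all_countable using local by blast
  then have "AE x in lebesgue. x \<in> \<Omega> \<longrightarrow> v x = 0"
  proof eventually_elim
    case (elim x)
    obtain m where "norm x < real m" using reals_Archimedean2 by blast
    then show ?case using elim by auto
  qed
  then show ?thesis using \<Omega> by (simp add: AE_restrict_space_iff)
qed

section \<open>Sufficiency\<close>

text \<open>Here \<open>a\<close> is (s \<phi>)', \<open>b\<close> is \<phi>, and a - b = s \<phi>'.
  Polarization with P, M = sqrt a X +- sqrt b Y writes 4 sqrt(ab) times the mixed term of the
  symmetric form \<open>I\<close> as a difference of two diagonal values. In the sum of the two
  bounds the mixed terms of \<open>R\<close> cancel, and the square root weights produce exactly the
  coefficients a and b.\<close>

lemma form_bound:
  fixes R I :: "real^'n^'n::finite"
  assumes sym: "transpose I = I" and ab: "a > 0" "b > 0"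
    and le: "\<And>\<xi>. \<bar>a - b\<bar> * \<bar>(I *v \<xi>) \<bullet> \<xi>\<bar> \<le> 2 * sqrt (b * a) * ((R *v \<xi>) \<bullet> \<xi>)"
  shows "0 \<le> a * ((R *v X) \<bullet> X) + b * ((R *v Y) \<bullet> Y) - (a - b) * ((I *v Y) \<bullet> X)"
proof -
  define d where "d = sqrt (b * a)"
  have d: "d > 0" "sqrt a * sqrt b = d" unfolding d_def using ab by (auto simp: real_sqrt_mult)
  have swap: "(I *v X) \<bullet> Y = (I *v Y) \<bullet> X"
    using sym by (metis dot_lmul_matrix inner_commute vector_transpose_matrix)
  define P where "P = sqrt a *\<^sub>R X + sqrt b *\<^sub>R Y"
  define M where "M = sqrt a *\<^sub>R X - sqrt b *\<^sub>R Y"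
  have "4 * (d * ((I *v Y) \<bullet> X)) = (I *v P) \<bullet> P - (I *v M) \<bullet> M"
    unfolding P_def M_def d(2)[symmetric] using swap
    by (simp add: matrix_vector_right_distrib matrix_vector_mult_diff_distrib matrix_vector_mult_scaleR
        inner_add_left inner_add_right inner_diff_left inner_diff_right algebra_simps)
  then have "\<bar>a - b\<bar> * (4 * (d * \<bar>(I *v Y) \<bullet> X\<bar>)) = \<bar>a - b\<bar> * \<bar>(I *v P) \<bullet> P - (I *v M) \<bullet> M\<bar>"
    using d(1) by (metis abs_mult abs_of_pos zero_less_numeral)
  also have "\<dots> \<le> \<bar>a - b\<bar> * \<bar>(I *v P) \<bullet> P\<bar> + \<bar>a - b\<bar> * \<bar>(I *v M) \<bullet> M\<bar>"
    unfolding distrib_left[symmetric] by (intro mult_left_mono) auto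
  also have "\<dots> \<le> 2 * d * ((R *v P) \<bullet> P) + 2 * d * ((R *v M) \<bullet> M)"
    unfolding d_def by (intro add_mono le)
  also have "\<dots> = 4 * d * (a * ((R *v X) \<bullet> X) + b * ((R *v Y) \<bullet> Y))"
  proof -
    have "(R *v P) \<bullet> P + (R *v M) \<bullet> M = 2 * (sqrt a * sqrt a * ((R *v X) \<bullet> X) + sqrt b * sqrt b * ((R *v Y) \<bullet> Y))"
      unfolding P_def M_def
      by (simp add: matrix_vector_right_distrib matrix_vector_mult_diff_distrib matrix_vector_mult_scaleR
          inner_add_left inner_add_right inner_diff_left inner_diff_right algebra_simps del: real_sqrt_mult_self)
    then have "(R *v P) \<bullet> P + (R *v M) \<bullet> M = 2 * (a * ((R *v X) \<bullet> X) + b * ((R *v Y) \<bullet> Y))" using ab by simp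
    then show ?thesis by (simp only: distrib_left[symmetric])
  qed
  finally have "4 * d * (\<bar>a - b\<bar> * \<bar>(I *v Y) \<bullet> X\<bar>) \<le> 4 * d * (a * ((R *v X) \<bullet> X) + b * ((R *v Y) \<bullet> Y))"
    by (simp add: mult_ac)
  then have "\<bar>a - b\<bar> * \<bar>(I *v Y) \<bullet> X\<bar> \<le> a * ((R *v X) \<bullet> X) + b * ((R *v Y) \<bullet> Y)"
    using d(1) by (simp only: mult_le_cancel_left)
  moreover have "(a - b) * ((I *v Y) \<bullet> X) \<le> \<bar>a - b\<bar> * \<bar>(I *v Y) \<bullet> X\<bar>"
    by (metis abs_ge_self abs_mult)
  ultimately show ?thesis by linarith
qed

text \<open>The phase of \<open>g\<close> cancels against the conjugated phase of \<open>h\<close>.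
  The two terms with \<open>Im\<close> are kept apart here; symmetry merges them later into one with
  the factor a - b.\<close>

lemma Re_cdot_eq:
  fixes A :: "complex^'n^'n::finite" and X Y :: "real^'n"
  assumes \<omega>: "norm \<omega> = 1"
    and g: "\<And>i. g $ i = \<omega> * Complex (X $ i) (Y $ i)"
    and h: "\<And>i. h $ i = \<omega> * Complex (a * X $ i) (b * Y $ i)"
  shows "Re (cdot (A *v g) h) = a * ((map_matrix Re A *v X) \<bullet> X) + b * ((map_matrix Re A *v Y) \<bullet> Y)
    - a * ((map_matrix Im A *v Y) \<bullet> X) + b * ((map_matrix Im A *v X) \<bullet> Y)"
proof -
  have 1: "\<omega> * cnj \<omega> = 1" using \<omega> complex_norm_square[of \<omega>] by simp
  have "Re (A $ i $ j * g $ j * cnj (h $ i)) =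
      a * (Re (A $ i $ j) * X $ j * X $ i) + b * (Re (A $ i $ j) * Y $ j * Y $ i)
      - a * (Im (A $ i $ j) * Y $ j * X $ i) + b * (Im (A $ i $ j) * X $ j * Y $ i)" for i j
  proof -
    have "A $ i $ j * g $ j * cnj (h $ i)
        = (\<omega> * cnj \<omega>) * (A $ i $ j * Complex (X $ j) (Y $ j) * cnj (Complex (a * X $ i) (b * Y $ i)))"
      unfolding g h by (simp add: mult_ac)
    then have "Re (A $ i $ j * g $ j * cnj (h $ i)) =
        Re (A $ i $ j * Complex (X $ j) (Y $ j) * cnj (Complex (a * X $ i) (b * Y $ i)))"
      by (simp only: 1 mult_1)
    also have "\<dots> = a * (Re (A $ i $ j) * X $ j * X $ i) + b * (Re (A $ i $ j) * Y $ j * Y $ i)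
      - a * (Im (A $ i $ j) * Y $ j * X $ i) + b * (Im (A $ i $ j) * X $ j * Y $ i)"
      by (simp add: algebra_simps)
    finally show ?thesis .
  qed
  then show ?thesis
    by (simp add: cdot_def matrix_vector_mult_def map_matrix_def inner_vec_def sum_distrib_right sum_distrib_left
        Re_sum sum.distrib sum_subtractf)
qed

section \<open>The nonlinearity, its flux s \<phi>(s), and cut-offs adapted to it\<close>

locale admissible_function =
  fixes \<phi> :: "real \<Rightarrow> real"
  assumes admissible: "admissible \<phi>"
begin

definition flux' :: "real \<Rightarrow> real" where "flux' s = \<phi> s + s * deriv \<phi> s"

text \<open>In terms of \<open>t = s\<^sup>2\<close> the map \<open>z \<mapsto> \<phi>(|z|) z\<close> is \<open>radial p\<close>, and \<open>radial' p p' z\<close> is its derivative at \<open>z \<noteq> 0\<close>.\<close>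
definition p :: "real \<Rightarrow> real" where "p t = \<phi> (sqrt t)"

definition p' :: "real \<Rightarrow> real" where "p' t = deriv \<phi> (sqrt t) / (2 * sqrt t)"

lemma phi_pos: "s > 0 \<Longrightarrow> \<phi> s > 0"
  using admissible by (simp add: admissible_def)

lemma DERIV_phi: "s > 0 \<Longrightarrow> (\<phi> has_real_derivative deriv \<phi> s) (at s)"
  using admissible unfolding admissible_def
  by (metis DERIV_deriv_iff_real_differentiable)

lemma continuous_deriv_phi: "continuous_on {0<..} (deriv \<phi>)"
  using admissible by (simp add: admissible_def)

lemma continuous_phi: "continuous_on {0<..} \<phi>"
  using DERIV_phi by (intro DERIV_continuous_on) (auto intro: has_field_derivative_at_within)

lemma DERIV_flux: "s > 0 \<Longrightarrow> ((\<lambda>t. t * \<phi> t) has_real_derivative flux' s) (at s)"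
  unfolding flux'_def using DERIV_phi by (auto intro!: derivative_eq_intros)

lemma deriv_flux: "s > 0 \<Longrightarrow> deriv (\<lambda>t. t * \<phi> t) s = flux' s"
  using DERIV_flux DERIV_imp_deriv by blast

lemma flux'_pos: "s > 0 \<Longrightarrow> flux' s > 0"
  using admissible deriv_flux by (simp add: admissible_def)

lemma continuous_flux': "continuous_on {0<..} flux'"
  unfolding flux'_def by (intro continuous_intros continuous_phi continuous_deriv_phi)

lemma flux_strict_mono: "0 < s \<Longrightarrow> s < t \<Longrightarrow> s * \<phi> s < t * \<phi> t"
  by (rule DERIV_pos_imp_increasing[of s t "\<lambda>t. t * \<phi> t"])
     (auto intro!: exI conjI DERIV_flux flux'_pos)

lemma flux_surj:
  assumes "y > 0"
  obtains s where "s > 0" "s * \<phi> s = y"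
proof -
  have "(\<lambda>s. s * \<phi> s) ` {0<..} = {0<..}" using admissible by (simp add: admissible_def)
  then have "y \<in> (\<lambda>s. s * \<phi> s) ` {0<..}" using assms by simp
  then show ?thesis using that by auto
qed

lemma DERIV_p: "t > 0 \<Longrightarrow> (p has_real_derivative p' t) (at t)"
proof -
  assume t: "t > 0"
  have "((\<lambda>t. \<phi> (sqrt t)) has_real_derivative deriv \<phi> (sqrt t) * (inverse (sqrt t) / 2)) (at t)"
    using t by (intro DERIV_chain2[OF DERIV_phi] DERIV_real_sqrt) auto
  then show ?thesis
    unfolding p_def p'_def by (simp add: field_simps)
qed

lemma continuous_p: "continuous_on {0<..} p"
  using DERIV_p by (intro DERIV_continuous_on) (auto intro: has_field_derivative_at_within)

lemma continuous_p': "continuous_on {0<..} p'"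
proof -
  have "continuous_on {0<..} (\<lambda>t. deriv \<phi> (sqrt t))"
    by (rule continuous_on_compose2[OF continuous_deriv_phi]) (auto intro!: continuous_intros)
  then show ?thesis unfolding p'_def by (intro continuous_intros) auto
qed

lemma radial_p: "radial p z = of_real (\<phi> (norm z)) * z"
  by (simp add: radial_def p_def)

lemma radial'_p: "radial' p p' z v = of_real (\<phi> (norm z)) * v + of_real (deriv \<phi> (norm z) / norm z * (z \<bullet> v)) * z"
  by (simp add: radial'_def p_def p'_def)

text \<open>For t = |z|^2 the quantity t (p t)^2 is the squared modulus of
  \<open>radial p z\<close>. The cut-off thus acts on the values of \<open>radial p\<close>, and
  \<open>radial (cut k)\<close> is the composition of a good map with the singular one.\<close>

definition cut :: "nat \<Rightarrow> real \<Rightarrow> real" where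
  "cut k t = p t * cutoff k (t * (p t)\<^sup>2)"

definition cut' :: "nat \<Rightarrow> real \<Rightarrow> real" where
  "cut' k t = p' t * cutoff k (t * (p t)\<^sup>2) + p t * (cutoff' k (t * (p t)\<^sup>2) * ((p t)\<^sup>2 + t * (2 * p t * p' t)))"

lemma radial_cut: "radial (cut k) z = radial (cutoff k) (radial p z)"
  by (simp add: radial_def cut_def norm_mult power_mult_distrib mult_ac)

lemma flux_square: "t > 0 \<Longrightarrow> t * (p t)\<^sup>2 = (sqrt t * \<phi> (sqrt t))\<^sup>2"
  by (simp add: p_def power_mult_distrib)

text \<open>The flux increases from 0 to infinity, so it takes the values sqrt(1/(k+1)) and
  sqrt(2(k+1)) at some \<open>a\<close> and \<open>b\<close>. Outside [a^2, b^2] the cut-off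
  vanishes, and what remains is a C^1 profile supported in a compact subset of the positive half
  line.\<close>

lemma C1_map_cut: "\<exists>C. C1_map C (radial (cut k)) (radial' (cut k) (cut' k))"
proof -
  obtain a where a: "a > 0" "a * \<phi> a = sqrt (1 / real (Suc k))" by (rule flux_surj[of "sqrt (1 / real (Suc k))"]) auto
  obtain b where b: "b > 0" "b * \<phi> b = sqrt (2 * real (Suc k))" by (rule flux_surj[of "sqrt (2 * real (Suc k))"]) auto
  have lo: "cutoff k (t * (p t)\<^sup>2) = 0 \<and> cutoff' k (t * (p t)\<^sup>2) = 0" if "t < a\<^sup>2" for t
  proof -
    have "t * (p t)\<^sup>2 \<le> 1 / real (Suc k)"
    proof (cases "t > 0")
      case True
      then have "sqrt t < a" using that a(1) real_less_lsqrt by auto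
      then have "sqrt t * \<phi> (sqrt t) \<le> sqrt (1 / real (Suc k))"
        using flux_strict_mono[of "sqrt t" a] True a by simp
      then have "(sqrt t * \<phi> (sqrt t))\<^sup>2 \<le> (sqrt (1 / real (Suc k)))\<^sup>2"
        using True phi_pos[of "sqrt t"] by (intro power_mono) auto
      then show ?thesis using flux_square[OF True] by simp
    next
      case False
      then have "t * (p t)\<^sup>2 \<le> 0" by (simp add: mult_nonpos_nonneg)
      then show ?thesis by (rule order_trans) simp
    qed
    then show ?thesis by (intro conjI cutoff_eq_0) (auto simp: field_simps)
  qed
  have hi: "cutoff k (t * (p t)\<^sup>2) = 0 \<and> cutoff' k (t * (p t)\<^sup>2) = 0" if "t > b\<^sup>2" for t
  proof -
    have t: "t > 0" using that zero_le_power2[of b] by linarith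
    have "b < sqrt t" using that b(1) by (simp add: real_less_rsqrt)
    then have "sqrt (2 * real (Suc k)) \<le> sqrt t * \<phi> (sqrt t)"
      using flux_strict_mono[of b "sqrt t"] b by simp
    then have "(sqrt (2 * real (Suc k)))\<^sup>2 \<le> (sqrt t * \<phi> (sqrt t))\<^sup>2"
      by (intro power_mono) auto
    then show ?thesis using flux_square[OF t] by (intro conjI cutoff_eq_0) auto
  qed
  have D: "(cut k has_real_derivative cut' k t) (at t)" if "t > 0" for t
  proof -
    have "((\<lambda>t. t * (p t)\<^sup>2) has_real_derivative ((p t)\<^sup>2 + t * (2 * p t * p' t))) (at t)"
      using DERIV_p[OF that] by (auto intro!: derivative_eq_intros)
    from DERIV_mult[OF DERIV_p[OF that] DERIV_chain2[OF DERIV_cutoff this]]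
    show ?thesis unfolding cut_def cut'_def by (simp add: algebra_simps)
  qed
  have inner: "continuous_on {0<..} (\<lambda>t. t * (p t)\<^sup>2)"
    by (intro continuous_intros continuous_p)
  have "continuous_on {0<..} (\<lambda>t. cutoff k (t * (p t)\<^sup>2))"
  proof -
    have "continuous_on UNIV (cutoff k)"
      using DERIV_cutoff by (intro DERIV_continuous_on) (auto intro: has_field_derivative_at_within)
    from continuous_on_compose2[OF this inner] show ?thesis by simp
  qed
  moreover have "continuous_on {0<..} (\<lambda>t. cutoff' k (t * (p t)\<^sup>2))"
    using continuous_on_compose2[OF continuous_cutoff'[of UNIV] inner] by simp
  ultimately have "continuous_on {0<..} (cut' k)"
    unfolding cut'_def
    by (intro continuous_on_add continuous_on_mult continuous_on_power continuous_p continuous_p' continuous_on_const continuous_on_id)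
  moreover have a2: "a\<^sup>2 > 0" using a by simp
  moreover have z: "cut k t = 0" "cut' k t = 0" if "t < a\<^sup>2 \<or> t > b\<^sup>2" for t
    using lo[of t] hi[of t] that by (auto simp: cut_def cut'_def)
  ultimately have C1: "(cut k has_real_derivative cut' k t) (at t)" "continuous_on UNIV (cut' k)" for t
    using C1_extend_by_zero[of "a\<^sup>2" "cut k" "cut' k"] D by auto
  have "continuous_on UNIV (cut k)"
    using C1 by (intro DERIV_continuous_on) (auto intro: has_field_derivative_at_within)
  then obtain B where B: "\<And>t. \<bar>cut k t\<bar> \<le> B"
    by (rule bounded_if_zero_outside[of "cut k" "a\<^sup>2" "b\<^sup>2"]) (use z in auto)
  have "continuous_on UNIV (\<lambda>t. t * cut' k t)" by (intro continuous_intros C1)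
  then obtain B' where B': "\<And>t. \<bar>t * cut' k t\<bar> \<le> B'"
    by (rule bounded_if_zero_outside[of "\<lambda>t. t * cut' k t" "a\<^sup>2" "b\<^sup>2"]) (use z in auto)
  show ?thesis using C1_map_radial[OF C1 B B'] by blast
qed

end

lemma has_H10_gradientD:
  assumes "has_H10_gradient \<Omega> u g"
  shows "square_integrable \<Omega> u" "square_integrable \<Omega> g" "square_integrable \<Omega> (\<lambda>x. g x $ i)"
    "test_function \<Omega> \<zeta> \<Longrightarrow>
      (LINT x|lebesgue_on \<Omega>. u x * partial_deriv i \<zeta> x) = - (LINT x|lebesgue_on \<Omega>. g x $ i * \<zeta> x)"
  using assms square_integrable_vec_nth unfolding has_H10_gradient_def has_H1_gradient_def by blast+

text \<open>Test the chain rule with maps that tend to the identity but vanish near zero.\<close>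
lemma weak_gradient_zero_on_zero_set:
  fixes u :: "real^'n::finite \<Rightarrow> complex"
  assumes \<Omega>: "open \<Omega>" and u: "has_H10_gradient \<Omega> u g"
  shows "AE x in lebesgue_on \<Omega>. u x = 0 \<longrightarrow> g x = 0"
proof -
  note uD = has_H10_gradientD[OF u]
  let ?M = "lebesgue_on \<Omega>"
  define T where "T k = radial (cutoff k)" for k
  define T' where "T' k = radial' (cutoff k) (cutoff' k)" for k
  have T: "C1_map 33 (T k) (T' k)" for k
    unfolding T_def T'_def by (rule C1_map_cutoff)
  \<comment> \<open>The maps converge to the identity everywhere, whereas their derivatives converge
    to the identity only off zero and to 0 at zero. This mismatch is what forces the gradient to
    vanish on the zero set.\<close>
  have lim: "(\<lambda>k. T k z) \<longlonglongrightarrow> z" "(\<lambda>k. T' k z v) \<longlonglongrightarrow> (if z = 0 then 0 else v)" for z v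
  proof -
    have "\<forall>\<^sub>F k in sequentially. T k z = z \<and> T' k z v = v" if "z \<noteq> 0"
      using eventually_cutoff_eq_1[of "(norm z)\<^sup>2"] that
      by (auto elim!: eventually_mono simp: T_def T'_def radial_def radial'_def)
    moreover have "T k z = z \<and> T' k z v = 0" if "z = 0" for k
      using that cutoff_eq_0[of k 0] by (simp add: T_def T'_def radial_def radial'_def)
    ultimately show "(\<lambda>k. T k z) \<longlonglongrightarrow> z" "(\<lambda>k. T' k z v) \<longlonglongrightarrow> (if z = 0 then 0 else v)"
      by (cases "z = 0"; auto intro!: tendsto_eventually elim!: eventually_mono)+
  qed
  have um: "u \<in> borel_measurable ?M" using uD by (simp add: square_integrable_def)
  have "AE x in ?M. (if u x = 0 then g x $ i else 0) = 0" for i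
  proof (rule AE_eq_0_if_weakly_0[OF \<Omega>])
    have gm: "(\<lambda>x. g x $ i) \<in> borel_measurable ?M" using uD(3)[of i] by (simp add: square_integrable_def)
    have ifm: "(\<lambda>x. if u x = 0 then g x $ i else 0) \<in> borel_measurable ?M"
    proof -
      have "{x \<in> space ?M. u x = 0} \<in> sets ?M"
        using measurable_sets[OF um, of "{0}"] by (simp add: vimage_def Int_def conj_commute)
      with gm show ?thesis by (intro measurable_If) auto
    qed
    show sq: "square_integrable \<Omega> (\<lambda>x. if u x = 0 then g x $ i else 0)"
      by (rule square_integrable_bound[OF uD(3)[of i], of _ 1]) (use ifm in auto)
    fix \<zeta> assume \<zeta>: "test_function \<Omega> \<zeta>"
    note s\<zeta> = square_integrable_test_function[OF \<Omega> \<zeta>]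
    note \<zeta>m = s\<zeta>(1)[unfolded square_integrable_def, THEN conjunct1] s\<zeta>(2)[unfolded square_integrable_def, THEN conjunct1]
    have 1: "(\<lambda>k. LINT x|?M. T k (u x) * partial_deriv i \<zeta> x) \<longlonglongrightarrow> (LINT x|?M. u x * partial_deriv i \<zeta> x)"
    proof (rule integral_dominated_convergence[where w = "\<lambda>x. norm (u x * partial_deriv i \<zeta> x)"])
      show "AE x in ?M. norm (T k (u x) * partial_deriv i \<zeta> x) \<le> norm (u x * partial_deriv i \<zeta> x)" for k
        using cutoff_bounds by (auto simp: T_def radial_def norm_mult mult.assoc intro!: mult_left_le_one_le)
      show "integrable ?M (\<lambda>x. norm (u x * partial_deriv i \<zeta> x))"
        by (intro integrable_norm square_integrable_mult uD s\<zeta>)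
      show "AE x in ?M. (\<lambda>k. T k (u x) * partial_deriv i \<zeta> x) \<longlonglongrightarrow> u x * partial_deriv i \<zeta> x"
        by (intro AE_I2 tendsto_intros lim)
    qed (intro borel_measurable_times \<zeta>m um C1_map_measurable(1)[OF T um um])+
    have 2: "(\<lambda>k. LINT x|?M. T' k (u x) (g x $ i) * \<zeta> x) \<longlonglongrightarrow> (LINT x|?M. (if u x = 0 then 0 else g x $ i) * \<zeta> x)"
    proof (rule integral_dominated_convergence[where w = "\<lambda>x. 33 * norm (g x $ i * \<zeta> x)"])
      show "AE x in ?M. norm (T' k (u x) (g x $ i) * \<zeta> x) \<le> 33 * norm (g x $ i * \<zeta> x)" for k
      proof (rule AE_I2)
        fix x
        have "norm (T' k (u x) (g x $ i)) * norm (\<zeta> x) \<le> (33 * norm (g x $ i)) * norm (\<zeta> x)"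
          using T unfolding C1_map_def by (intro mult_right_mono) auto
        then show "norm (T' k (u x) (g x $ i) * \<zeta> x) \<le> 33 * norm (g x $ i * \<zeta> x)" by (simp add: norm_mult)
      qed
      show "integrable ?M (\<lambda>x. 33 * norm (g x $ i * \<zeta> x))"
        by (intro integrable_mult_right integrable_norm square_integrable_mult uD s\<zeta>)
      show "AE x in ?M. (\<lambda>k. T' k (u x) (g x $ i) * \<zeta> x) \<longlonglongrightarrow> (if u x = 0 then 0 else g x $ i) * \<zeta> x"
        by (intro AE_I2 tendsto_mult lim tendsto_const)
      have "(\<lambda>x. g x $ i - (if u x = 0 then g x $ i else 0)) \<in> borel_measurable ?M"
        using gm ifm by (rule borel_measurable_diff)
      moreover have "(\<lambda>x. g x $ i - (if u x = 0 then g x $ i else 0)) = (\<lambda>x. if u x = 0 then 0 else g x $ i)"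
        by auto
      ultimately show "(\<lambda>x. (if u x = 0 then 0 else g x $ i) * \<zeta> x) \<in> borel_measurable ?M"
        using \<zeta>m by (intro borel_measurable_times) auto
    qed (intro borel_measurable_times \<zeta>m C1_map_measurable(2)[OF T um gm])+
    have "(\<lambda>k. LINT x|?M. T k (u x) * partial_deriv i \<zeta> x) = (\<lambda>k. - (LINT x|?M. T' k (u x) (g x $ i) * \<zeta> x))"
      using weak_chain_rule[OF \<Omega> u T \<zeta>] by auto
    then have "(LINT x|?M. u x * partial_deriv i \<zeta> x) = - (LINT x|?M. (if u x = 0 then 0 else g x $ i) * \<zeta> x)"
      using LIMSEQ_unique[OF 1] tendsto_minus[OF 2] by simp
    then have eq: "(LINT x|?M. g x $ i * \<zeta> x) = (LINT x|?M. (if u x = 0 then 0 else g x $ i) * \<zeta> x)"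
      using uD(4)[OF \<zeta>] by simp
    have "(LINT x|?M. (if u x = 0 then g x $ i else 0) * \<zeta> x)
      = (LINT x|?M. g x $ i * \<zeta> x - (if u x = 0 then 0 else g x $ i) * \<zeta> x)"
      by (intro Bochner_Integration.integral_cong) auto
    also have "\<dots> = (LINT x|?M. g x $ i * \<zeta> x) - (LINT x|?M. (if u x = 0 then 0 else g x $ i) * \<zeta> x)"
    proof (rule Bochner_Integration.integral_diff)
      show gi: "integrable ?M (\<lambda>x. g x $ i * \<zeta> x)" by (intro square_integrable_mult uD s\<zeta>)
      have "integrable ?M (\<lambda>x. g x $ i * \<zeta> x - (if u x = 0 then g x $ i else 0) * \<zeta> x)"
        by (intro Bochner_Integration.integrable_diff gi square_integrable_mult sq s\<zeta>)
      moreover have "(\<lambda>x. g x $ i * \<zeta> x - (if u x = 0 then g x $ i else 0) * \<zeta> x) = (\<lambda>x. (if u x = 0 then 0 else g x $ i) * \<zeta> x)"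
        by auto
      ultimately show "integrable ?M (\<lambda>x. (if u x = 0 then 0 else g x $ i) * \<zeta> x)" by simp
    qed
    finally show "(LINT x|?M. (if u x = 0 then g x $ i else 0) * \<zeta> x) = 0" using eq by simp
  qed
  then have "AE x in ?M. \<forall>i\<in>UNIV. (if u x = 0 then g x $ i else 0) = 0" by (intro AE_finite_allI) auto
  then show ?thesis by eventually_elim (auto simp: vec_eq_iff)
qed

context admissible_function
begin

text \<open>\<open>radial p\<close> is singular at zero. Composed with a cut-off it becomes \<open>C\<^sup>1\<close>, so the chain rule can be applied
  both to \<open>u\<close> and to \<open>radial p \<circ> u\<close>; uniqueness of weak gradients compares the two results.\<close>
lemma weak_gradient_radial_p:
  fixes u :: "real^'n::finite \<Rightarrow> complex"
  assumes \<Omega>: "open \<Omega>" and u: "has_H10_gradient \<Omega> u g" and w: "has_H10_gradient \<Omega> (\<lambda>x. radial p (u x)) h"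
  shows "AE x in lebesgue_on \<Omega>. u x \<noteq> 0 \<longrightarrow> (\<forall>i. h x $ i = radial' p p' (u x) (g x $ i))"
proof -
  note uD = has_H10_gradientD[OF u] and wD = has_H10_gradientD[OF w]
  let ?M = "lebesgue_on \<Omega>"
  have "AE x in ?M. radial' (cut k) (cut' k) (u x) (g x $ i) - radial' (cutoff k) (cutoff' k) (radial p (u x)) (h x $ i) = 0" for i k
  proof (rule AE_eq_0_if_weakly_0[OF \<Omega>])
    obtain C where S: "C1_map C (radial (cut k)) (radial' (cut k) (cut' k))" using C1_map_cut by blast
    note T = C1_map_cutoff[of k]
    note sq = C1_map_square_integrable(2)[OF S uD(1) uD(3)[of i]] C1_map_square_integrable(2)[OF T wD(1) wD(3)[of i]]
    show "square_integrable \<Omega> (\<lambda>x. radial' (cut k) (cut' k) (u x) (g x $ i) - radial' (cutoff k) (cutoff' k) (radial p (u x)) (h x $ i))"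
      by (intro square_integrable_diff sq)
    fix \<zeta> assume \<zeta>: "test_function \<Omega> \<zeta>"
    have "(LINT x|?M. radial' (cut k) (cut' k) (u x) (g x $ i) * \<zeta> x)
        = (LINT x|?M. radial' (cutoff k) (cutoff' k) (radial p (u x)) (h x $ i) * \<zeta> x)"
      using weak_chain_rule[OF \<Omega> u S \<zeta>, of i] weak_chain_rule[OF \<Omega> w T \<zeta>, of i] by (simp add: radial_cut)
    then show "(LINT x|?M. (radial' (cut k) (cut' k) (u x) (g x $ i) - radial' (cutoff k) (cutoff' k) (radial p (u x)) (h x $ i)) * \<zeta> x) = 0"
      using square_integrable_mult[OF sq(1) square_integrable_test_function(1)[OF \<Omega> \<zeta>]]
        square_integrable_mult[OF sq(2) square_integrable_test_function(1)[OF \<Omega> \<zeta>]]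
      by (simp add: left_diff_distrib)
  qed
  then have "AE x in ?M. \<forall>i\<in>UNIV. \<forall>k. radial' (cut k) (cut' k) (u x) (g x $ i) - radial' (cutoff k) (cutoff' k) (radial p (u x)) (h x $ i) = 0"
    by (intro AE_finite_allI) (auto simp: AE_all_countable)
  then show ?thesis
  proof eventually_elim
    case (elim x)
    show ?case
    proof (intro impI allI)
      fix i assume ux: "u x \<noteq> 0"
      let ?t = "(norm (u x))\<^sup>2"
      have eq: "(norm (radial p (u x)))\<^sup>2 = ?t * (p ?t)\<^sup>2"
        by (simp add: radial_def norm_mult power_mult_distrib mult_ac)
      \<comment> \<open>At a point where u is nonzero some cut-off is flat with value 1 at the
        squared modulus of \<open>radial p (u x)\<close>. For that \<open>k\<close> both cut
        derivatives reduce to the uncut ones; the index may depend on x because the null set already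
        covers all \<open>k\<close>.\<close>
      have "?t * (p ?t)\<^sup>2 > 0" using ux phi_pos[of "norm (u x)"] by (simp add: p_def)
      from eventually_happens'[OF sequentially_bot eventually_cutoff_eq_1[OF this]]
      obtain k where "cutoff k (?t * (p ?t)\<^sup>2) = 1" "cutoff' k (?t * (p ?t)\<^sup>2) = 0" by blast
      then have "radial' (cut k) (cut' k) (u x) v = radial' p p' (u x) v"
        "radial' (cutoff k) (cutoff' k) (radial p (u x)) v = v" for v
        using eq by (simp_all add: radial'_def cut_def cut'_def)
      then show "h x $ i = radial' p p' (u x) (g x $ i)" using elim by (metis UNIV_I eq_iff_diff_eq_0)
    qed
  qed
qed

lemma pointwise_nonneg:
  fixes A :: "complex^'n^'n::finite"
  assumes sym: "transpose (map_matrix Im A) = map_matrix Im A" and z: "z \<noteq> 0"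
    and le: "\<And>\<xi>::real^'n. \<bar>norm z * deriv \<phi> (norm z)\<bar> * \<bar>(map_matrix Im A *v \<xi>) \<bullet> \<xi>\<bar>
         \<le> 2 * sqrt (\<phi> (norm z) * flux' (norm z)) * ((map_matrix Re A *v \<xi>) \<bullet> \<xi>)"
    and h: "\<And>i. h $ i = radial' p p' z (g $ i)"
  shows "0 \<le> Re (cdot (A *v g) h)"
proof -
  define s where "s = norm z"
  define \<omega> where "\<omega> = z / of_real s"
  define X :: "real^'n" where "X = (\<chi> i. Re (cnj \<omega> * g $ i))"
  define Y :: "real^'n" where "Y = (\<chi> i. Im (cnj \<omega> * g $ i))"
  have s: "s > 0" using z by (simp add: s_def)
  have \<omega>1: "norm \<omega> = 1" "z = of_real s * \<omega>"
    using s by (auto simp: \<omega>_def s_def norm_divide)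
  then have \<omega>: "norm \<omega> = 1" "\<omega> * cnj \<omega> = 1" "z = of_real s * \<omega>"
    using complex_norm_square[of \<omega>] by simp_all
  have XY: "Complex (X $ i) (Y $ i) = cnj \<omega> * g $ i" for i
    by (simp add: X_def Y_def complex_eq_iff)
  have g: "g $ i = \<omega> * Complex (X $ i) (Y $ i)" for i
    unfolding XY using \<omega>(2) by (simp flip: mult.assoc)
  have "z \<bullet> g $ i = s * X $ i" for i
    unfolding \<omega>(3) X_def by (simp add: inner_complex_def algebra_simps)
  then have "h $ i = of_real (\<phi> s) * (\<omega> * Complex (X $ i) (Y $ i)) + of_real (deriv \<phi> s * X $ i) * (of_real s * \<omega>)" for i
    unfolding h radial'_p using s by (simp add: s_def[symmetric] g[symmetric] \<omega>(3)[symmetric])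
  also have "\<dots> i = \<omega> * Complex (flux' s * X $ i) (\<phi> s * Y $ i)" for i
  proof -
    have "of_real (\<phi> s) * Complex (X $ i) (Y $ i) + of_real (deriv \<phi> s * X $ i) * of_real s
      = Complex (flux' s * X $ i) (\<phi> s * Y $ i)"
      by (simp add: complex_eq_iff flux'_def algebra_simps)
    then show ?thesis by (simp add: algebra_simps flip: distrib_left)
  qed
  finally have h': "h $ i = \<omega> * Complex (flux' s * X $ i) (\<phi> s * Y $ i)" for i .
  have swap: "(map_matrix Im A *v X) \<bullet> Y = (map_matrix Im A *v Y) \<bullet> X"
    using sym by (metis dot_lmul_matrix inner_commute vector_transpose_matrix)
  have "0 \<le> flux' s * ((map_matrix Re A *v X) \<bullet> X) + \<phi> s * ((map_matrix Re A *v Y) \<bullet> Y)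
     - (flux' s - \<phi> s) * ((map_matrix Im A *v Y) \<bullet> X)"
    by (rule form_bound[OF sym flux'_pos[OF s] phi_pos[OF s]]) (use le in \<open>simp add: flux'_def s_def\<close>)
  then show ?thesis
    unfolding Re_cdot_eq[OF \<omega>(1) g h'] swap by (simp add: algebra_simps)
qed

lemma dissipative_if_inequality:
  fixes A :: "real^'n::finite \<Rightarrow> complex^'n^'n"
  assumes \<Omega>: "open \<Omega>"
    and sym: "AE x in lebesgue_on \<Omega>. transpose (map_matrix Im (A x)) = map_matrix Im (A x)"
    and le: "AE x in lebesgue_on \<Omega>. \<forall>s>0. \<forall>\<xi>::real^'n.
       \<bar>s * deriv \<phi> s\<bar> * \<bar>(map_matrix Im (A x) *v \<xi>) \<bullet> \<xi>\<bar>
         \<le> 2 * sqrt (\<phi> s * flux' s) * ((map_matrix Re (A x) *v \<xi>) \<bullet> \<xi>)"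
  shows "LPhi_dissipative \<Omega> A \<phi>"
  unfolding LPhi_dissipative_def radial_p[symmetric]
proof (intro allI impI)
  fix u g h assume u: "has_H10_gradient \<Omega> u g" and w: "has_H10_gradient \<Omega> (\<lambda>x. radial p (u x)) h"
  let ?f = "\<lambda>x. cdot (A x *v g x) (h x)"
  have "AE x in lebesgue_on \<Omega>. 0 \<le> Re (?f x)"
    using sym le weak_gradient_zero_on_zero_set[OF \<Omega> u] weak_gradient_radial_p[OF \<Omega> u w]
  proof eventually_elim
    case (elim x)
    show ?case
    proof (cases "u x = 0")
      case True
      then show ?thesis using elim by (simp add: cdot_def)
    next
      case False
      then show ?thesis using elim by (intro pointwise_nonneg[of "A x" "u x" "h x" "g x"]) auto
    qed
  qed
  then have "0 \<le> (LINT x|lebesgue_on \<Omega>. Re (?f x))" by (rule integral_nonneg_AE)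
  \<comment> \<open>A non-integrable integrand has Bochner integral 0 by convention, so that case is
    immediate.\<close>
  then show "0 \<le> Re (LINT x|lebesgue_on \<Omega>. ?f x)"
    by (cases "integrable (lebesgue_on \<Omega>) ?f") (simp_all add: not_integrable_integral_eq)
qed

end

section \<open>Compositions that stay in the closure of the test functions\<close>

lemma integrable_bounded_support:
  fixes f :: "real^'n::finite \<Rightarrow> 'b::euclidean_space"
  assumes "open \<Omega>" "f \<in> borel_measurable (lebesgue_on \<Omega>)" "compact K"
    and "AE x in lebesgue_on \<Omega>. norm (f x) \<le> indicator K x * C"
  shows "integrable (lebesgue_on \<Omega>) f"
proof (rule Bochner_Integration.integrable_bound)
  have K: "K \<in> lmeasurable" by (rule lmeasurable_compact[OF assms(3)])
  have "integrable lebesgue (\<lambda>x. indicator K x * C)"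
    using fmeasurableD[OF K] fmeasurableD2[OF K]
    by (intro integrable_mult_left integrable_real_indicator) (auto simp: less_top)
  from integrable_mult_indicator[OF _ this, of \<Omega>]
  show "integrable (lebesgue_on \<Omega>) (\<lambda>x. indicator K x * C)"
    using assms(1) by (subst integrable_restrict_space) auto
  show "AE x in lebesgue_on \<Omega>. norm (f x) \<le> norm (indicator K x * C)"
    using assms(4) by eventually_elim simp
qed (rule assms)

lemma norm_vec_le_sum:
  fixes v :: "complex^'n::finite"
  assumes "\<And>i. norm (v $ i) \<le> C"
  shows "norm v \<le> of_nat (CARD('n)) * C"
proof -
  have "norm v \<le> (\<Sum>i\<in>UNIV. norm (v $ i))" unfolding norm_vec_def by (rule L2_set_le_sum) auto
  also have "\<dots> \<le> of_nat (CARD('n)) * C" using assms by (intro sum_bounded_above) auto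
  finally show ?thesis .
qed

lemma integral_norm_square_tendsto_0:
  fixes f :: "nat \<Rightarrow> real^'n::finite \<Rightarrow> 'b::euclidean_space"
  assumes \<Omega>: "open \<Omega>" and K: "compact K"
    and m: "\<And>k. f k \<in> borel_measurable (lebesgue_on \<Omega>)" "w \<in> borel_measurable (lebesgue_on \<Omega>)"
    and b: "\<And>k x. norm (w x - f k x) \<le> indicator K x * C"
    and lim: "\<And>x. (\<lambda>k. f k x) \<longlonglongrightarrow> w x"
  shows "(\<lambda>k. LINT x|lebesgue_on \<Omega>. (norm (w x - f k x))\<^sup>2) \<longlonglongrightarrow> 0"
proof -
  have "(\<lambda>k. LINT x|lebesgue_on \<Omega>. (norm (w x - f k x))\<^sup>2) \<longlonglongrightarrow> (LINT x|lebesgue_on \<Omega>. 0)"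
  proof (rule integral_dominated_convergence[where w = "\<lambda>x. indicator K x * C\<^sup>2"])
    show "integrable (lebesgue_on \<Omega>) (\<lambda>x. indicator K x * C\<^sup>2)"
      by (rule integrable_bounded_support[OF \<Omega> _ K, of _ "C\<^sup>2"])
         (use K in \<open>auto intro!: measurable_restrict_space1 borel_measurable_times borel_measurable_indicator simp: lmeasurable_compact fmeasurableD\<close>)
    show "AE x in lebesgue_on \<Omega>. norm ((norm (w x - f k x))\<^sup>2) \<le> indicator K x * C\<^sup>2" for k
    proof (rule AE_I2)
      fix x
      have "(norm (w x - f k x))\<^sup>2 \<le> (indicator K x * C)\<^sup>2" by (intro power_mono b) auto
      then show "norm ((norm (w x - f k x))\<^sup>2) \<le> indicator K x * C\<^sup>2"
        using b[of x k] by (auto simp: indicator_def)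
    qed
    show "AE x in lebesgue_on \<Omega>. (\<lambda>k. (norm (w x - f k x))\<^sup>2) \<longlonglongrightarrow> 0"
    proof (rule AE_I2)
      fix x
      have "(\<lambda>k. (norm (w x - f k x))\<^sup>2) \<longlonglongrightarrow> (norm (w x - w x))\<^sup>2" by (intro tendsto_intros lim)
      then show "(\<lambda>k. (norm (w x - f k x))\<^sup>2) \<longlonglongrightarrow> 0" by simp
    qed
  qed (use m in auto)
  then show ?thesis by simp
qed

text \<open>Uniform bounds on a common compact set upgrade pointwise convergence to L^2 convergence
  of values and gradients. The limit gradient \<open>h\<close> may therefore be discontinuous, as
  happens for \<open>radial p \<circ> v\<close> at the zeros of v.\<close>

lemma has_H10_gradient_limit:
  fixes w :: "real^'n::finite \<Rightarrow> complex"
  assumes \<Omega>: "open \<Omega>" and \<psi>: "\<And>k. test_function \<Omega> (\<psi> k)"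
    and K: "compact K" "\<And>k x. x \<notin> K \<Longrightarrow> \<psi> k x = 0"
    and lim: "\<And>x. (\<lambda>k. \<psi> k x) \<longlonglongrightarrow> w x" "\<And>i x. (\<lambda>k. partial_deriv i (\<psi> k) x) \<longlonglongrightarrow> h x $ i"
    and C: "\<And>k x. norm (\<psi> k x) \<le> C" "\<And>k i x. norm (partial_deriv i (\<psi> k) x) \<le> C"
  shows "has_H10_gradient \<Omega> w h"
proof -
  let ?M = "lebesgue_on \<Omega>"
  let ?N = "of_nat (CARD('n)) * C"
  note D = test_functionD[OF \<psi>]
  have gc: "continuous_on UNIV (grad (\<psi> k))" for k
    unfolding grad_def using D(3) by (intro continuous_on_vec_lambda)
  have glim: "(\<lambda>k. grad (\<psi> k) x) \<longlonglongrightarrow> h x" for x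
    by (intro vec_tendstoI) (simp add: grad_def lim)
  have \<psi>m: "\<psi> k \<in> borel_measurable ?M" "partial_deriv i (\<psi> k) \<in> borel_measurable ?M" "grad (\<psi> k) \<in> borel_measurable ?M" for k i
    by (intro borel_measurable_continuous_lebesgue_on D gc)+
  have wm: "w \<in> borel_measurable ?M" and hm: "h \<in> borel_measurable ?M"
    by (rule borel_measurable_LIMSEQ_metric[of "\<lambda>k. \<psi> k"]; use \<psi>m lim in auto)
       (rule borel_measurable_LIMSEQ_metric[of "\<lambda>k. grad (\<psi> k)"]; use \<psi>m glim in auto)
  have w0: "w x = 0" if "x \<notin> K" for x
    using lim(1)[of x] K(2)[OF that] by (simp add: LIMSEQ_const_iff)
  have pd0: "partial_deriv i (\<psi> k) x = 0" if "x \<notin> K" for i k x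
    using that K compact_imp_closed partial_deriv_outside_support by metis
  have h0: "h x = 0" if "x \<notin> K" for x
    using lim(2)[of _ x] pd0[OF that] by (simp add: LIMSEQ_const_iff vec_eq_iff)
  have wb: "norm (w x) \<le> C" for x
    by (rule Lim_bounded[OF tendsto_norm[OF lim(1)], of 0]) (use C in auto)
  have gb: "norm (grad (\<psi> k) x) \<le> ?N" for k x by (rule norm_vec_le_sum) (simp add: grad_def C)
  have hb: "norm (h x) \<le> ?N" for x
    by (rule Lim_bounded[OF tendsto_norm[OF glim], of 0]) (use gb in auto)
  have sq: "square_integrable \<Omega> f" if m: "f \<in> borel_measurable ?M" and b: "\<And>x. norm (f x) \<le> B" "\<And>x. x \<notin> K \<Longrightarrow> f x = 0"
    for f :: "real^'n \<Rightarrow> 'c::euclidean_space" and B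
    unfolding square_integrable_def
  proof
    show "integrable ?M (\<lambda>x. (norm (f x))\<^sup>2)"
    proof (rule integrable_bounded_support[OF \<Omega> _ K(1)])
      show "AE x in ?M. norm ((norm (f x))\<^sup>2) \<le> indicator K x * B\<^sup>2"
        using power_mono[OF b(1) norm_ge_zero, of _ 2] b(2) by (intro AE_I2) (auto simp: indicator_def)
    qed (use m in auto)
  qed (rule m)
  have sw: "square_integrable \<Omega> w" and sh: "square_integrable \<Omega> h"
    by (rule sq[OF wm wb w0]; simp) (rule sq[OF hm hb h0]; simp)
  have weak: "(LINT x|?M. w x * partial_deriv i \<zeta> x) = - (LINT x|?M. h x $ i * \<zeta> x)" if \<zeta>: "test_function \<Omega> \<zeta>" for \<zeta> i
  proof -
    note s\<zeta> = square_integrable_test_function[OF \<Omega> \<zeta>]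
    note D\<zeta> = test_functionD[OF \<zeta>]
    obtain L where L: "compact L" "\<And>x. x \<notin> L \<Longrightarrow> \<zeta> x = 0" "\<And>x i. x \<notin> L \<Longrightarrow> partial_deriv i \<zeta> x = 0"
      using test_function_supportE[OF \<zeta>] by metis
    have int: "integrable ?M (\<lambda>x. C * norm (f x))"
      if "continuous_on UNIV f" "\<And>x. x \<notin> L \<Longrightarrow> f x = 0" for f :: "real^'n \<Rightarrow> complex"
    proof -
      have "integrable lebesgue (\<lambda>x. C * norm (f x))"
        by (rule integrable_continuous_compact_support(2)[OF _ L(1)]) (use that in \<open>auto intro!: continuous_intros\<close>)
      from integrable_mult_indicator[OF _ this, of \<Omega>] show ?thesis
        using \<Omega> by (subst integrable_restrict_space) auto
    qed
    have \<zeta>m: "\<zeta> \<in> borel_measurable ?M" "partial_deriv i \<zeta> \<in> borel_measurable ?M"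
      by (intro borel_measurable_continuous_lebesgue_on D\<zeta>)+
    have l1: "(\<lambda>k. LINT x|?M. \<psi> k x * partial_deriv i \<zeta> x) \<longlonglongrightarrow> (LINT x|?M. w x * partial_deriv i \<zeta> x)"
    proof (rule integral_dominated_convergence[where w = "\<lambda>x. C * norm (partial_deriv i \<zeta> x)"])
      show "integrable ?M (\<lambda>x. C * norm (partial_deriv i \<zeta> x))" by (rule int) (use D\<zeta> L in auto)
      show "AE x in ?M. norm (\<psi> k x * partial_deriv i \<zeta> x) \<le> C * norm (partial_deriv i \<zeta> x)" for k
        using C by (auto simp: norm_mult intro!: mult_right_mono)
      show "AE x in ?M. (\<lambda>k. \<psi> k x * partial_deriv i \<zeta> x) \<longlonglongrightarrow> w x * partial_deriv i \<zeta> x"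
        by (intro AE_I2 tendsto_intros lim)
    qed (intro borel_measurable_times \<zeta>m wm \<psi>m)+
    have l2: "(\<lambda>k. LINT x|?M. partial_deriv i (\<psi> k) x * \<zeta> x) \<longlonglongrightarrow> (LINT x|?M. h x $ i * \<zeta> x)"
    proof (rule integral_dominated_convergence[where w = "\<lambda>x. C * norm (\<zeta> x)"])
      show "integrable ?M (\<lambda>x. C * norm (\<zeta> x))" by (rule int) (use D\<zeta> L in auto)
      show "AE x in ?M. norm (partial_deriv i (\<psi> k) x * \<zeta> x) \<le> C * norm (\<zeta> x)" for k
        using C by (auto simp: norm_mult intro!: mult_right_mono)
      show "AE x in ?M. (\<lambda>k. partial_deriv i (\<psi> k) x * \<zeta> x) \<longlonglongrightarrow> h x $ i * \<zeta> x"
        by (intro AE_I2 tendsto_mult tendsto_const lim)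
    qed (intro borel_measurable_times \<zeta>m borel_measurable_vec_nth hm \<psi>m)+
    have e: "(LINT x|?M. \<psi> k x * partial_deriv i \<zeta> x) = - (LINT x|?M. partial_deriv i (\<psi> k) x * \<zeta> x)" for k
      by (rule integral_by_parts[OF \<Omega> \<zeta> D(1) D(3)])
    show ?thesis using LIMSEQ_unique[OF l1[unfolded e] tendsto_minus[OF l2]] .
  qed
  have "\<exists>\<psi>. test_function \<Omega> \<psi> \<and> H1_norm \<Omega> (\<lambda>x. w x - \<psi> x) (\<lambda>x. h x - grad \<psi> x) < \<epsilon>" if "\<epsilon> > 0" for \<epsilon>
  proof -
    have "(\<lambda>k. LINT x|?M. (norm (w x - \<psi> k x))\<^sup>2) \<longlonglongrightarrow> 0"
    proof (rule integral_norm_square_tendsto_0[OF \<Omega> K(1) \<psi>m(1) wm _ lim(1)])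
      show "norm (w x - \<psi> k x) \<le> indicator K x * (2 * C)" for k x
        using norm_triangle_ineq4[of "w x" "\<psi> k x"] wb[of x] C(1)[of k x] w0[of x] K(2)[of x k]
        by (auto simp: indicator_def)
    qed
    moreover have "(\<lambda>k. LINT x|?M. (norm (h x - grad (\<psi> k) x))\<^sup>2) \<longlonglongrightarrow> 0"
    proof (rule integral_norm_square_tendsto_0[OF \<Omega> K(1) \<psi>m(3) hm _ glim])
      have "grad (\<psi> k) x = 0" if "x \<notin> K" for k x using pd0[OF that] by (simp add: grad_def vec_eq_iff)
      then show "norm (h x - grad (\<psi> k) x) \<le> indicator K x * (2 * ?N)" for k x
        using norm_triangle_ineq4[of "h x" "grad (\<psi> k) x"] hb[of x] gb[of k x] h0[of x]
        by (auto simp: indicator_def)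
    qed
    ultimately have "(\<lambda>k. H1_norm \<Omega> (\<lambda>x. w x - \<psi> k x) (\<lambda>x. h x - grad (\<psi> k) x)) \<longlonglongrightarrow> sqrt (0 + 0)"
      unfolding H1_norm_def by (intro tendsto_intros)
    then have "\<forall>\<^sub>F k in sequentially. H1_norm \<Omega> (\<lambda>x. w x - \<psi> k x) (\<lambda>x. h x - grad (\<psi> k) x) < \<epsilon>"
      using that by (intro order_tendstoD) auto
    from eventually_happens'[OF sequentially_bot this] show ?thesis using \<psi> by blast
  qed
  then show ?thesis unfolding has_H10_gradient_def has_H1_gradient_def using sw sh weak by blast
qed

lemma has_H10_gradient_test_function:
  assumes "open \<Omega>" "test_function \<Omega> \<psi>"
  shows "has_H10_gradient \<Omega> \<psi> (grad \<psi>)"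
proof -
  note D = test_functionD[OF assms(2)]
  obtain K where K: "compact K" "\<And>x. x \<notin> K \<Longrightarrow> \<psi> x = 0" "\<And>x i. x \<notin> K \<Longrightarrow> partial_deriv i \<psi> x = 0"
    using test_function_supportE[OF assms(2)] by metis
  obtain C where C: "\<And>x. norm (\<psi> x) \<le> C" using bounded_if_compact_support[OF D(2) K(1,2)] by metis
  have "continuous_on UNIV (grad \<psi>)" unfolding grad_def using D(3) by (intro continuous_on_vec_lambda)
  moreover have "grad \<psi> x = 0" if "x \<notin> K" for x using K(3)[OF that] by (simp add: grad_def vec_eq_iff)
  ultimately obtain C' where C': "\<And>x. norm (grad \<psi> x) \<le> C'" using bounded_if_compact_support[OF _ K(1)] by metis
  have "norm (partial_deriv i \<psi> x) \<le> C'" for i x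
    using Finite_Cartesian_Product.norm_nth_le[of "grad \<psi> x" i] C'[of x] by (simp add: grad_def)
  then show ?thesis
    using C K(1,2) assms
    by (intro has_H10_gradient_limit[of \<Omega> "\<lambda>_. \<psi>" K _ _ "max C C'"]) (auto simp: grad_def le_max_iff_disj)
qed

text \<open>Approximating q' by Weierstrass and integrating from 0 controls the function and its
  derivative at once.\<close>

lemma C1_polynomial_approximation:
  fixes q q' :: "real \<Rightarrow> real"
  assumes q: "\<And>t. t \<in> {0..M} \<Longrightarrow> (q has_real_derivative q' t) (at t)" "continuous_on {0..M} q'"
    and M: "M \<ge> 0" and \<delta>: "\<delta> > 0"
  obtains c :: "nat \<Rightarrow> real" and n and P' where
    "\<And>t. ((\<lambda>t. \<Sum>j\<le>n. c j * t ^ j) has_real_derivative P' t) (at t)"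
    "\<And>t. t \<in> {0..M} \<Longrightarrow> \<bar>(\<Sum>j\<le>n. c j * t ^ j) - q t\<bar> \<le> \<delta>"
    "\<And>t. t \<in> {0..M} \<Longrightarrow> \<bar>P' t - q' t\<bar> \<le> \<delta>"
proof -
  \<comment> \<open>Integration over [0, M] multiplies the error by at most M, so this choice keeps
    both e and e M below \<delta>.\<close>
  define e where "e = \<delta> / (M + 1)"
  have e: "e > 0" "e * M \<le> \<delta>" "e \<le> \<delta>" unfolding e_def using M \<delta> by (auto simp: field_simps)
  obtain g where g: "real_polynomial_function g" "\<And>t. t \<in> {0..M} \<Longrightarrow> \<bar>q' t - g t\<bar> < e"
    using Stone_Weierstrass_real_polynomial_function[OF compact_Icc q(2) e(1)] by blast
  obtain a n where a: "g = (\<lambda>t. \<Sum>j\<le>n. a j * t ^ j)" using g(1) unfolding real_polynomial_function_iff_sum by blast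
  \<comment> \<open>Coefficients of the antiderivative of \<open>g\<close> that agrees with q at
    0.\<close>
  define c where "c j = (case j of 0 \<Rightarrow> q 0 | Suc j \<Rightarrow> a j / real (Suc j))" for j
  define P where "P t = (\<Sum>j\<le>Suc n. c j * t ^ j)" for t
  have P: "P = (\<lambda>t. q 0 + (\<Sum>j\<le>n. a j / real (Suc j) * t ^ Suc j))"
    unfolding P_def sum.atMost_Suc_shift by (simp add: c_def)
  have D: "(P has_real_derivative g t) (at t)" for t
    unfolding P a by (auto intro!: derivative_eq_intros sum.cong simp del: of_nat_Suc power_Suc)
  have g': "\<bar>g t - q' t\<bar> \<le> e" if "t \<in> {0..M}" for t using g(2)[OF that] by linarith
  have "\<bar>P t - q t\<bar> \<le> \<delta>" if t: "t \<in> {0..M}" for t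
  proof -
    have "norm ((P t - q t) - (P 0 - q 0)) \<le> e * norm (t - 0)"
    proof (rule differentiable_bound[of "{0..M}" "\<lambda>t. P t - q t" "\<lambda>t. (*) (g t - q' t)"])
      show "((\<lambda>t. P t - q t) has_derivative (*) (g x - q' x)) (at x within {0..M})" if "x \<in> {0..M}" for x
        using DERIV_diff[OF D q(1)[OF that]] by (auto simp: has_field_derivative_def intro: has_derivative_at_withinI)
      show "onorm ((*) (g x - q' x)) \<le> e" if "x \<in> {0..M}" for x
        using g'[OF that] by (intro onorm_le) (auto simp: abs_mult intro: mult_right_mono)
    qed (use t M in auto)
    moreover have "P 0 = q 0" by (simp add: P)
    ultimately have "\<bar>P t - q t\<bar> \<le> e * t" using t by simp
    also have "\<dots> \<le> e * M" using e t by (intro mult_left_mono) auto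
    finally show ?thesis using e by linarith
  qed
  then show ?thesis
    using that[of c "Suc n" g] D g' e(3) unfolding P_def[abs_def] by fastforce
qed

text \<open>|v|^2 is v times its conjugate and hence smooth, unlike |v|; the remaining factor v
  preserves the support.\<close>

lemma test_function_radial_polynomial:
  assumes "test_function \<Omega> v"
  shows "test_function \<Omega> (\<lambda>x. radial (\<lambda>t. \<Sum>j\<le>n. c j * t ^ j) (v x))"
proof -
  obtain K where K: "compact K" "K \<subseteq> \<Omega>" "\<And>x. x \<notin> K \<Longrightarrow> v x = 0"
    using test_function_supportE[OF assms] by metis
  show ?thesis
  proof (rule test_functionI[OF _ K(1,2)])
    fix k
    have "Ck k v" using assms by (simp add: test_function_def)
    then have "Ck k (\<lambda>x. (\<Sum>j\<le>n. of_real (c j) * (v x * cnj (v x)) ^ j) * v x)"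
      by (intro Ck_mult Ck_sum Ck_power Ck_cnj Ck_const)
    then show "Ck k (\<lambda>x. radial (\<lambda>t. \<Sum>j\<le>n. c j * t ^ j) (v x))"
      by (simp add: radial_def flip: complex_norm_square)
  qed (use K in \<open>simp add: radial_def\<close>)
qed

lemma radial'_diff: "radial' P P' z v - radial' Q Q' z v = radial' (\<lambda>t. P t - Q t) (\<lambda>t. P' t - Q' t) z v"
  by (simp add: radial'_def algebra_simps)

context admissible_function
begin

text \<open>A polynomial in \<open>|v|\<^sup>2\<close> times \<open>v\<close> is again a test function, so approximating \<open>p\<close> by polynomials in \<open>C\<^sup>1\<close>
  (after a cut-off at zero) replaces mollification.\<close>
lemma has_H10_gradient_radial_p:
  fixes v :: "real^'n::finite \<Rightarrow> complex"
  assumes \<Omega>: "open \<Omega>" and v: "test_function \<Omega> v"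
    and C: "\<And>x i. v x \<noteq> 0 \<Longrightarrow> \<phi> (norm (v x)) * norm (partial_deriv i v x) \<le> C"
      "\<And>x i. v x \<noteq> 0 \<Longrightarrow> flux' (norm (v x)) * norm (partial_deriv i v x) \<le> C"
  shows "has_H10_gradient \<Omega> (\<lambda>x. radial p (v x))
    (\<lambda>x. \<chi> i. if v x = 0 then 0 else radial' p p' (v x) (partial_deriv i v x))"
proof -
  note D = test_functionD[OF v]
  obtain K where K: "compact K" "\<And>x. x \<notin> K \<Longrightarrow> v x = 0" "\<And>x i. x \<notin> K \<Longrightarrow> partial_deriv i v x = 0"
    using test_function_supportE[OF v] by metis
  obtain V0 where V0: "V0 \<ge> 0" "\<And>x. norm (v x) \<le> V0" using bounded_if_compact_support[OF D(2) K(1,2)] by metis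
  have "\<exists>B. \<forall>x. norm (partial_deriv i v x) \<le> B" for i
    using bounded_if_compact_support[OF D(3) K(1,3)] by metis
  then obtain B where B: "\<And>i x. norm (partial_deriv i v x) \<le> B i" by metis
  define V where "V = Max (insert V0 (range B))"
  have V: "norm (v x) \<le> V" "norm (partial_deriv i v x) \<le> V" "V \<ge> 0" for x i
  proof -
    have "V0 \<le> V" "B i \<le> V" unfolding V_def by (intro Max_ge; simp)+
    then show "norm (v x) \<le> V" "norm (partial_deriv i v x) \<le> V" "V \<ge> 0"
      using V0 B order_trans by blast+
  qed
  define M where "M = V\<^sup>2"
  have M: "M \<ge> 0" "(norm (v x))\<^sup>2 \<in> {0..M}" for x
    unfolding M_def using V by (auto intro: power_mono)
  \<comment> \<open>Here the cut-off acts on |v|^2 itself, not on the modulus of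
    \<open>radial p\<close>. The upper transition is harmless since v is bounded and the limit in k
    is taken pointwise.\<close>
  define q where "q k t = p t * cutoff k t" for k t
  define q' where "q' k t = p' t * cutoff k t + p t * cutoff' k t" for k t
  have qC1: "(q k has_real_derivative q' k t) (at t)" "continuous_on UNIV (q' k)" for k t
  proof -
    have "q k t = 0" "q' k t = 0" if "t < 1 / real (Suc k)" for t
      using that cutoff_eq_0[of k t] by (auto simp: q_def q'_def field_simps)
    moreover have "(q k has_real_derivative q' k t) (at t)" if "t > 0" for t
      using DERIV_mult[OF DERIV_p[OF that] DERIV_cutoff[of k]] unfolding q_def q'_def by (simp add: algebra_simps)
    moreover have "continuous_on {0<..} (cutoff k)"
      using DERIV_cutoff by (intro DERIV_continuous_on) (auto intro: has_field_derivative_at_within)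
    then have "continuous_on {0<..} (q' k)"
      unfolding q'_def by (intro continuous_intros continuous_p continuous_p' continuous_cutoff')
    ultimately show "(q k has_real_derivative q' k t) (at t)" "continuous_on UNIV (q' k)"
      using C1_extend_by_zero[of "1 / real (Suc k)" "q k" "q' k"] by auto
  qed
  define \<delta> where "\<delta> k = inverse (real (Suc k))" for k
  have \<delta>: "\<delta> k > 0" "\<delta> k \<le> 1" "\<delta> \<longlonglongrightarrow> 0" for k
    unfolding \<delta>_def using LIMSEQ_inverse_real_of_nat by (simp_all add: inverse_le_1_iff)
  define approx where "approx k c n P' \<longleftrightarrow> (\<forall>t. ((\<lambda>t. \<Sum>j\<le>n. c j * t ^ j) has_real_derivative P' t) (at t)) \<and>
      (\<forall>t\<in>{0..M}. \<bar>(\<Sum>j\<le>n. c j * t ^ j) - q k t\<bar> \<le> \<delta> k) \<and> (\<forall>t\<in>{0..M}. \<bar>P' t - q' k t\<bar> \<le> \<delta> k)"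
    for k c n P'
  have "\<exists>c n P'. approx k c n P'" for k
  proof -
    obtain c n P' where
      "\<And>t. ((\<lambda>t. \<Sum>j\<le>n. c j * t ^ j) has_real_derivative P' t) (at t)"
      "\<And>t. t \<in> {0..M} \<Longrightarrow> \<bar>(\<Sum>j\<le>n. c j * t ^ j) - q k t\<bar> \<le> \<delta> k"
      "\<And>t. t \<in> {0..M} \<Longrightarrow> \<bar>P' t - q' k t\<bar> \<le> \<delta> k"
      by (rule C1_polynomial_approximation[of M "q k" "q' k" "\<delta> k"])
         (use qC1 M \<delta> continuous_on_subset[OF qC1(2) subset_UNIV] in auto)
    then have "approx k c n P'" unfolding approx_def by blast
    then show ?thesis by blast
  qed
  then obtain c n P' where "\<And>k. approx k (c k) (n k) (P' k)" by metis
  then have P: "((\<lambda>t. \<Sum>j\<le>n k. c k j * t ^ j) has_real_derivative P' k t) (at t)"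
      "t\<in>{0..M} \<Longrightarrow> \<bar>(\<Sum>j\<le>n k. c k j * t ^ j) - q k t\<bar> \<le> \<delta> k"
      "t\<in>{0..M} \<Longrightarrow> \<bar>P' k t - q' k t\<bar> \<le> \<delta> k" for k t
    unfolding approx_def by blast+
  define P where "P k t = (\<Sum>j\<le>n k. c k j * t ^ j)" for k t
  note P = P[folded P_def]
  have t: "test_function \<Omega> (\<lambda>x. radial (P k) (v x))" for k
    unfolding P_def[abs_def] by (rule test_function_radial_polynomial[OF v])
  have pd: "partial_deriv i (\<lambda>x. radial (P k) (v x)) x = radial' (P k) (P' k) (v x) (partial_deriv i v x)" for i k x
  proof -
    have "(v has_derivative frechet_derivative v (at x)) (at x)" using D(1) by (simp add: frechet_derivative_works)
    from has_derivative_compose[OF this has_derivative_radial[of "P k" "P' k"]]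
    show ?thesis using P(1) by (subst partial_deriv_eqI) (auto simp: partial_deriv_def)
  qed
  have diff: "norm (radial' (P k) (P' k) (v x) y - radial' (q k) (q' k) (v x) y) \<le> (\<delta> k + 2 * (M * \<delta> k)) * norm y" for k x y
    unfolding radial'_diff
  proof (rule norm_radial'_le)
    show "\<bar>P k ((norm (v x))\<^sup>2) - q k ((norm (v x))\<^sup>2)\<bar> \<le> \<delta> k" using P(2) M(2) by blast
    have "(norm (v x))\<^sup>2 * \<bar>P' k ((norm (v x))\<^sup>2) - q' k ((norm (v x))\<^sup>2)\<bar> \<le> M * \<delta> k"
      using P(3)[OF M(2)] M(2)[of x] by (intro mult_mono) (auto simp: M)
    then show "\<bar>(norm (v x))\<^sup>2 * (P' k ((norm (v x))\<^sup>2) - q' k ((norm (v x))\<^sup>2))\<bar> \<le> M * \<delta> k"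
      by (simp add: abs_mult)
  qed
  have q0: "q k 0 = 0" for k using cutoff_eq_0[of k 0] by (simp add: q_def)
  \<comment> \<open>By \<open>norm_radial'_le\<close> the factor is \<phi> + 2 ((flux' + \<phi>)/2 +
    16 \<phi>) = flux' + 34 \<phi>, where 16 is the k-independent bound for t cutoff'(t). The two
    hypotheses with \<open>C\<close> then give 1 + 34 = 35.\<close>
  have qb: "norm (radial' (q k) (q' k) (v x) (partial_deriv i v x)) \<le> 35 * \<bar>C\<bar>" for k x i
  proof (cases "v x = 0")
    case False
    let ?s = "norm (v x)" and ?y = "norm (partial_deriv i v x)"
    have s: "?s > 0" using False by simp
    have sp: "?s\<^sup>2 * p' (?s\<^sup>2) = (flux' ?s - \<phi> ?s) / 2"
      using s by (simp add: p'_def flux'_def power2_eq_square)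
    have pp: "p (?s\<^sup>2) = \<phi> ?s" by (simp add: p_def)
    have "norm (radial' (q k) (q' k) (v x) (partial_deriv i v x)) \<le> (\<phi> ?s + 2 * ((flux' ?s + \<phi> ?s) / 2 + 16 * \<phi> ?s)) * ?y"
    proof (rule norm_radial'_le)
      show "\<bar>q k (?s\<^sup>2)\<bar> \<le> \<phi> ?s"
        unfolding q_def pp using phi_pos[OF s] cutoff_bounds by (simp add: abs_mult mult_left_le)
      have "\<bar>?s\<^sup>2 * q' k (?s\<^sup>2)\<bar> = \<bar>?s\<^sup>2 * p' (?s\<^sup>2) * cutoff k (?s\<^sup>2) + p (?s\<^sup>2) * (?s\<^sup>2 * cutoff' k (?s\<^sup>2))\<bar>"
        by (simp add: q'_def algebra_simps)
      also have "\<dots> \<le> \<bar>?s\<^sup>2 * p' (?s\<^sup>2)\<bar> * cutoff k (?s\<^sup>2) + p (?s\<^sup>2) * \<bar>?s\<^sup>2 * cutoff' k (?s\<^sup>2)\<bar>"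
        using phi_pos[OF s] cutoff_bounds[of k "?s\<^sup>2"]
        by (intro order_trans[OF abs_triangle_ineq]) (simp add: abs_mult pp)
      also have "\<dots> \<le> (flux' ?s + \<phi> ?s) / 2 * 1 + \<phi> ?s * 16"
        unfolding sp pp using phi_pos[OF s] flux'_pos[OF s] cutoff_bounds cutoff'_bound
        by (intro add_mono mult_mono) auto
      finally show "\<bar>?s\<^sup>2 * q' k (?s\<^sup>2)\<bar> \<le> (flux' ?s + \<phi> ?s) / 2 + 16 * \<phi> ?s" by simp
    qed
    also have "\<dots> = flux' ?s * ?y + 34 * (\<phi> ?s * ?y)" by (simp add: algebra_simps)
    also have "\<dots> \<le> \<bar>C\<bar> + 34 * \<bar>C\<bar>" using C[OF False, of i] by (intro add_mono mult_left_mono) auto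
    finally show ?thesis by simp
  qed (simp add: radial'_def q0)
  show ?thesis
  proof (rule has_H10_gradient_limit[OF \<Omega> t K(1)])
    fix x i
    let ?t = "(norm (v x))\<^sup>2"
    have Pq: "(\<lambda>k. P k ?t - q k ?t) \<longlonglongrightarrow> 0"
      by (rule Lim_null_comparison[OF _ \<delta>(3)]) (use P(2)[OF M(2)] in auto)
    have qlim: "(\<lambda>k. q k ?t * y) \<longlonglongrightarrow> p ?t * y" if "v x \<noteq> 0" for y
    proof (rule tendsto_eventually)
      have "0 < ?t" using that by simp
      from eventually_cutoff_eq_1[OF this] show "\<forall>\<^sub>F k in sequentially. q k ?t * y = p ?t * y"
        by eventually_elim (simp add: q_def)
    qed
    show "(\<lambda>k. radial (P k) (v x)) \<longlonglongrightarrow> radial p (v x)"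
    proof (cases "v x = 0")
      case False
      have "(\<lambda>k. of_real ((P k ?t - q k ?t) + q k ?t * 1) * v x) \<longlonglongrightarrow> of_real (0 + p ?t * 1) * v x"
        by (intro tendsto_intros Pq qlim False)
      then show ?thesis by (simp add: radial_def)
    qed (simp add: radial_def)
    have "(\<lambda>k. radial' (P k) (P' k) (v x) (partial_deriv i v x) - radial' (q k) (q' k) (v x) (partial_deriv i v x)) \<longlonglongrightarrow> 0"
    proof (rule Lim_null_comparison)
      show "(\<lambda>k. (\<delta> k + 2 * (M * \<delta> k)) * norm (partial_deriv i v x)) \<longlonglongrightarrow> 0"
        by (rule tendsto_eq_intros \<delta>(3) refl | simp)+
    qed (use diff in auto)
    moreover have "(\<lambda>k. radial' (q k) (q' k) (v x) (partial_deriv i v x)) \<longlonglongrightarrow> (if v x = 0 then 0 else radial' p p' (v x) (partial_deriv i v x))"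
    proof (cases "v x = 0")
      case False
      then show ?thesis
        using eventually_cutoff_eq_1[of ?t]
        by (intro tendsto_eventually) (auto elim!: eventually_mono simp: q_def q'_def radial'_def)
    qed (simp add: radial'_def q0)
    ultimately have "(\<lambda>k. radial' (P k) (P' k) (v x) (partial_deriv i v x)) \<longlonglongrightarrow> (if v x = 0 then 0 else radial' p p' (v x) (partial_deriv i v x))"
      using tendsto_add by fastforce
    then show "(\<lambda>k. partial_deriv i (\<lambda>x. radial (P k) (v x)) x) \<longlonglongrightarrow>
      (\<chi> i. if v x = 0 then 0 else radial' p p' (v x) (partial_deriv i v x)) $ i" by (simp add: pd)
  next
    fix k x i
    \<comment> \<open>\<open>?C1\<close> bounds s (\<phi>(s) + 1) for s up to V: the flux is
      increasing, and V + 1 lies strictly above s. \<open>?C2\<close> adds to the bound for the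
      cut-off profile the polynomial error, with \<delta> k at most 1.\<close>
    let ?C1 = "(V + 1) * \<phi> (V + 1) + V" and ?C2 = "35 * \<bar>C\<bar> + (1 + 2 * M) * V"
    have "norm (radial (P k) (v x)) \<le> ?C1"
    proof (cases "v x = 0")
      case False
      let ?s = "norm (v x)"
      have s: "?s > 0" using False by simp
      have "\<bar>q k (?s\<^sup>2)\<bar> \<le> \<phi> ?s"
        using phi_pos[OF s] cutoff_bounds by (simp add: q_def p_def abs_mult mult_left_le)
      then have "\<bar>P k (?s\<^sup>2)\<bar> \<le> \<phi> ?s + 1" using P(2)[OF M(2)[of x], of k] \<delta>(2)[of k] by linarith
      then have "\<bar>P k (?s\<^sup>2)\<bar> * ?s \<le> (\<phi> ?s + 1) * ?s" by (intro mult_right_mono) auto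
      moreover have "?s * \<phi> ?s \<le> (V + 1) * \<phi> (V + 1)"
        using flux_strict_mono[OF s, of "V + 1"] V(1)[of x] by simp
      ultimately show ?thesis using V(1)[of x] by (simp add: radial_def norm_mult algebra_simps)
    next
      case True
      then show ?thesis using V(3) phi_pos[of "V + 1"] by (simp add: radial_def)
    qed
    then show "norm (radial (P k) (v x)) \<le> max ?C1 ?C2" by simp
    have "norm (radial' (P k) (P' k) (v x) (partial_deriv i v x))
      \<le> norm (radial' (q k) (q' k) (v x) (partial_deriv i v x)) + (\<delta> k + 2 * (M * \<delta> k)) * norm (partial_deriv i v x)"
      using diff[of k x "partial_deriv i v x"] norm_triangle_sub by (smt (verit))
    also have "\<dots> \<le> 35 * \<bar>C\<bar> + (1 + 2 * (M * 1)) * V"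
      using \<delta>(1,2)[of k] M(1) V by (intro add_mono qb mult_mono mult_left_mono) auto
    finally show "norm (partial_deriv i (\<lambda>x. radial (P k) (v x)) x) \<le> max ?C1 ?C2" by (simp add: pd)
  qed (simp add: radial_def K)
qed

end

section \<open>Necessity\<close>

context admissible_function
begin

lemma flux'_le_powr:
  obtains C r s0 where "C > 0" "r > -1" "s0 > 0" "\<And>s. 0 < s \<Longrightarrow> s < s0 \<Longrightarrow> flux' s \<le> C * s powr r"
proof -
  obtain C1 C r s0 where C: "C > 0" "r > -1" "s0 > 0" and
    "\<forall>s\<in>{0<..<s0}. C1 * s powr r \<le> deriv (\<lambda>t. t * \<phi> t) s \<and> deriv (\<lambda>t. t * \<phi> t) s \<le> C * s powr r"
    using admissible unfolding admissible_def by (elim conjE exE) (rule that, assumption+)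
  then have "flux' s \<le> C * s powr r" if "0 < s" "s < s0" for s
    using that deriv_flux by auto
  then show ?thesis using that C by blast
qed

text \<open>Integrate the bound for the derivative of the flux from 0; there is no boundary term,
  because an increasing flux onto the positive half line tends to 0 at zero.\<close>

lemma phi_le_powr:
  assumes C: "C > 0" "r > -1" and le: "\<And>s. 0 < s \<Longrightarrow> s < s0 \<Longrightarrow> flux' s \<le> C * s powr r"
    and s: "0 < s" "s < s0"
  shows "\<phi> s \<le> C / (r + 1) * s powr r"
proof -
  define G where "G t = C / (r + 1) * t powr (r + 1) - t * \<phi> t" for t
  have DG: "(G has_real_derivative C * t powr r - flux' t) (at t)" if "t > 0" for t
  proof -
    have "((\<lambda>t. C / (r + 1) * t powr (r + 1)) has_real_derivative C / (r + 1) * ((r + 1) * t powr (r + 1 - 1))) (at t)"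
      by (intro DERIV_cmult has_real_derivative_powr that)
    from DERIV_diff[OF this DERIV_flux[OF that]] show ?thesis
      unfolding G_def using C by simp
  qed
  \<comment> \<open>\<open>G\<close> is nondecreasing, and near zero it exceeds -e, since the flux
    drops below e to the left of its preimage \<open>t0\<close>.\<close>
  have "0 \<le> G s + e" if e: "e > 0" for e
  proof -
    obtain t0 where t0: "t0 > 0" "t0 * \<phi> t0 = e" using flux_surj[OF e] by blast
    define t where "t = min t0 s / 2"
    have t: "0 < t" "t < t0" "t < s" using t0 s by (auto simp: t_def)
    have "G t \<le> G s"
      by (rule DERIV_nonneg_imp_nondecreasing[of t s])
         (use t s le in \<open>auto intro!: exI[of _ "C * _ powr r - flux' _"] DG\<close>)
    moreover have "0 \<le> C / (r + 1) * t powr (r + 1)" using C by simp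
    moreover have "t * \<phi> t < e" using flux_strict_mono[of t t0] t t0 by simp
    ultimately show ?thesis unfolding G_def by linarith
  qed
  then have "0 \<le> G s" by (rule field_le_epsilon)
  then have "s * \<phi> s \<le> s * (C / (r + 1) * s powr r)"
    using s by (simp add: G_def powr_add mult_ac)
  then show ?thesis using s(1) by (rule mult_left_le_imp_le)
qed

text \<open>If \<open>\<eta>\<close> is a smooth bump and \<open>|u|\<close> is comparable to \<open>\<eta> ^ m\<close>, then \<open>|\<nabla> u|\<close> is at most of the
  order \<open>\<eta> ^ (m - 1)\<close>, so this makes \<open>\<phi>(|u|) u\<close> Lipschitz although \<open>\<phi>\<close> may blow up at zero.\<close>
definition growth_controlled :: "nat \<Rightarrow> bool" where
  "growth_controlled m \<longleftrightarrow> (\<forall>S\<ge>1. \<exists>C. \<forall>t \<eta>. 0 < \<eta> \<longrightarrow> \<eta> \<le> 1 \<longrightarrow> \<eta> ^ m / S \<le> t \<longrightarrow> t \<le> S * \<eta> ^ m \<longrightarrow>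
    \<phi> t * \<eta> ^ (m - 1) \<le> C \<and> flux' t * \<eta> ^ (m - 1) \<le> C)"

text \<open>If \<phi>(t) and (t \<phi>)' are O(t^r) and t is comparable to \<eta>^m, then
  multiplying by \<eta>^(m-1) gives the order \<eta>^(m (r + 1) - 1). Since r > -1, some m makes
  this exponent nonnegative.\<close>

lemma growth_control:
  obtains m :: nat where "m \<ge> 1" "growth_controlled m"
proof -
  obtain C r s0 where C: "C > 0" "r > -1" "s0 > 0" and le: "\<And>s. 0 < s \<Longrightarrow> s < s0 \<Longrightarrow> flux' s \<le> C * s powr r"
    using flux'_le_powr by metis
  obtain m0 :: nat where m0: "max 1 (1 / (r + 1)) \<le> real m0" using real_arch_simple by blast
  have m: "m0 \<ge> 1" "real m0 * (r + 1) \<ge> 1" using m0 C by (auto simp: field_simps)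
  show ?thesis
  proof (rule that[OF m(1)], unfold growth_controlled_def, intro allI impI)
    fix S :: real assume S: "S \<ge> 1"
    \<comment> \<open>Condition (iv) gives the power bound only below \<open>s0\<close>; compactness
      extends it to all t up to S.\<close>
    have "continuous_on {s0 / 2..S} (\<lambda>t. (\<phi> t + flux' t) / t powr r)"
      using C by (intro continuous_intros continuous_on_subset[OF continuous_phi] continuous_on_subset[OF continuous_flux']) auto
    then have "bounded ((\<lambda>t. (\<phi> t + flux' t) / t powr r) ` {s0 / 2..S})"
      by (intro compact_imp_bounded compact_continuous_image) auto
    then obtain B where "\<forall>y\<in>(\<lambda>t. (\<phi> t + flux' t) / t powr r) ` {s0 / 2..S}. norm y \<le> B"
      unfolding bounded_iff ..
    then have B: "\<bar>(\<phi> t + flux' t) / t powr r\<bar> \<le> B" if "t \<in> {s0 / 2..S}" for t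
      using that by simp
    define D where "D = max B (max C (C / (r + 1)))"
    have D: "\<phi> t \<le> D * t powr r \<and> flux' t \<le> D * t powr r" if t: "0 < t" "t \<le> S" for t
    proof (cases "t < s0")
      case True
      have "C * t powr r \<le> D * t powr r" "C / (r + 1) * t powr r \<le> D * t powr r"
        unfolding D_def by (intro mult_right_mono; simp)+
      then show ?thesis using le[OF t(1) True] phi_le_powr[OF C(1,2) le t(1) True] by force
    next
      case False
      then have "(\<phi> t + flux' t) / t powr r \<le> B" using abs_le_D1[OF B[of t]] t C by simp
      then have "\<phi> t + flux' t \<le> B * t powr r" using t by (simp add: field_simps)
      also have "\<dots> \<le> D * t powr r" unfolding D_def by (intro mult_right_mono) auto
      finally show ?thesis using phi_pos[OF t(1)] flux'_pos[OF t(1)] by linarith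
    qed
    have D0: "D \<ge> 0" unfolding D_def using C by auto
    show "\<exists>C. \<forall>t \<eta>. 0 < \<eta> \<longrightarrow> \<eta> \<le> 1 \<longrightarrow> \<eta> ^ m0 / S \<le> t \<longrightarrow> t \<le> S * \<eta> ^ m0 \<longrightarrow>
      \<phi> t * \<eta> ^ (m0 - 1) \<le> C \<and> flux' t * \<eta> ^ (m0 - 1) \<le> C"
    proof (intro exI[of _ "D * S powr \<bar>r\<bar>"] allI impI)
      fix t \<eta> :: real assume \<eta>: "0 < \<eta>" "\<eta> \<le> 1" and t: "\<eta> ^ m0 / S \<le> t" "t \<le> S * \<eta> ^ m0"
      have e: "\<eta> ^ m0 = \<eta> powr real m0" "\<eta> ^ (m0 - 1) = \<eta> powr (real m0 - 1)"
        using \<eta> m by (simp_all add: powr_realpow[symmetric] of_nat_diff)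
      have "0 < \<eta> ^ m0 / S" using \<eta> S by simp
      then have t0: "0 < t" using t by linarith
      have "S * \<eta> ^ m0 \<le> S * 1" using \<eta> S by (intro mult_left_mono power_le_one) auto
      then have tS: "t \<le> S" using t by simp
      \<comment> \<open>The sign of r decides whether the upper or the lower comparison of t with
        \<eta>^m is used; both lose the factor S^|r|.\<close>
      have "t powr r \<le> S powr \<bar>r\<bar> * \<eta> powr (real m0 * r)"
      proof (cases "r \<ge> 0")
        case True
        then have "t powr r \<le> (S * \<eta> ^ m0) powr r" using t t0 by (intro powr_mono2) auto
        also have "\<dots> = S powr \<bar>r\<bar> * \<eta> powr (real m0 * r)"
          using True S \<eta> by (simp add: powr_mult e(1) powr_powr)
        finally show ?thesis .
      next
        case False
        then have "t powr r \<le> (\<eta> ^ m0 / S) powr r" using t \<open>0 < \<eta> ^ m0 / S\<close> by (intro powr_mono2') auto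
        also have "\<dots> = \<eta> powr (real m0 * r) / S powr r"
          using S \<eta> by (simp add: powr_divide e(1) powr_powr)
        also have "\<dots> = S powr \<bar>r\<bar> * \<eta> powr (real m0 * r)"
          using False by (simp add: powr_minus divide_inverse)
        finally show ?thesis .
      qed
      then have "t powr r * \<eta> ^ (m0 - 1) \<le> S powr \<bar>r\<bar> * \<eta> powr (real m0 * r) * \<eta> ^ (m0 - 1)"
        using \<eta> by (intro mult_right_mono) auto
      also have "\<dots> = S powr \<bar>r\<bar> * \<eta> powr (real m0 * (r + 1) - 1)"
        unfolding e(2) by (simp add: mult.assoc powr_add[symmetric] algebra_simps)
      also have "\<dots> \<le> S powr \<bar>r\<bar> * 1"
        using \<eta> m by (intro mult_left_mono powr_le1) auto
      finally have "D * (t powr r * \<eta> ^ (m0 - 1)) \<le> D * S powr \<bar>r\<bar>" using D0 by (intro mult_left_mono) auto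
      moreover have "\<phi> t * \<eta> ^ (m0 - 1) \<le> (D * t powr r) * \<eta> ^ (m0 - 1)" "flux' t * \<eta> ^ (m0 - 1) \<le> (D * t powr r) * \<eta> ^ (m0 - 1)"
        using D[OF t0 tS] \<eta> by (intro mult_right_mono; simp)+
      ultimately show "\<phi> t * \<eta> ^ (m0 - 1) \<le> D * S powr \<bar>r\<bar> \<and> flux' t * \<eta> ^ (m0 - 1) \<le> D * S powr \<bar>r\<bar>"
        by (simp add: mult.assoc)
    qed
  qed
qed

lemma norm_radial'_p_le:
  assumes "z \<noteq> 0"
  shows "norm (radial' p p' z v) \<le> (2 * \<phi> (norm z) + flux' (norm z)) * norm v"
proof -
  let ?s = "norm z"
  have s: "?s > 0" using assms by simp
  have "?s\<^sup>2 * p' (?s\<^sup>2) = (flux' ?s - \<phi> ?s) / 2"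
    using s by (simp add: p'_def flux'_def power2_eq_square)
  then have "\<bar>?s\<^sup>2 * p' (?s\<^sup>2)\<bar> \<le> (flux' ?s + \<phi> ?s) / 2" "\<bar>p (?s\<^sup>2)\<bar> \<le> \<phi> ?s"
    using phi_pos[OF s] flux'_pos[OF s] by (auto simp: p_def)
  from norm_radial'_le[where P = p and P' = p' and v = v, OF this(2,1)] show ?thesis by (simp add: add_divide_distrib algebra_simps)
qed

text \<open>At a positive real point the real direction is radial and the imaginary one tangential,
  so the derivative is diagonal.\<close>

lemma radial'_p_of_real:
  assumes "t > 0"
  shows "radial' p p' (of_real t) (Complex x y) = Complex (flux' t * x) (\<phi> t * y)"
  using assms by (simp add: radial'_p flux'_def inner_complex_def complex_eq_iff algebra_simps)

lemma radial'_scale: "radial' P P' z (of_real a * v) = of_real a * radial' P P' z v"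
  by (simp add: radial'_def inner_complex_def algebra_simps)

lemma radial'_expand: "radial' P P' z v = of_real (Re v) * radial' P P' z 1 + of_real (Im v) * radial' P P' z \<i>"
  by (simp add: radial'_def inner_complex_def complex_eq_iff algebra_simps)

lemma tendsto_radial'_p:
  assumes "u \<longlonglongrightarrow> u0" "u0 \<noteq> 0"
  shows "(\<lambda>k. radial' p p' (u k) v) \<longlonglongrightarrow> radial' p p' u0 v"
proof -
  have n: "(\<lambda>k. (norm (u k))\<^sup>2) \<longlonglongrightarrow> (norm u0)\<^sup>2" by (intro tendsto_intros assms)
  have "isCont p ((norm u0)\<^sup>2)" "isCont p' ((norm u0)\<^sup>2)"
    using continuous_on_interior[OF continuous_p] continuous_on_interior[OF continuous_p'] assms(2)
    by (auto simp: interior_open)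
  then have "(\<lambda>k. p ((norm (u k))\<^sup>2)) \<longlonglongrightarrow> p ((norm u0)\<^sup>2)" "(\<lambda>k. p' ((norm (u k))\<^sup>2)) \<longlonglongrightarrow> p' ((norm u0)\<^sup>2)"
    using isCont_tendsto_compose n by blast+
  then show ?thesis unfolding radial'_def by (intro tendsto_intros assms)
qed

end

text \<open>The sequences \<open>a\<close> do not converge; they are only asymptotic to a bounded
  real oscillation \<kappa> times a constant. This lemma and the next one multiply such asymptotics,
  first by a convergent factor and then with each other.\<close>

lemma oscillating_mult:
  fixes a b :: "nat \<Rightarrow> complex"
  assumes "\<And>k. \<bar>\<kappa> k\<bar> \<le> 1" "(\<lambda>k. a k - of_real (\<kappa> k) * a0) \<longlonglongrightarrow> 0" "b \<longlonglongrightarrow> b0"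
  shows "(\<lambda>k. a k * b k - of_real (\<kappa> k) * (a0 * b0)) \<longlonglongrightarrow> 0"
proof -
  have "(\<lambda>k. (of_real (\<kappa> k) * a0) * (b k - b0)) \<longlonglongrightarrow> 0"
  proof (rule Lim_null_comparison)
    show "\<forall>\<^sub>F k in sequentially. norm ((of_real (\<kappa> k) * a0) * (b k - b0)) \<le> norm a0 * norm (b k - b0)"
      using assms(1) by (intro always_eventually) (auto simp: norm_mult intro!: mult_right_mono mult_left_le_one_le)
    have "(\<lambda>k. norm a0 * norm (b k - b0)) \<longlonglongrightarrow> norm a0 * norm (b0 - b0)" by (intro tendsto_intros assms(3))
    then show "(\<lambda>k. norm a0 * norm (b k - b0)) \<longlonglongrightarrow> 0" by simp
  qed
  from tendsto_add[OF tendsto_mult[OF assms(2,3)] this] show ?thesis by (simp add: algebra_simps)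
qed

lemma oscillating_mult2:
  fixes a b :: "nat \<Rightarrow> complex"
  assumes \<kappa>: "\<And>k. \<bar>\<kappa> k\<bar> \<le> 1" and a: "(\<lambda>k. a k - of_real (\<kappa> k) * a0) \<longlonglongrightarrow> 0"
    and b: "(\<lambda>k. b k - of_real (\<kappa> k) * b0) \<longlonglongrightarrow> 0"
  shows "(\<lambda>k. a k * b k - of_real ((\<kappa> k)\<^sup>2) * (a0 * b0)) \<longlonglongrightarrow> 0"
proof -
  have *: "(\<lambda>k. (of_real (\<kappa> k) * c) * d k) \<longlonglongrightarrow> 0" if "d \<longlonglongrightarrow> 0" for c :: complex and d
  proof (rule Lim_null_comparison)
    show "\<forall>\<^sub>F k in sequentially. norm ((of_real (\<kappa> k) * c) * d k) \<le> norm c * norm (d k)"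
      using \<kappa> by (intro always_eventually) (auto simp: norm_mult intro!: mult_right_mono mult_left_le_one_le)
    have "(\<lambda>k. norm c * norm (d k)) \<longlonglongrightarrow> norm c * norm (0::complex)" by (intro tendsto_intros that)
    then show "(\<lambda>k. norm c * norm (d k)) \<longlonglongrightarrow> 0" by simp
  qed
  from tendsto_add[OF tendsto_add[OF tendsto_mult[OF a b] *[OF a, of b0]] *[OF b, of a0]]
  show ?thesis by (simp add: algebra_simps power2_eq_square)
qed

section \<open>The oscillating test functions and the limit of their integrands\<close>

lemma cdot_matrix_vector: "cdot (A *v G) H = (\<Sum>i\<in>UNIV. \<Sum>j\<in>UNIV. A $ i $ j * (G $ j * cnj (H $ i)))"
  by (simp add: cdot_def matrix_vector_mult_def sum_distrib_right mult.assoc)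

lemma Linfinity_matrixD:
  assumes "Linfinity_matrix \<Omega> A"
  obtains L where "L \<ge> 0" "AE x in lebesgue_on \<Omega>. \<forall>i j. cmod (A x $ i $ j) \<le> L"
proof -
  have "\<forall>i j. \<exists>C. AE x in lebesgue_on \<Omega>. cmod (A x $ i $ j) \<le> C"
    using assms unfolding Linfinity_matrix_def by blast
  then obtain C where C: "\<And>i j. AE x in lebesgue_on \<Omega>. cmod (A x $ i $ j) \<le> C i j" by metis
  define L where "L = Max (insert 0 (range (\<lambda>(i, j). C i j)))"
  have L: "0 \<le> L" "C i j \<le> L" for i j
    unfolding L_def by (intro Max_ge; force)+
  have "AE x in lebesgue_on \<Omega>. \<forall>i\<in>UNIV. \<forall>j\<in>UNIV. cmod (A x $ i $ j) \<le> L"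
  proof (intro AE_finite_allI)
    show "AE x in lebesgue_on \<Omega>. cmod (A x $ i $ j) \<le> L" for i j
      using C[of i j] by eventually_elim (use L in \<open>auto intro: order_trans\<close>)
  qed auto
  then show ?thesis using that L by auto
qed

lemma cos_squared_shift: "(cos t)\<^sup>2 + (cos (t + pi / 2))\<^sup>2 = 1"
  by (simp add: cos_add)

context admissible_function
begin

text \<open>The real part of the integrand for \<open>X = \<alpha> \<xi>\<close>, \<open>Y = \<mu> \<xi>\<close> and \<open>|u| = t\<close>.\<close>
definition quad :: "(real^'n::finite \<Rightarrow> complex^'n^'n) \<Rightarrow> real^'n \<Rightarrow> real \<Rightarrow> real \<Rightarrow> real \<Rightarrow> real^'n \<Rightarrow> real" where
  "quad A \<xi> \<alpha> \<mu> t x = (flux' t * \<alpha>\<^sup>2 + \<phi> t * \<mu>\<^sup>2) * ((map_matrix Re (A x) *v \<xi>) \<bullet> \<xi>)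
     - (flux' t - \<phi> t) * \<alpha> * \<mu> * ((map_matrix Im (A x) *v \<xi>) \<bullet> \<xi>)"

text \<open>The modulus freezes at a positive real t, so the phase is 1, and \<open>e\<close>, later
  \<eta>^m, enters both slots linearly.\<close>

lemma quad_eq:
  assumes "t > 0"
  shows "Re (\<Sum>i\<in>UNIV. \<Sum>j\<in>UNIV. A x $ i $ j * (of_real (e * \<xi> $ j) * Complex \<alpha> \<mu> *
      cnj (radial' p p' (of_real t) (of_real (e * \<xi> $ i) * Complex \<alpha> \<mu>)))) = e\<^sup>2 * quad A \<xi> \<alpha> \<mu> t x"
proof -
  have "Re (cdot (A x *v (\<chi> i. Complex (((e * \<alpha>) *\<^sub>R \<xi>) $ i) (((e * \<mu>) *\<^sub>R \<xi>) $ i)))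
        (\<chi> i. Complex (flux' t * ((e * \<alpha>) *\<^sub>R \<xi>) $ i) (\<phi> t * ((e * \<mu>) *\<^sub>R \<xi>) $ i)))
    = e\<^sup>2 * quad A \<xi> \<alpha> \<mu> t x"
    by (subst Re_cdot_eq[where \<omega> = 1 and X = "(e * \<alpha>) *\<^sub>R \<xi>" and Y = "(e * \<mu>) *\<^sub>R \<xi>" and a = "flux' t" and b = "\<phi> t"])
       (simp_all add: quad_def matrix_vector_mult_scaleR power2_eq_square algebra_simps)
  moreover have "of_real (e * \<xi> $ i) * Complex \<alpha> \<mu> = Complex (((e * \<alpha>) *\<^sub>R \<xi>) $ i) (((e * \<mu>) *\<^sub>R \<xi>) $ i)" for i
    by (simp add: complex_eq_iff)
  ultimately show ?thesis
    unfolding cdot_matrix_vector by (simp add: radial'_p_of_real[OF assms])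
qed

text \<open>For a fixed bump, dissipativity is applied to both phases at every frequency. Dividing
  both gradients by the frequency scale \<open>\<nu> k\<close> preserves the sign and leaves
  integrands that are bounded uniformly in k on the support of \<eta>.\<close>

lemma oscillating_test:
  fixes A :: "real^'n::finite \<Rightarrow> complex^'n^'n"
  assumes \<Omega>: "open \<Omega>" and A: "Linfinity_matrix \<Omega> A" and diss: "LPhi_dissipative \<Omega> A \<phi>"
    and \<eta>: "bump \<eta> \<Omega>" and m: "m \<ge> 1" and s: "s > 0"
    and growth: "growth_controlled m"
  shows "0 \<le> (LINT x|lebesgue_on \<Omega>. (\<eta> x ^ m)\<^sup>2 * quad A \<xi> \<alpha> \<mu> (s * \<eta> x ^ m) x)"
proof -
  let ?M = "lebesgue_on \<Omega>"
  define e where "e x = complex_of_real (\<eta> x)" for x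
  have e: "test_function \<Omega> e" using \<eta> by (simp add: bump_def e_def[abs_def])
  note eD = test_functionD[OF e]
  have \<eta>b: "0 \<le> \<eta> x" "\<eta> x \<le> 1" for x using \<eta> by (auto simp: bump_def)
  obtain K where K: "compact K" "K \<subseteq> \<Omega>" "\<And>x. x \<notin> K \<Longrightarrow> e x = 0" "\<And>x i. x \<notin> K \<Longrightarrow> partial_deriv i e x = 0"
    using test_function_supportE[OF e] by metis
  have \<eta>0: "\<eta> x = 0" if "x \<notin> K" for x using K(3)[OF that] by (simp add: e_def)
  have "\<exists>B. \<forall>x. norm (partial_deriv i e x) \<le> B" for i
    using bounded_if_compact_support[OF eD(3) K(1,4)] by metis
  then obtain B where B: "\<And>i x. norm (partial_deriv i e x) \<le> B i" by metis
  define E where "E = Max (insert 0 (range B))"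
  have E: "0 \<le> E" "norm (partial_deriv i e x) \<le> E" for i x
  proof -
    have "0 \<le> E" "B i \<le> E" unfolding E_def by (intro Max_ge; simp)+
    then show "0 \<le> E" "norm (partial_deriv i e x) \<le> E" using B order_trans by blast+
  qed
  define c where "c = Complex \<alpha> \<mu>"
  \<comment> \<open>Starting at \<open>N\<close> makes the perturbation at most s/2, so |\<theta>|
    stays in [s/2, 2s] and u vanishes only where \<eta> does.\<close>
  obtain N :: nat where N: "max 1 (2 * norm c / s) \<le> real N" using real_arch_simple by blast
  define \<nu> where "\<nu> k = real (N + k)" for k
  have \<nu>: "1 \<le> \<nu> k" "0 < \<nu> k" "norm c / \<nu> k \<le> s / 2" "\<nu> k \<noteq> 0" for k
  proof -
    have "1 \<le> \<nu> k" "2 * norm c / s \<le> \<nu> k" using N by (auto simp: \<nu>_def)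
    then show "1 \<le> \<nu> k" "0 < \<nu> k" "norm c / \<nu> k \<le> s / 2" "\<nu> k \<noteq> 0" using s by (auto simp: field_simps)
  qed
  have \<nu>0: "(\<lambda>k. 1 / \<nu> k) \<longlonglongrightarrow> 0"
  proof -
    have "(\<lambda>k. inverse (real (k + N))) \<longlonglongrightarrow> 0" by (rule LIMSEQ_ignore_initial_segment[OF lim_inverse_n])
    then show ?thesis by (simp add: \<nu>_def add.commute divide_inverse)
  qed
  define ph where "ph k \<beta> x = ((\<nu> k)\<^sup>2 *\<^sub>R \<xi>) \<bullet> x + \<beta>" for k \<beta> x
  define \<theta> where "\<theta> k \<beta> x = of_real s + of_real (sin (ph k \<beta> x)) * (c / of_real (\<nu> k))" for k \<beta> x
  define u where "u k \<beta> x = e x ^ m * \<theta> k \<beta> x" for k \<beta> x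
  \<comment> \<open>The gradient of u divided by \<open>\<nu> k\<close>. The first summand comes
    from differentiating \<eta>^m and decays like 1 / \<open>\<nu> k\<close>; the second is the
    oscillation that survives.\<close>
  define V where "V k \<beta> i x = (of_nat m * e x ^ (m - 1) * partial_deriv i e x * \<theta> k \<beta> x) * of_real (1 / \<nu> k)
      + of_real (cos (ph k \<beta> x)) * (of_real (\<eta> x ^ m * \<xi> $ i) * c)" for k \<beta> i x
  have \<theta>s: "norm (\<theta> k \<beta> x - of_real s) \<le> norm c / \<nu> k" for k \<beta> x
    using \<nu>(2)[of k] mult_right_mono[OF abs_sin_le_one[of "ph k \<beta> x"], of "norm c / \<nu> k"]
    by (simp add: \<theta>_def norm_mult norm_divide)
  have \<theta>b: "s / 2 \<le> norm (\<theta> k \<beta> x)" "norm (\<theta> k \<beta> x) \<le> 2 * s" for k \<beta> x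
  proof -
    have "norm (\<theta> k \<beta> x - of_real s) \<le> s / 2" using \<theta>s \<nu>(3) order_trans by blast
    moreover have "norm (complex_of_real s) = s" using s by simp
    ultimately show "s / 2 \<le> norm (\<theta> k \<beta> x)" "norm (\<theta> k \<beta> x) \<le> 2 * s"
      using norm_triangle_ineq2[of "of_real s" "\<theta> k \<beta> x"] norm_triangle_ineq2[of "\<theta> k \<beta> x" "of_real s"] s
      by (auto simp: norm_minus_commute)
  qed
  have nu: "norm (u k \<beta> x) = \<eta> x ^ m * norm (\<theta> k \<beta> x)" for k \<beta> x
    using \<eta>b[of x] by (simp add: u_def e_def norm_mult norm_power)
  have u0: "u k \<beta> x = 0 \<longleftrightarrow> \<eta> x = 0" for k \<beta> x
    using \<theta>b(1)[of k \<beta> x] s m by (auto simp: u_def e_def)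
  have D\<theta>: "(\<theta> k \<beta> has_derivative (\<lambda>v. of_real (cos (ph k \<beta> x) * (((\<nu> k)\<^sup>2 *\<^sub>R \<xi>) \<bullet> v)) * (c / of_real (\<nu> k)))) (at x)" for k \<beta> x
  proof -
    have "((\<lambda>x. complex_of_real (sin (((\<nu> k)\<^sup>2 *\<^sub>R \<xi>) \<bullet> x + \<beta>))) has_derivative (\<lambda>v. of_real (cos (ph k \<beta> x) * (((\<nu> k)\<^sup>2 *\<^sub>R \<xi>) \<bullet> v)))) (at x)"
      unfolding ph_def by (rule has_derivative_ridge) (rule DERIV_sin)
    then show ?thesis
      unfolding \<theta>_def[abs_def] ph_def
      by (rule has_derivative_eq_rhs[OF has_derivative_add[OF has_derivative_const has_derivative_mult_left]]) simp
  qed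
  have tu: "test_function \<Omega> (u k \<beta>)" for k \<beta>
    unfolding u_def[abs_def]
  proof (rule test_functionI[OF _ K(1,2)])
    show "Ck j (\<lambda>x. e x ^ m * \<theta> k \<beta> x)" for j
      unfolding \<theta>_def ph_def by (intro Ck_mult Ck_power Ck_add Ck_const Ck_sin_ridge eD)
  qed (use K m in auto)
  have pdu: "partial_deriv i (u k \<beta>) x = of_real (\<nu> k) * V k \<beta> i x" for k \<beta> i x
  proof -
    have "(e has_derivative frechet_derivative e (at x)) (at x)" using eD(1) by (simp add: frechet_derivative_works)
    from partial_deriv_eqI[OF has_derivative_mult[OF has_derivative_power[OF this, of m] D\<theta>[of k \<beta>]], of i]
    have "partial_deriv i (u k \<beta>) x = e x ^ m * (of_real (cos (ph k \<beta> x) * ((\<nu> k)\<^sup>2 * \<xi> $ i)) * (c / of_real (\<nu> k)))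
        + of_nat m * partial_deriv i e x * e x ^ (m - 1) * \<theta> k \<beta> x"
      unfolding u_def[abs_def] by (simp add: partial_deriv_def inner_axis)
    also have "\<dots> = of_real (\<nu> k) * V k \<beta> i x"
      using \<nu>(4)[of k] by (simp add: V_def e_def power2_eq_square field_simps)
    finally show ?thesis .
  qed
  define D where "D = real m * E * (2 * s) + norm \<xi> * norm c"
  have D0: "D \<ge> 0" unfolding D_def using E s by simp
  have Vb: "norm (V k \<beta> i x) \<le> \<eta> x ^ (m - 1) * D" for k \<beta> i x
  proof -
    have "norm ((of_nat m * e x ^ (m - 1) * partial_deriv i e x * \<theta> k \<beta> x) * of_real (1 / \<nu> k))
      = (real m * \<eta> x ^ (m - 1) * norm (partial_deriv i e x) * norm (\<theta> k \<beta> x)) * (1 / \<nu> k)"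
      using \<eta>b[of x] \<nu>(2)[of k] by (simp add: norm_mult norm_power e_def norm_divide)
    also have "\<dots> \<le> (real m * \<eta> x ^ (m - 1) * E * (2 * s)) * 1"
      using \<eta>b[of x] E s \<theta>b[of k \<beta> x] \<nu>(1,2)[of k] by (intro mult_mono mult_nonneg_nonneg) (auto simp: field_simps)
    finally have 1: "norm ((of_nat m * e x ^ (m - 1) * partial_deriv i e x * \<theta> k \<beta> x) * of_real (1 / \<nu> k))
      \<le> \<eta> x ^ (m - 1) * (real m * E * (2 * s))" by (simp add: mult_ac)
    have "norm (of_real (cos (ph k \<beta> x)) * (of_real (\<eta> x ^ m * \<xi> $ i) * c)) = \<bar>cos (ph k \<beta> x)\<bar> * (\<eta> x ^ m * \<bar>\<xi> $ i\<bar> * norm c)"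
      using \<eta>b[of x] by (simp add: norm_mult norm_power)
    also have "\<dots> \<le> 1 * (\<eta> x ^ (m - 1) * norm \<xi> * norm c)"
      using \<eta>b[of x] component_le_norm_cart[of \<xi> i]
      by (intro mult_mono mult_nonneg_nonneg power_decreasing) auto
    finally have 2: "norm (of_real (cos (ph k \<beta> x)) * (of_real (\<eta> x ^ m * \<xi> $ i) * c)) \<le> \<eta> x ^ (m - 1) * (norm \<xi> * norm c)"
      by (simp add: mult_ac)
    show ?thesis unfolding V_def D_def distrib_left by (rule norm_triangle_mono[OF 1 2])
  qed
  \<comment> \<open>With this S the modulus |u| = \<eta>^m |\<theta>| lies between \<eta>^m / S and
    S \<eta>^m, the range of \<open>growth_controlled\<close>.\<close>
  define S where "S = max (2 * s) (max (2 / s) 1)"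
  have S: "S \<ge> 1" "2 * s \<le> S" "2 / s \<le> S" unfolding S_def by auto
  obtain G where G: "\<And>t \<eta>. 0 < \<eta> \<Longrightarrow> \<eta> \<le> 1 \<Longrightarrow> \<eta> ^ m / S \<le> t \<Longrightarrow> t \<le> S * \<eta> ^ m \<Longrightarrow>
      \<phi> t * \<eta> ^ (m - 1) \<le> G \<and> flux' t * \<eta> ^ (m - 1) \<le> G"
    using growth S(1) unfolding growth_controlled_def by blast
  have Gu: "\<phi> (norm (u k \<beta> x)) * \<eta> x ^ (m - 1) \<le> G" "flux' (norm (u k \<beta> x)) * \<eta> x ^ (m - 1) \<le> G" if "\<eta> x \<noteq> 0" for k \<beta> x
  proof -
    have \<eta>p: "0 < \<eta> x" "0 < \<eta> x ^ m" using that \<eta>b[of x] by auto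
    have "1 / S \<le> s / 2" using S s by (simp add: field_simps)
    then have "1 / S \<le> norm (\<theta> k \<beta> x)" using \<theta>b(1)[of k \<beta> x] by linarith
    then have "\<eta> x ^ m * (1 / S) \<le> norm (u k \<beta> x)" unfolding nu using \<eta>p by (intro mult_left_mono) auto
    moreover have "norm (\<theta> k \<beta> x) \<le> S" using \<theta>b(2)[of k \<beta> x] S(2) by linarith
    then have "norm (u k \<beta> x) \<le> S * \<eta> x ^ m" unfolding nu using \<eta>p by (simp add: mult.commute mult_left_mono)
    ultimately show "\<phi> (norm (u k \<beta> x)) * \<eta> x ^ (m - 1) \<le> G" "flux' (norm (u k \<beta> x)) * \<eta> x ^ (m - 1) \<le> G"
      using G[OF \<eta>p(1) \<eta>b(2)] by simp_all
  qed
  define W where "W k \<beta> i x = (if u k \<beta> x = 0 then 0 else radial' p p' (u k \<beta> x) (V k \<beta> i x))" for k \<beta> i x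
  have H10u: "has_H10_gradient \<Omega> (u k \<beta>) (grad (u k \<beta>))" for k \<beta>
    by (rule has_H10_gradient_test_function[OF \<Omega> tu])
  have H10w: "has_H10_gradient \<Omega> (\<lambda>x. radial p (u k \<beta> x)) (\<lambda>x. \<chi> i. of_real (\<nu> k) * W k \<beta> i x)" for k \<beta>
  proof -
    have "has_H10_gradient \<Omega> (\<lambda>x. radial p (u k \<beta> x))
      (\<lambda>x. \<chi> i. if u k \<beta> x = 0 then 0 else radial' p p' (u k \<beta> x) (partial_deriv i (u k \<beta>) x))"
    proof (rule has_H10_gradient_radial_p[OF \<Omega> tu, where C = "G * (D * \<nu> k)"])
      fix x i assume nz: "u k \<beta> x \<noteq> 0"
      then have pos: "norm (u k \<beta> x) > 0" and \<eta>nz: "\<eta> x \<noteq> 0" using u0 by auto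
      have pb: "norm (partial_deriv i (u k \<beta>) x) \<le> \<eta> x ^ (m - 1) * (D * \<nu> k)"
        unfolding pdu using mult_left_mono[OF Vb[of k \<beta> i x], of "\<nu> k"] \<nu>(2)[of k] by (simp add: norm_mult mult_ac)
      have "\<phi> (norm (u k \<beta> x)) * norm (partial_deriv i (u k \<beta>) x) \<le> (\<phi> (norm (u k \<beta> x)) * \<eta> x ^ (m - 1)) * (D * \<nu> k)"
        using mult_left_mono[OF pb, of "\<phi> (norm (u k \<beta> x))"] phi_pos[OF pos] by (simp add: mult.assoc)
      also have "\<dots> \<le> G * (D * \<nu> k)" using Gu(1)[OF \<eta>nz, of k \<beta>] D0 \<nu>(2)[of k] by (intro mult_right_mono) auto
      finally show "\<phi> (norm (u k \<beta> x)) * norm (partial_deriv i (u k \<beta>) x) \<le> G * (D * \<nu> k)" .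
      have "flux' (norm (u k \<beta> x)) * norm (partial_deriv i (u k \<beta>) x) \<le> (flux' (norm (u k \<beta> x)) * \<eta> x ^ (m - 1)) * (D * \<nu> k)"
        using mult_left_mono[OF pb, of "flux' (norm (u k \<beta> x))"] flux'_pos[OF pos] by (simp add: mult.assoc)
      also have "\<dots> \<le> G * (D * \<nu> k)" using Gu(2)[OF \<eta>nz, of k \<beta>] D0 \<nu>(2)[of k] by (intro mult_right_mono) auto
      finally show "flux' (norm (u k \<beta> x)) * norm (partial_deriv i (u k \<beta>) x) \<le> G * (D * \<nu> k)" .
    qed
    moreover have "(\<lambda>x. \<chi> i. if u k \<beta> x = 0 then 0 else radial' p p' (u k \<beta> x) (partial_deriv i (u k \<beta>) x))
      = (\<lambda>x. \<chi> i. of_real (\<nu> k) * W k \<beta> i x)"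
      by (auto simp: fun_eq_iff vec_eq_iff W_def pdu radial'_scale)
    ultimately show ?thesis by simp
  qed
  have Wb: "norm (W k \<beta> i x) \<le> 3 * G * D" for k \<beta> i x
  proof (cases "u k \<beta> x = 0")
    case True
    have "G \<ge> 0"
      using G[of 1 1] S(1) phi_pos[of 1] by (simp add: field_simps)
    then show ?thesis using True D0 by (simp add: W_def)
  next
    case False
    then have \<eta>nz: "\<eta> x \<noteq> 0" and pos: "norm (u k \<beta> x) > 0" using u0 by auto
    have "norm (W k \<beta> i x) \<le> (2 * \<phi> (norm (u k \<beta> x)) + flux' (norm (u k \<beta> x))) * norm (V k \<beta> i x)"
      using False norm_radial'_p_le by (simp add: W_def)
    also have "\<dots> \<le> (2 * \<phi> (norm (u k \<beta> x)) + flux' (norm (u k \<beta> x))) * (\<eta> x ^ (m - 1) * D)"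
      using phi_pos[OF pos] flux'_pos[OF pos] by (intro mult_left_mono Vb) auto
    also have "\<dots> = (2 * (\<phi> (norm (u k \<beta> x)) * \<eta> x ^ (m - 1)) + flux' (norm (u k \<beta> x)) * \<eta> x ^ (m - 1)) * D"
      by (simp add: algebra_simps)
    also have "\<dots> \<le> (2 * G + G) * D" using Gu[OF \<eta>nz, of k \<beta>] D0 by (intro mult_right_mono add_mono mult_left_mono) auto
    finally show ?thesis by simp
  qed
  have Vb': "norm (V k \<beta> i x) \<le> D" for k \<beta> i x
  proof -
    have "\<eta> x ^ (m - 1) * D \<le> 1 * D" using \<eta>b[of x] D0 by (intro mult_right_mono power_le_one)
    then show ?thesis using Vb[of k \<beta> i x] by linarith
  qed
  have W0: "W k \<beta> i x = 0" if "x \<notin> K" for k \<beta> i x using \<eta>0[OF that] u0 by (simp add: W_def)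
  obtain L where L: "L \<ge> 0" "AE x in ?M. \<forall>i j. cmod (A x $ i $ j) \<le> L"
    by (rule Linfinity_matrixD[OF A])
  define F where "F k \<beta> x = (\<Sum>i\<in>UNIV. \<Sum>j\<in>UNIV. A x $ i $ j * (V k \<beta> j x * cnj (W k \<beta> i x)))" for k \<beta> x
  define bd where "bd = of_nat (CARD('n)) * (of_nat (CARD('n)) * (L * (D * (3 * G * D))))"
  have Fb: "AE x in ?M. norm (F k \<beta> x) \<le> indicator K x * bd" for k \<beta>
    using L(2)
  proof eventually_elim
    case (elim x)
    show ?case
    proof (cases "x \<in> K")
      case True
      have "norm (A x $ i $ j * (V k \<beta> j x * cnj (W k \<beta> i x))) \<le> L * (D * (3 * G * D))" for i j
        unfolding norm_mult complex_mod_cnj using elim L D0 Vb' Wb by (intro mult_mono) auto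
      then have "norm (F k \<beta> x) \<le> bd"
        unfolding F_def bd_def by (intro order_trans[OF norm_sum] sum_bounded_above order_trans[OF norm_sum])
      then show ?thesis using True by simp
    qed (simp add: F_def W0)
  qed
  have Fm: "F k \<beta> \<in> borel_measurable ?M" for k \<beta>
  proof -
    have "(\<lambda>x. partial_deriv i (u k \<beta>) x / of_real (\<nu> k)) \<in> borel_measurable ?M" for i
      using test_functionD(3)[OF tu] \<nu>(4)[of k]
      by (intro borel_measurable_continuous_lebesgue_on continuous_intros) auto
    then have Vm: "V k \<beta> i \<in> borel_measurable ?M" for i using \<nu>(4)[of k] by (simp add: pdu)
    have "(\<lambda>x. (\<chi> i. of_real (\<nu> k) * W k \<beta> i x) $ i / of_real (\<nu> k)) \<in> borel_measurable ?M" for i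
      using has_H10_gradientD(3)[OF H10w[of k \<beta>], of i] unfolding square_integrable_def
      by (intro borel_measurable_divide borel_measurable_const) blast
    then have Wm: "W k \<beta> i \<in> borel_measurable ?M" for i using \<nu>(4)[of k] by simp
    have "(\<lambda>x. cnj (W k \<beta> i x)) \<in> borel_measurable ?M" for i
      by (rule measurable_compose[OF Wm]) (intro borel_measurable_continuous_onI continuous_intros)
    then show ?thesis
      unfolding F_def[abs_def] using A Vm unfolding Linfinity_matrix_def
      by (intro borel_measurable_sum borel_measurable_times) auto
  qed
  have Fi: "integrable ?M (F k \<beta>)" for k \<beta>
    by (rule integrable_bounded_support[OF \<Omega> Fm K(1) Fb])
  have Fnn: "0 \<le> (LINT x|?M. Re (F k \<beta> x))" for k \<beta>
  proof -
    have "0 \<le> Re (LINT x|?M. cdot (A x *v grad (u k \<beta>) x) (\<chi> i. of_real (\<nu> k) * W k \<beta> i x))"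
      using diss H10u H10w unfolding LPhi_dissipative_def radial_p[symmetric] by blast
    also have "(\<lambda>x. cdot (A x *v grad (u k \<beta>) x) (\<chi> i. of_real (\<nu> k) * W k \<beta> i x)) = (\<lambda>x. of_real ((\<nu> k)\<^sup>2) * F k \<beta> x)"
      by (simp add: cdot_matrix_vector F_def grad_def pdu sum_distrib_left power2_eq_square mult_ac)
    finally have "0 \<le> (\<nu> k)\<^sup>2 * Re (LINT x|?M. F k \<beta> x)" by simp
    then have "0 \<le> Re (LINT x|?M. F k \<beta> x)" using \<nu>(2)[of k] by (simp add: zero_le_mult_iff)
    then show ?thesis using Fi by simp
  qed
  \<comment> \<open>The factors cos^2 prevent a single phase from having a pointwise limit in
    general; only the sum of the two phases has one.\<close>
  have Flim: "(\<lambda>k. Re (F k 0 x + F k (pi / 2) x)) \<longlonglongrightarrow> (\<eta> x ^ m)\<^sup>2 * quad A \<xi> \<alpha> \<mu> (s * \<eta> x ^ m) x" for x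
  proof (cases "\<eta> x = 0")
    case True
    then have em: "\<eta> x ^ m = 0" using m by simp
    show ?thesis unfolding em using True u0 by (simp add: F_def W_def)
  next
    case False
    then have \<eta>p: "\<eta> x > 0" using \<eta>b[of x] by simp
    define t where "t = s * \<eta> x ^ m"
    have t: "t > 0" unfolding t_def using s \<eta>p by simp
    define w where "w i = complex_of_real (\<eta> x ^ m * \<xi> $ i) * c" for i
    have \<theta>lim: "(\<lambda>k. \<theta> k \<beta> x) \<longlonglongrightarrow> of_real s" for \<beta>
    proof (rule LIM_zero_cancel, rule Lim_null_comparison)
      show "\<forall>\<^sub>F k in sequentially. norm (\<theta> k \<beta> x - of_real s) \<le> norm c * (1 / \<nu> k)"
        using \<theta>s by simp
      show "(\<lambda>k. norm c * (1 / \<nu> k)) \<longlonglongrightarrow> 0" using tendsto_mult_right_zero[OF \<nu>0] .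
    qed
    have ulim: "(\<lambda>k. u k \<beta> x) \<longlonglongrightarrow> of_real t" for \<beta>
    proof -
      have "(\<lambda>k. u k \<beta> x) \<longlonglongrightarrow> e x ^ m * of_real s" unfolding u_def by (intro tendsto_intros \<theta>lim)
      then show ?thesis by (simp add: t_def e_def mult.commute)
    qed
    have Vlim: "(\<lambda>k. V k \<beta> i x - of_real (cos (ph k \<beta> x)) * w i) \<longlonglongrightarrow> 0" for \<beta> i
    proof -
      have "(\<lambda>k. (of_nat m * e x ^ (m - 1) * partial_deriv i e x * \<theta> k \<beta> x) * of_real (1 / \<nu> k))
          \<longlonglongrightarrow> (of_nat m * e x ^ (m - 1) * partial_deriv i e x * of_real s) * of_real 0"
        by (intro tendsto_intros \<theta>lim \<nu>0)
      then show ?thesis by (simp add: V_def w_def)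
    qed
    have nz: "complex_of_real t \<noteq> 0" using t by simp
    have Wlim: "(\<lambda>k. W k \<beta> i x - of_real (cos (ph k \<beta> x)) * radial' p p' (of_real t) (w i)) \<longlonglongrightarrow> 0" for \<beta> i
    proof -
      \<comment> \<open>\<open>tendsto_radial'_p\<close> moves the base point for a fixed direction
        only. Expanding in the directions 1 and i puts the oscillation of \<open>V\<close> into real
        coefficients, to which \<open>oscillating_mult\<close> applies.\<close>
      have 1: "(\<lambda>k. of_real (Re (V k \<beta> i x)) - of_real (cos (ph k \<beta> x)) * complex_of_real (Re (w i))) \<longlonglongrightarrow> 0"
        using tendsto_of_real[OF tendsto_Re[OF Vlim[of \<beta> i]]] by simp
      have 2: "(\<lambda>k. of_real (Im (V k \<beta> i x)) - of_real (cos (ph k \<beta> x)) * complex_of_real (Im (w i))) \<longlonglongrightarrow> 0"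
        using tendsto_of_real[OF tendsto_Im[OF Vlim[of \<beta> i]]] by simp
      note tendsto_add[OF oscillating_mult[OF _ 1 tendsto_radial'_p[OF ulim nz, of _ 1]]
          oscillating_mult[OF _ 2 tendsto_radial'_p[OF ulim nz, of _ \<i>]]]
      then have "(\<lambda>k. radial' p p' (u k \<beta> x) (V k \<beta> i x) - of_real (cos (ph k \<beta> x)) * radial' p p' (of_real t) (w i)) \<longlonglongrightarrow> 0"
        by (subst (1 2) radial'_expand) (simp add: algebra_simps)
      then show ?thesis using False u0 by (simp add: W_def)
    qed
    have prod: "(\<lambda>k. V k \<beta> j x * cnj (W k \<beta> i x) - of_real ((cos (ph k \<beta> x))\<^sup>2) * (w j * cnj (radial' p p' (of_real t) (w i)))) \<longlonglongrightarrow> 0" for \<beta> i j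
    proof (rule oscillating_mult2[OF _ Vlim])
      show "(\<lambda>k. cnj (W k \<beta> i x) - of_real (cos (ph k \<beta> x)) * cnj (radial' p p' (of_real t) (w i))) \<longlonglongrightarrow> 0"
        using tendsto_cnj[OF Wlim[of \<beta> i]] by simp
    qed simp
    have "(\<lambda>k. V k 0 j x * cnj (W k 0 i x) + V k (pi / 2) j x * cnj (W k (pi / 2) i x)) \<longlonglongrightarrow> w j * cnj (radial' p p' (of_real t) (w i))" for i j
    proof -
      define z where "z = w j * cnj (radial' p p' (of_real t) (w i))"
      have "(cos (ph k 0 x))\<^sup>2 + (cos (ph k (pi / 2) x))\<^sup>2 = 1" for k
        unfolding ph_def using cos_squared_shift by simp
      then have "of_real ((cos (ph k 0 x))\<^sup>2) * z + of_real ((cos (ph k (pi / 2) x))\<^sup>2) * z = z" for k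
        by (metis distrib_right mult_1 of_real_1 of_real_add)
      then have "V k 0 j x * cnj (W k 0 i x) + V k (pi / 2) j x * cnj (W k (pi / 2) i x) - z =
         (V k 0 j x * cnj (W k 0 i x) - of_real ((cos (ph k 0 x))\<^sup>2) * z)
         + (V k (pi / 2) j x * cnj (W k (pi / 2) i x) - of_real ((cos (ph k (pi / 2) x))\<^sup>2) * z)" (is "?a k = ?b k + ?c k") for k
        by (simp add: algebra_simps)
      moreover have "(\<lambda>k. ?b k + ?c k) \<longlonglongrightarrow> 0 + 0"
        unfolding z_def by (intro tendsto_add prod)
      ultimately have "(\<lambda>k. V k 0 j x * cnj (W k 0 i x) + V k (pi / 2) j x * cnj (W k (pi / 2) i x) - z) \<longlonglongrightarrow> 0"
        by (simp only: add_0_left)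
      then show ?thesis unfolding z_def by (rule LIM_zero_cancel)
    qed
    then have "(\<lambda>k. Re (\<Sum>i\<in>UNIV. \<Sum>j\<in>UNIV. A x $ i $ j * (V k 0 j x * cnj (W k 0 i x) + V k (pi / 2) j x * cnj (W k (pi / 2) i x))))
      \<longlonglongrightarrow> Re (\<Sum>i\<in>UNIV. \<Sum>j\<in>UNIV. A x $ i $ j * (w j * cnj (radial' p p' (of_real t) (w i))))"
      by (intro tendsto_Re tendsto_sum tendsto_mult tendsto_const)
    moreover have "Re (\<Sum>i\<in>UNIV. \<Sum>j\<in>UNIV. A x $ i $ j * (w j * cnj (radial' p p' (of_real t) (w i)))) = (\<eta> x ^ m)\<^sup>2 * quad A \<xi> \<alpha> \<mu> t x"
      unfolding w_def c_def by (rule quad_eq[OF t])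
    ultimately show ?thesis
      unfolding F_def t_def by (simp add: distrib_left sum.distrib)
  qed
  have "(\<lambda>k. LINT x|?M. Re (F k 0 x + F k (pi / 2) x)) \<longlonglongrightarrow> (LINT x|?M. (\<eta> x ^ m)\<^sup>2 * quad A \<xi> \<alpha> \<mu> (s * \<eta> x ^ m) x)"
  proof (rule integral_dominated_convergence[where w = "\<lambda>x. indicator K x * (2 * bd)"])
    have sm: "(\<lambda>x. Re (F k 0 x + F k (pi / 2) x)) \<in> borel_measurable ?M" for k
      by (rule measurable_compose[OF borel_measurable_add[OF Fm Fm] borel_measurable_Re])
    then show "(\<lambda>x. Re (F k 0 x + F k (pi / 2) x)) \<in> borel_measurable ?M" for k .
    show "(\<lambda>x. (\<eta> x ^ m)\<^sup>2 * quad A \<xi> \<alpha> \<mu> (s * \<eta> x ^ m) x) \<in> borel_measurable ?M"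
      by (rule borel_measurable_LIMSEQ_metric[OF sm]) (rule Flim)
    show "AE x in ?M. norm (Re (F k 0 x + F k (pi / 2) x)) \<le> indicator K x * (2 * bd)" for k
      using Fb[of k 0] Fb[of k "pi / 2"]
    proof eventually_elim
      case (elim x)
      have "norm (Re (F k 0 x + F k (pi / 2) x)) \<le> norm (F k 0 x + F k (pi / 2) x)"
        unfolding real_norm_def by (rule abs_Re_le_cmod)
      also have "\<dots> \<le> norm (F k 0 x) + norm (F k (pi / 2) x)" by (rule norm_triangle_ineq)
      finally show ?case using elim by linarith
    qed
    show "integrable ?M (\<lambda>x. indicator K x * (2 * bd))"
    proof (rule integrable_bounded_support[OF \<Omega> _ K(1), of _ "\<bar>2 * bd\<bar>"])
      have "K \<in> sets lebesgue" using K(1) by (simp add: lmeasurable_compact fmeasurableD)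
      then show "(\<lambda>x. indicator K x * (2 * bd)) \<in> borel_measurable ?M"
        by (intro measurable_restrict_space1 borel_measurable_times borel_measurable_indicator borel_measurable_const)
    qed (auto simp: indicator_def)
  qed (use Flim in simp)
  then show ?thesis
  proof (rule LIMSEQ_le_const)
    have "(LINT x|?M. Re (F k 0 x + F k (pi / 2) x)) = (LINT x|?M. Re (F k 0 x)) + (LINT x|?M. Re (F k (pi / 2) x))" for k
      using Fi by simp
    then show "\<exists>N. \<forall>k\<ge>N. 0 \<le> (LINT x|?M. Re (F k 0 x + F k (pi / 2) x))"
      using Fnn by (simp add: add_nonneg_nonneg)
  qed
qed

end

section \<open>Localization of the limiting quadratic form\<close>

lemma form_sum: "((M :: real^'n^'n::finite) *v \<xi>) \<bullet> \<xi> = (\<Sum>i\<in>UNIV. \<Sum>j\<in>UNIV. M $ i $ j * \<xi> $ j * \<xi> $ i)"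
  by (simp add: matrix_vector_mult_def inner_vec_def sum_distrib_right)

lemma abs_form_le:
  fixes M :: "real^'n^'n::finite"
  assumes "\<And>i j. \<bar>M $ i $ j\<bar> \<le> L"
  shows "\<bar>(M *v \<xi>) \<bullet> \<xi>\<bar> \<le> of_nat (CARD('n)) * (of_nat (CARD('n)) * (L * norm \<xi> * norm \<xi>))"
proof -
  have L: "L \<ge> 0" using assms[of undefined undefined] by linarith
  have "\<bar>M $ i $ j * \<xi> $ j * \<xi> $ i\<bar> \<le> L * norm \<xi> * norm \<xi>" for i j
    unfolding abs_mult using L by (intro mult_mono mult_nonneg_nonneg assms component_le_norm_cart) auto
  then show ?thesis
    unfolding form_sum by (intro order_trans[OF sum_abs] sum_bounded_above order_trans[OF sum_abs]) auto
qed

lemma form_measurable: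
  assumes "\<And>i j. (\<lambda>x. A x $ i $ j) \<in> borel_measurable M" "f \<in> borel_measurable borel"
  shows "(\<lambda>x. (map_matrix f (A x :: complex^'n^'n::finite) *v \<xi>) \<bullet> (\<xi> :: real^'n)) \<in> borel_measurable M"
  unfolding form_sum
  by (intro borel_measurable_sum borel_measurable_times borel_measurable_const)
     (simp add: map_matrix_def measurable_compose[OF assms])

context admissible_function
begin

lemma abs_quad_le:
  assumes "t > 0" "\<bar>(map_matrix Re (A x) *v \<xi>) \<bullet> \<xi>\<bar> \<le> L" "\<bar>(map_matrix Im (A x) *v \<xi>) \<bullet> \<xi>\<bar> \<le> L"
  shows "\<bar>quad A \<xi> \<alpha> \<mu> t x\<bar> \<le> (flux' t + \<phi> t) * ((\<alpha>\<^sup>2 + \<mu>\<^sup>2 + \<bar>\<alpha> * \<mu>\<bar>) * L)"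
proof -
  have pos: "flux' t > 0" "\<phi> t > 0" using assms flux'_pos phi_pos by auto
  have L: "L \<ge> 0" using assms(2) by linarith
  have 1: "\<bar>(flux' t * \<alpha>\<^sup>2 + \<phi> t * \<mu>\<^sup>2) * ((map_matrix Re (A x) *v \<xi>) \<bullet> \<xi>)\<bar>
      \<le> ((flux' t + \<phi> t) * (\<alpha>\<^sup>2 + \<mu>\<^sup>2)) * L"
  proof -
    have "\<bar>flux' t * \<alpha>\<^sup>2 + \<phi> t * \<mu>\<^sup>2\<bar> \<le> (flux' t + \<phi> t) * (\<alpha>\<^sup>2 + \<mu>\<^sup>2)"
      using pos by (simp add: algebra_simps)
    then show ?thesis unfolding abs_mult[of "flux' t * \<alpha>\<^sup>2 + \<phi> t * \<mu>\<^sup>2"] using assms(2) pos by (intro mult_mono) auto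
  qed
  have 2: "\<bar>(flux' t - \<phi> t) * \<alpha> * \<mu> * ((map_matrix Im (A x) *v \<xi>) \<bullet> \<xi>)\<bar> \<le> ((flux' t + \<phi> t) * \<bar>\<alpha> * \<mu>\<bar>) * L"
  proof -
    have "\<bar>flux' t - \<phi> t\<bar> * \<bar>\<alpha> * \<mu>\<bar> \<le> (flux' t + \<phi> t) * \<bar>\<alpha> * \<mu>\<bar>"
      using pos by (intro mult_right_mono) auto
    then have "(\<bar>flux' t - \<phi> t\<bar> * \<bar>\<alpha> * \<mu>\<bar>) * \<bar>(map_matrix Im (A x) *v \<xi>) \<bullet> \<xi>\<bar> \<le> ((flux' t + \<phi> t) * \<bar>\<alpha> * \<mu>\<bar>) * L"
      using assms(3) pos by (intro mult_mono) auto
    then show ?thesis by (simp add: abs_mult mult.assoc)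
  qed
  have "\<bar>quad A \<xi> \<alpha> \<mu> t x\<bar> \<le> ((flux' t + \<phi> t) * (\<alpha>\<^sup>2 + \<mu>\<^sup>2)) * L + ((flux' t + \<phi> t) * \<bar>\<alpha> * \<mu>\<bar>) * L"
    unfolding quad_def using 1 2 by linarith
  then show ?thesis by (simp add: algebra_simps)
qed

lemma quad_measurable:
  assumes "Linfinity_matrix \<Omega> A"
  shows "(\<lambda>x. quad A \<xi> \<alpha> \<mu> t x) \<in> borel_measurable (lebesgue_on \<Omega>)"
  unfolding quad_def
  by (intro borel_measurable_diff borel_measurable_times borel_measurable_const form_measurable
      borel_measurable_Re borel_measurable_Im)
     (use assms in \<open>simp_all add: Linfinity_matrix_def\<close>)

lemma form_bounded:
  fixes A :: "real^'n::finite \<Rightarrow> complex^'n^'n"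
  assumes "Linfinity_matrix \<Omega> A"
  obtains L where "L \<ge> 0" "AE x in lebesgue_on \<Omega>. \<bar>(map_matrix Re (A x) *v \<xi>) \<bullet> \<xi>\<bar> \<le> L \<and> \<bar>(map_matrix Im (A x) *v \<xi>) \<bullet> \<xi>\<bar> \<le> L"
proof -
  obtain L where L: "L \<ge> 0" "AE x in lebesgue_on \<Omega>. \<forall>i j. cmod (A x $ i $ j) \<le> L"
    by (rule Linfinity_matrixD[OF assms])
  let ?B = "of_nat (CARD('n)) * (of_nat (CARD('n)) * (L * norm \<xi> * norm \<xi>))"
  have "AE x in lebesgue_on \<Omega>. \<bar>(map_matrix Re (A x) *v \<xi>) \<bullet> \<xi>\<bar> \<le> ?B \<and> \<bar>(map_matrix Im (A x) *v \<xi>) \<bullet> \<xi>\<bar> \<le> ?B"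
    using L(2)
  proof eventually_elim
    case (elim x)
    have "\<bar>map_matrix Re (A x) $ i $ j\<bar> \<le> L" "\<bar>map_matrix Im (A x) $ i $ j\<bar> \<le> L" for i j
      using elim abs_Re_le_cmod[of "A x $ i $ j"] abs_Im_le_cmod[of "A x $ i $ j"]
      by (auto simp: map_matrix_def intro: order_trans)
    then show ?case using abs_form_le by blast
  qed
  moreover have "0 \<le> ?B" using L by simp
  ultimately show ?thesis using that by blast
qed

lemma quad_integral_nonneg:
  fixes A :: "real^'n::finite \<Rightarrow> complex^'n^'n"
  assumes \<Omega>: "open \<Omega>" and A: "Linfinity_matrix \<Omega> A" and diss: "LPhi_dissipative \<Omega> A \<phi>"
    and s: "s > 0" and U: "open U" "bounded U" "U \<subseteq> \<Omega>"
  shows "0 \<le> (LINT x|lebesgue_on \<Omega>. indicator U x * quad A \<xi> \<alpha> \<mu> s x)"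
proof -
  let ?M = "lebesgue_on \<Omega>"
  obtain m where m: "m \<ge> 1" and growth: "growth_controlled m" by (rule growth_control)
  obtain \<eta> where \<eta>: "\<And>k. bump (\<eta> k) U" "\<And>x. (\<lambda>k. \<eta> k x) \<longlonglongrightarrow> indicator U x"
    using bumps_to_indicator[OF U(1)] by metis
  have \<eta>\<Omega>: "bump (\<eta> k) \<Omega>" for k using \<eta>(1)[of k] U(3) by (auto simp: bump_def test_function_def)
  have \<eta>b: "0 \<le> \<eta> k x" "\<eta> k x \<le> 1" for k x using \<eta>(1)[of k] by (auto simp: bump_def)
  have \<eta>0: "\<eta> k x = 0" if "x \<notin> U" for k x
  proof -
    have "test_function U (\<lambda>x. complex_of_real (\<eta> k x))" using \<eta>(1)[of k] by (simp add: bump_def)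
    from test_function_supportE[OF this] show ?thesis using that by (metis of_real_eq_0_iff subsetD)
  qed
  let ?f = "\<lambda>k x. (\<eta> k x ^ m)\<^sup>2 * quad A \<xi> \<alpha> \<mu> (s * \<eta> k x ^ m) x"
  have nn: "0 \<le> (LINT x|?M. ?f k x)" for k
    by (rule oscillating_test[OF \<Omega> A diss \<eta>\<Omega> m s growth])
  obtain L where L: "L \<ge> 0" "AE x in ?M. \<bar>(map_matrix Re (A x) *v \<xi>) \<bullet> \<xi>\<bar> \<le> L \<and> \<bar>(map_matrix Im (A x) *v \<xi>) \<bullet> \<xi>\<bar> \<le> L"
    by (rule form_bounded[OF A])
  \<comment> \<open>Chosen so that s \<eta>^m lies between \<eta>^m / S and S \<eta>^m.\<close>
  define S where "S = max s (max (1 / s) 1)"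
  have S: "S \<ge> 1" "s \<le> S" "1 / S \<le> s"
  proof -
    show "S \<ge> 1" "s \<le> S" unfolding S_def by auto
    have "1 / s \<le> S" unfolding S_def by auto
    then show "1 / S \<le> s" using s \<open>S \<ge> 1\<close> by (simp add: field_simps)
  qed
  obtain G where G: "\<And>t \<eta>. 0 < \<eta> \<Longrightarrow> \<eta> \<le> 1 \<Longrightarrow> \<eta> ^ m / S \<le> t \<Longrightarrow> t \<le> S * \<eta> ^ m \<Longrightarrow>
      \<phi> t * \<eta> ^ (m - 1) \<le> G \<and> flux' t * \<eta> ^ (m - 1) \<le> G"
    using growth S(1) unfolding growth_controlled_def by blast
  define bd where "bd = (G + G) * ((\<alpha>\<^sup>2 + \<mu>\<^sup>2 + \<bar>\<alpha> * \<mu>\<bar>) * L)"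
  have "(\<lambda>k. LINT x|?M. ?f k x) \<longlonglongrightarrow> (LINT x|?M. indicator U x * quad A \<xi> \<alpha> \<mu> s x)"
  proof (rule integral_dominated_convergence[where w = "\<lambda>x. indicator (closure U) x * bd"])
    show "(\<lambda>x. indicator U x * quad A \<xi> \<alpha> \<mu> s x) \<in> borel_measurable ?M"
      using U(1) by (intro borel_measurable_times quad_measurable[OF A] measurable_restrict_space1 borel_measurable_indicator) auto
    show "?f k \<in> borel_measurable ?M" for k
    proof -
      have \<eta>m: "\<eta> k \<in> borel_measurable ?M"
        by (rule borel_measurable_continuous_lebesgue_on[OF bump_continuous[OF \<eta>(1)]])
      \<comment> \<open>\<phi> and \<open>flux'\<close> are continuous only on the positive half
        line, so the compositions are masked by the set where \<eta> is nonzero; elsewhere the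
        weight (\<eta>^m)^2 vanishes.\<close>
      define V where "V = {x \<in> space ?M. \<eta> k x \<noteq> 0}"
      have V: "V \<in> sets ?M" unfolding V_def
        using measurable_sets[OF \<eta>m, of "- {0}"] by (simp add: vimage_def Int_def conj_commute)
      have cm: "(\<lambda>x. if x \<in> V then f (s * \<eta> k x ^ m) else 0) \<in> borel_measurable ?M"
        if f: "continuous_on {0<..} f" for f :: "real \<Rightarrow> real"
      proof -
        have "(\<lambda>y. if y \<in> {0<..} then f y else 0) \<in> borel_measurable borel"
          using f by (intro borel_measurable_continuous_on_if) auto
        then have "(\<lambda>x. if s * \<eta> k x ^ m \<in> {0<..} then f (s * \<eta> k x ^ m) else 0) \<in> borel_measurable ?M"
          by (rule measurable_compose[rotated]) (intro borel_measurable_times borel_measurable_const borel_measurable_power \<eta>m)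
        moreover have "x \<in> V \<longleftrightarrow> s * \<eta> k x ^ m \<in> {0<..}" if "x \<in> space ?M" for x
          using that s \<eta>b[of k x] m by (auto simp: V_def zero_less_mult_iff zero_less_power_eq le_less)
        ultimately show ?thesis by (subst measurable_cong[where g = "\<lambda>x. if s * \<eta> k x ^ m \<in> {0<..} then f (s * \<eta> k x ^ m) else 0"]) auto
      qed
      define fl where "fl x = (if x \<in> V then flux' (s * \<eta> k x ^ m) else 0)" for x
      define ph where "ph x = (if x \<in> V then \<phi> (s * \<eta> k x ^ m) else 0)" for x
      let ?g = "\<lambda>x. (\<eta> k x ^ m)\<^sup>2 * ((fl x * \<alpha>\<^sup>2 + ph x * \<mu>\<^sup>2) * ((map_matrix Re (A x) *v \<xi>) \<bullet> \<xi>)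
          - (fl x - ph x) * \<alpha> * \<mu> * ((map_matrix Im (A x) *v \<xi>) \<bullet> \<xi>))"
      have g: "?g \<in> borel_measurable ?M"
        using A unfolding Linfinity_matrix_def fl_def ph_def
        by (intro borel_measurable_times borel_measurable_power borel_measurable_add borel_measurable_diff \<eta>m
            borel_measurable_const form_measurable cm continuous_phi continuous_flux' borel_measurable_Re borel_measurable_Im) auto
      have eq: "?f k x = ?g x" if "x \<in> space ?M" for x
      proof (cases "\<eta> k x = 0")
        case True
        then have em: "\<eta> k x ^ m = 0" using m by simp
        show ?thesis unfolding em by simp
      qed (use that in \<open>simp add: V_def fl_def ph_def quad_def\<close>)
      show ?thesis by (rule iffD2[OF measurable_cong[OF eq] g])
    qed
    show "integrable ?M (\<lambda>x. indicator (closure U) x * bd)"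
    proof (rule integrable_bounded_support[OF \<Omega>, of _ "closure U" "\<bar>bd\<bar>"])
      show "compact (closure U)" using U(2) by (simp add: compact_closure)
      show "(\<lambda>x. indicator (closure U) x * bd) \<in> borel_measurable ?M"
        by (intro measurable_restrict_space1 borel_measurable_times borel_measurable_indicator borel_measurable_const) auto
    qed (auto simp: indicator_def)
    show "AE x in ?M. norm (?f k x) \<le> indicator (closure U) x * bd" for k
      using L(2)
    proof eventually_elim
      case (elim x)
      show ?case
      proof (cases "\<eta> k x = 0")
        case True
        have "G \<ge> 0" using G[of 1 1] S(1) phi_pos[of 1] by (simp add: field_simps)
        then have "bd \<ge> 0" unfolding bd_def using L(1) by (intro mult_nonneg_nonneg) auto
        moreover have em: "\<eta> k x ^ m = 0" using True m by simp
        ultimately show ?thesis unfolding em by (simp add: indicator_def)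
      next
        case False
        then have xU: "x \<in> closure U" using \<eta>0[of x k] closure_subset by blast
        let ?h = "\<eta> k x"
        have h: "0 < ?h" "0 < ?h ^ m" using False \<eta>b[of k x] by auto
        have t: "0 < s * ?h ^ m" using s h by simp
        have "?h ^ m / S \<le> s * ?h ^ m" "s * ?h ^ m \<le> S * ?h ^ m"
          using S h mult_right_mono[of "1 / S" s "?h ^ m"] by auto
        from G[OF h(1) \<eta>b(2) this]
        have g: "\<phi> (s * ?h ^ m) * ?h ^ (m - 1) \<le> G" "flux' (s * ?h ^ m) * ?h ^ (m - 1) \<le> G" by auto
        let ?c = "(\<alpha>\<^sup>2 + \<mu>\<^sup>2 + \<bar>\<alpha> * \<mu>\<bar>) * L"
        have c: "0 \<le> ?c" using L(1) by simp
        have pos: "flux' (s * ?h ^ m) + \<phi> (s * ?h ^ m) > 0" using flux'_pos[OF t] phi_pos[OF t] by linarith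
        \<comment> \<open>The weight (\<eta>^m)^2 is dominated by \<eta>^(m-1), the weight for which
          the growth bound is stated.\<close>
        have "?h ^ m * ?h ^ m \<le> ?h ^ (m - 1) * 1"
          using h \<eta>b[of k x] by (intro mult_mono power_decreasing power_le_one) auto
        then have hm: "(?h ^ m)\<^sup>2 \<le> ?h ^ (m - 1)" by (simp add: power2_eq_square)
        have "\<bar>quad A \<xi> \<alpha> \<mu> (s * ?h ^ m) x\<bar> \<le> (flux' (s * ?h ^ m) + \<phi> (s * ?h ^ m)) * ?c"
          using elim by (intro abs_quad_le[OF t]) auto
        then have "(?h ^ m)\<^sup>2 * \<bar>quad A \<xi> \<alpha> \<mu> (s * ?h ^ m) x\<bar>
            \<le> ?h ^ (m - 1) * ((flux' (s * ?h ^ m) + \<phi> (s * ?h ^ m)) * ?c)"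
          using h by (intro mult_mono[OF hm]) auto
        moreover have "norm (?f k x) = (?h ^ m)\<^sup>2 * \<bar>quad A \<xi> \<alpha> \<mu> (s * ?h ^ m) x\<bar>"
          by (simp add: abs_mult)
        ultimately have "norm (?f k x) \<le> ?h ^ (m - 1) * ((flux' (s * ?h ^ m) + \<phi> (s * ?h ^ m)) * ?c)"
          by simp
        also have "\<dots> = (flux' (s * ?h ^ m) * ?h ^ (m - 1) + \<phi> (s * ?h ^ m) * ?h ^ (m - 1)) * ?c"
          by (simp add: algebra_simps)
        also have "\<dots> \<le> bd" unfolding bd_def using g c by (intro mult_right_mono add_mono) auto
        finally show ?thesis using xU by simp
      qed
    qed
    show "AE x in ?M. (\<lambda>k. ?f k x) \<longlonglongrightarrow> indicator U x * quad A \<xi> \<alpha> \<mu> s x"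
    proof (rule AE_I2)
      fix x
      show "(\<lambda>k. ?f k x) \<longlonglongrightarrow> indicator U x * quad A \<xi> \<alpha> \<mu> s x"
      proof (cases "x \<in> U")
        case True
        then have \<eta>1: "(\<lambda>k. \<eta> k x) \<longlonglongrightarrow> 1" using \<eta>(2)[of x] by simp
        have "(\<lambda>k. s * \<eta> k x ^ m) \<longlonglongrightarrow> s * 1 ^ m" by (intro tendsto_intros \<eta>1)
        then have t: "(\<lambda>k. s * \<eta> k x ^ m) \<longlonglongrightarrow> s" by simp
        have "isCont flux' s" "isCont \<phi> s"
          using continuous_on_interior[OF continuous_flux'] continuous_on_interior[OF continuous_phi] s
          by (auto simp: interior_open)
        then have "(\<lambda>k. flux' (s * \<eta> k x ^ m)) \<longlonglongrightarrow> flux' s" "(\<lambda>k. \<phi> (s * \<eta> k x ^ m)) \<longlonglongrightarrow> \<phi> s"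
          using isCont_tendsto_compose t by blast+
        then have "(\<lambda>k. ?f k x) \<longlonglongrightarrow> (1 ^ m)\<^sup>2 * quad A \<xi> \<alpha> \<mu> s x"
          unfolding quad_def by (intro tendsto_intros \<eta>1)
        then show ?thesis using True by simp
      next
        case False
        then have em: "\<eta> k x ^ m = 0" for k using \<eta>0[of x] m by simp
        show ?thesis unfolding em using False by simp
      qed
    qed
  qed
  then show ?thesis by (rule LIMSEQ_le_const) (use nn in auto)
qed

text \<open>Balls serve twice: they make the form integrable, and they make the open sets of the
  preceding lemma bounded. The open-set criterion is applied to the form extended by zero.\<close>

lemma quad_nonneg_AE:
  fixes A :: "real^'n::finite \<Rightarrow> complex^'n^'n"
  assumes \<Omega>: "open \<Omega>" and A: "Linfinity_matrix \<Omega> A" and diss: "LPhi_dissipative \<Omega> A \<phi>" and s: "s > 0"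
  shows "AE x in lebesgue_on \<Omega>. 0 \<le> quad A \<xi> \<alpha> \<mu> s x"
proof -
  have "AE x in lebesgue. x \<in> \<Omega> \<inter> ball 0 (real j) \<longrightarrow> 0 \<le> quad A \<xi> \<alpha> \<mu> s x" for j
  proof -
    let ?B = "ball (0::real^'n) (real j)"
    define f where "f x = indicator \<Omega> x *\<^sub>R (indicator ?B x * quad A \<xi> \<alpha> \<mu> s x)" for x
    obtain L where L: "L \<ge> 0" "AE x in lebesgue_on \<Omega>. \<bar>(map_matrix Re (A x) *v \<xi>) \<bullet> \<xi>\<bar> \<le> L \<and> \<bar>(map_matrix Im (A x) *v \<xi>) \<bullet> \<xi>\<bar> \<le> L"
      by (rule form_bounded[OF A])
    have "integrable (lebesgue_on \<Omega>) (\<lambda>x. indicator ?B x * quad A \<xi> \<alpha> \<mu> s x)"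
    proof (rule integrable_bounded_support[OF \<Omega> _ compact_cball])
      show "(\<lambda>x. indicator ?B x * quad A \<xi> \<alpha> \<mu> s x) \<in> borel_measurable (lebesgue_on \<Omega>)"
        by (intro borel_measurable_times quad_measurable[OF A] measurable_restrict_space1 borel_measurable_indicator) auto
      show "AE x in lebesgue_on \<Omega>. norm (indicator ?B x * quad A \<xi> \<alpha> \<mu> s x)
          \<le> indicator (cball 0 (real j)) x * ((flux' s + \<phi> s) * ((\<alpha>\<^sup>2 + \<mu>\<^sup>2 + \<bar>\<alpha> * \<mu>\<bar>) * L))"
        using L(2)
      proof eventually_elim
        case (elim x)
        then have "\<bar>quad A \<xi> \<alpha> \<mu> s x\<bar> \<le> (flux' s + \<phi> s) * ((\<alpha>\<^sup>2 + \<mu>\<^sup>2 + \<bar>\<alpha> * \<mu>\<bar>) * L)"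
          by (intro abs_quad_le[OF s]) auto
        moreover from this have "0 \<le> (flux' s + \<phi> s) * ((\<alpha>\<^sup>2 + \<mu>\<^sup>2 + \<bar>\<alpha> * \<mu>\<bar>) * L)" by linarith
        ultimately show ?case by (auto simp: indicator_def)
      qed
    qed
    then have fi: "integrable lebesgue f"
      unfolding f_def using \<Omega> by (subst (asm) integrable_restrict_space) auto
    have "AE x in lebesgue. 0 \<le> f x"
    proof (rule AE_nonneg_if_open_integrals_nonneg[OF fi])
      fix U :: "(real^'n) set" assume U: "open U"
      have "0 \<le> (LINT x|lebesgue_on \<Omega>. indicator (U \<inter> ?B \<inter> \<Omega>) x * quad A \<xi> \<alpha> \<mu> s x)"
        using U \<Omega> by (intro quad_integral_nonneg[OF \<Omega> A diss s]) (auto intro: bounded_subset[OF bounded_ball])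
      also have "\<dots> = (LINT x|lebesgue. indicator \<Omega> x *\<^sub>R (indicator (U \<inter> ?B \<inter> \<Omega>) x * quad A \<xi> \<alpha> \<mu> s x))"
        using \<Omega> by (subst integral_restrict_space) auto
      also have "\<dots> = (LINT x|lebesgue. indicator U x * f x)"
        by (rule Bochner_Integration.integral_cong) (auto simp: f_def indicator_def)
      finally show "0 \<le> (LINT x|lebesgue. indicator U x * f x)" .
    qed
    then show ?thesis by eventually_elim (auto simp: f_def)
  qed
  then have "AE x in lebesgue. \<forall>j. x \<in> \<Omega> \<inter> ball 0 (real j) \<longrightarrow> 0 \<le> quad A \<xi> \<alpha> \<mu> s x"
    unfolding AE_all_countable by blast
  then have "AE x in lebesgue. x \<in> \<Omega> \<longrightarrow> 0 \<le> quad A \<xi> \<alpha> \<mu> s x"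
  proof eventually_elim
    case (elim x)
    obtain j where "norm x < real j" using reals_Archimedean2 by blast
    then show ?case using elim by auto
  qed
  then show ?thesis using \<Omega> by (simp add: AE_restrict_space_iff)
qed

text \<open>The choice \<alpha> = sqrt \<phi>, \<mu> = +- sqrt flux' gives equality in the
  arithmetic-geometric mean inequality flux' \<alpha>^2 + \<phi> \<mu>^2 >= 2 d |\<alpha> \<mu>|
  with d = sqrt(\<phi> flux'), hence the sharpest condition. One factor d then divides out.\<close>

lemma inequality_AE:
  fixes A :: "real^'n::finite \<Rightarrow> complex^'n^'n"
  assumes \<Omega>: "open \<Omega>" and A: "Linfinity_matrix \<Omega> A" and diss: "LPhi_dissipative \<Omega> A \<phi>" and s: "s > 0"
  shows "AE x in lebesgue_on \<Omega>. \<bar>s * deriv \<phi> s\<bar> * \<bar>(map_matrix Im (A x) *v \<xi>) \<bullet> \<xi>\<bar>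
         \<le> 2 * sqrt (\<phi> s * flux' s) * ((map_matrix Re (A x) *v \<xi>) \<bullet> \<xi>)"
  using quad_nonneg_AE[OF assms, of \<xi> "sqrt (\<phi> s)" "sqrt (flux' s)"] quad_nonneg_AE[OF assms, of \<xi> "sqrt (\<phi> s)" "- sqrt (flux' s)"]
proof eventually_elim
  case (elim x)
  define R where "R = (map_matrix Re (A x) *v \<xi>) \<bullet> \<xi>"
  define I where "I = (map_matrix Im (A x) *v \<xi>) \<bullet> \<xi>"
  define d where "d = sqrt (\<phi> s * flux' s)"
  have pos: "\<phi> s > 0" "flux' s > 0" using phi_pos[OF s] flux'_pos[OF s] by auto
  then have d: "d > 0" "d * d = \<phi> s * flux' s" by (simp_all add: d_def)
  have d3: "d = sqrt (\<phi> s) * sqrt (flux' s)" by (simp add: d_def real_sqrt_mult)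
  have sd: "flux' s - \<phi> s = s * deriv \<phi> s" by (simp add: flux'_def)
  have q: "quad A \<xi> (sqrt (\<phi> s)) (\<epsilon> * sqrt (flux' s)) s x = d * (2 * d * R - \<epsilon> * (s * deriv \<phi> s) * I)" if "\<epsilon>\<^sup>2 = 1" for \<epsilon>
  proof -
    have "quad A \<xi> (sqrt (\<phi> s)) (\<epsilon> * sqrt (flux' s)) s x = 2 * (\<phi> s * flux' s) * R - (s * deriv \<phi> s) * sqrt (\<phi> s) * (\<epsilon> * sqrt (flux' s)) * I"
      using pos that unfolding quad_def R_def[symmetric] I_def[symmetric] sd by (simp add: power_mult_distrib)
    also have "\<dots> = d * (2 * d * R - \<epsilon> * (s * deriv \<phi> s) * I)"
      unfolding d(2)[symmetric] by (simp add: d3 algebra_simps)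
    finally show ?thesis .
  qed
  have "0 \<le> d * (2 * d * R - (s * deriv \<phi> s) * I)" "0 \<le> d * (2 * d * R + (s * deriv \<phi> s) * I)"
    using elim q[of 1] q[of "-1"] by simp_all
  then have "\<bar>(s * deriv \<phi> s) * I\<bar> \<le> 2 * d * R" using d(1) by (auto simp: zero_le_mult_iff abs_le_iff)
  then show ?case unfolding R_def I_def d_def by (simp add: abs_mult)
qed

text \<open>So far the null set depends on s and \<xi>. A countable dense set of pairs yields one
  common null set, and off it both sides are continuous in (s, \<xi>), so the inequality passes to
  all pairs.\<close>

lemma inequality_if_dissipative:
  fixes A :: "real^'n::finite \<Rightarrow> complex^'n^'n"
  assumes \<Omega>: "open \<Omega>" and A: "Linfinity_matrix \<Omega> A" and diss: "LPhi_dissipative \<Omega> A \<phi>"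
  shows "AE x in lebesgue_on \<Omega>. \<forall>s>0. \<forall>\<xi>::real^'n. \<bar>s * deriv \<phi> s\<bar> * \<bar>(map_matrix Im (A x) *v \<xi>) \<bullet> \<xi>\<bar>
         \<le> 2 * sqrt (\<phi> s * flux' s) * ((map_matrix Re (A x) *v \<xi>) \<bullet> \<xi>)"
proof -
  let ?S = "{0::real<..} \<times> (UNIV :: (real^'n) set)"
  define l where "l x y = \<bar>fst y * deriv \<phi> (fst y)\<bar> * \<bar>(map_matrix Im (A x) *v snd y) \<bullet> snd y\<bar>" for x and y :: "real \<times> (real^'n)"
  define r where "r x y = 2 * sqrt (\<phi> (fst y) * flux' (fst y)) * ((map_matrix Re (A x) *v snd y) \<bullet> snd y)" for x and y :: "real \<times> (real^'n)"
  obtain T where T: "countable T" "T \<subseteq> ?S" "?S \<subseteq> closure T" by (rule separable[of ?S]) (rule that, assumption+)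
  have op: "open ?S" by (intro open_Times) auto
  have cf: "continuous_on ?S (\<lambda>y. f (fst y))" if "continuous_on {0<..} f" for f :: "real \<Rightarrow> real"
    by (rule continuous_on_compose2[OF that]) (auto intro!: continuous_intros)
  have cm: "continuous_on ?S (\<lambda>y. (M *v snd y) \<bullet> snd y)" for M :: "real^'n^'n"
    by (intro continuous_on_inner bounded_linear.continuous_on[OF matrix_vector_mul_bounded_linear] continuous_intros)
  have cl: "continuous_on ?S (l x)" and cr: "continuous_on ?S (r x)" for x
    unfolding l_def[abs_def] r_def[abs_def]
    by (intro continuous_intros cf cm continuous_deriv_phi continuous_phi continuous_flux')+
  have "AE x in lebesgue_on \<Omega>. \<forall>y\<in>T. l x y \<le> r x y"
    unfolding AE_ball_countable[OF T(1)]
  proof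
    fix y assume "y \<in> T"
    then have "fst y > 0" using T(2) by auto
    from inequality_AE[OF \<Omega> A diss this] show "AE x in lebesgue_on \<Omega>. l x y \<le> r x y"
      unfolding l_def r_def .
  qed
  then show ?thesis
  proof eventually_elim
    case (elim x)
    have "l x y \<le> r x y" if y: "y \<in> ?S" for y
    proof -
      obtain z where z: "\<And>n. z n \<in> T" "z \<longlonglongrightarrow> y"
        using y T(3) closure_sequential[of y T] by blast
      have "isCont (l x) y" "isCont (r x) y"
        using cl[of x] cr[of x] y unfolding continuous_on_eq_continuous_at[OF op] by blast+
      then have "(\<lambda>n. l x (z n)) \<longlonglongrightarrow> l x y" "(\<lambda>n. r x (z n)) \<longlonglongrightarrow> r x y"
        using isCont_tendsto_compose z(2) by blast+
      then show ?thesis by (rule LIMSEQ_le) (use elim z in auto)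
    qed
    from this[of "(_, _)"] show ?case by (simp add: l_def r_def)
  qed
qed

end

theorem theorem1:
  fixes \<Omega> :: "(real^'n::finite) set"
    and A :: "real^'n \<Rightarrow> complex^'n^'n"
    and \<phi> :: "real \<Rightarrow> real"
  assumes "open \<Omega>" "connected \<Omega>" "\<Omega> \<noteq> {}"
    and "Linfinity_matrix \<Omega> A"
    and "admissible \<phi>"
    and "AE x in lebesgue_on \<Omega>. transpose (map_matrix Im (A x)) = map_matrix Im (A x)"
  shows "LPhi_dissipative \<Omega> A \<phi> \<longleftrightarrow>
    (AE x in lebesgue_on \<Omega>. \<forall>s>0. \<forall>\<xi>::real^'n.
       \<bar>s * deriv \<phi> s\<bar> * \<bar>(map_matrix Im (A x) *v \<xi>) \<bullet> \<xi>\<bar>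
         \<le> 2 * sqrt (\<phi> s * deriv (\<lambda>t. t * \<phi> t) s) * ((map_matrix Re (A x) *v \<xi>) \<bullet> \<xi>))"
proof -
  interpret admissible_function \<phi> by unfold_locales (rule assms(5))
  have eq: "(\<forall>s>0. \<forall>\<xi>::real^'n.
       \<bar>s * deriv \<phi> s\<bar> * \<bar>(map_matrix Im (A x) *v \<xi>) \<bullet> \<xi>\<bar>
         \<le> 2 * sqrt (\<phi> s * deriv (\<lambda>t. t * \<phi> t) s) * ((map_matrix Re (A x) *v \<xi>) \<bullet> \<xi>)) \<longleftrightarrow>
      (\<forall>s>0. \<forall>\<xi>::real^'n. \<bar>s * deriv \<phi> s\<bar> * \<bar>(map_matrix Im (A x) *v \<xi>) \<bullet> \<xi>\<bar>
         \<le> 2 * sqrt (\<phi> s * flux' s) * ((map_matrix Re (A x) *v \<xi>) \<bullet> \<xi>))" for x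
    using deriv_flux by auto
  show ?thesis
    unfolding eq
    using dissipative_if_inequality[OF assms(1,6)] inequality_if_dissipative[OF assms(1,4)] by blast
qed

end
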